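(* Let $M$ be an Oeljeklaus--Toma manifold, and let $\phi$ be a holomorphic geometric structure of affine type on $M$. Then $\phi$ is locally homogeneous on $M$. Moreover, the Lie algebra of local holomorphic affine vector fields on $M$ (with respect to the standard complex affine structure of $M$) preserving $\phi$ is transitive on $M$.
   Context: **Oeljeklaus--Toma (OT) manifolds.** Let $F$ be a number field of degree $n=s+2t$ over $\mathbb{Q}$ with $s>0$ real embeddings $\sigma_1,\dots,\sigma_s$ and $2t>0$ non-real complex embeddings $\sigma_{s+1},\dots,\sigma_{s+2t}$, ordered so that $\sigma_{s+i}=\overline{\sigma}_{s+i+t}$ for $1\le i\le t$. Let $\mathcal{O}_F$ be its ring of integers, $\mathcal{O}_F^{*}$ its group of units, and $\mathcal{O}_F^{*,+}\subset\mathcal{O}_F^*$ the subgroup of units $u$ with $\sigma_i(u)>0$ for all $1\le i\le s$. An element $a\in\mathcal{O}_F$ acts on $\mathbb{C}^{s+t}$ by the translation $T_a(z_1,\dots,z_{s+t})=(z_1+\sigma_1(a),\dots,z_{s+t}+\sigma_{s+t}(a))$, and $u\in\mathcal{O}_F^{*}$ acts by $M_u(z_1,\dots,z_{s+t})=(\sigma_1(u)z_1,\dots,\sigma_{s+t}(u)z_{s+t})$. Together, via the affine transformations $M_u\circ T_a$, they give an action of $\mathcal{O}_F^{*,+}\ltimes\mathcal{O}_F$ which preserves $\mathbb{H}^s\times\mathbb{C}^t$ ($\mathbb{H}$ the upper half-plane) and is free there. A subgroup $U\subset\mathcal{O}_F^{*,+}$ is called admissible if the induced action of $U\ltimes\mathcal{O}_F$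 on $\mathbb{H}^s\times\mathbb{C}^t$ is properly discontinuous with compact quotient. An OT manifold is the compact complex manifold $M=(\mathbb{H}^s\times\mathbb{C}^t)/(U\ltimes\mathcal{O}_F)$ for such $F$ and an admissible $U$; it has complex dimension $s+t$. Since the action is by complex affine transformations, the affine structure of $\mathbb{H}^s\times\mathbb{C}^t\subset\mathbb{C}^{s+t}$ descends to the standard complex affine structure on $M$ (equivalently, a flat torsion-free holomorphic affine connection). A local holomorphic affine vector field on $M$ is a holomorphic vector field on an open subset of $M$ which, in the local affine coordinates coming from $\mathbb{C}^{s+t}$, has the form $z\mapsto Az+b$ with $A$ a constant matrix and $b$ a constant vector (these are the Killing fields of the affine structure). **Holomorphic geometric structures.** Let $M$ be a complex manifold of dimension $m$. For $k\ge 1$ let $R^k(M)\to M$ be the holomorphic principal bundle of $k$-frames, i.e. of $k$-jets at $0$ of local biholomorphisms $(\mathbb{C}^m,0)\to M$; its structure group is the complex affine algebraic group $D^k$ of $k$-jets at $0$ of local biholomorphisms of $\mathbb{C}^m$ fixing $0$. A holomorphic geometric structure (of order $k$) on $M$ is a holomorphic $D^k$-equivariant map $\phi:R^k(M)\to Z$, where $Z$ is a complex algebraic manifold endowed with an algebraic action of $D^k$. It is of affine type if $Z$ is a complex affine variety. A local biholomorphism $f$ of $M$ preserves $\phi$ (is a local isometry) if its canonical lift $f^{(k)}$ to $R^k(M)$, $j^k_0 r\mapsto j^k_0(f\circ r)$, preserves each fiber of $\phi$, i.e. $\phi\circ f^{(k)}=\phi$. A local holomorphic vector field on $M$ preserves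 $\phi$ (is a local Killing field of $\phi$) if its local flow acts by local isometries of $\phi$. **Transitivity.** A Lie algebra (sheaf) of local holomorphic vector fields is transitive on an open set $V\subset M$ if for every $x\in V$ the values at $x$ of its members defined near $x$ span $T_xM$. The structure $\phi$ is locally homogeneous on $V$ if its local Killing fields are transitive on $V$; locally homogeneous, without qualification, means on all of $M$. *)

theory Defs
  imports
    "HOL-Analysis.Analysis"
    "HOL-Computational_Algebra.Polynomial"
    "HOL-Combinatorics.Permutations"
    "HOL-Library.Multiset"
begin

section \<open>Several complex variables\<close>

text \<open>
  The dimension of a k-jet space depends on the natural number k, so it cannot be a type.
  Hence C^I, for a finite index set I, is the set of functions supported in I, with the
  (product = Euclidean) topology induced from the function type.
\<close>

definition Cspace :: "'i set \<Rightarrow> ('i \<Rightarrow> complex) set" where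
  "Cspace I = {z. \<forall>i. i \<notin> I \<longrightarrow> z i = 0}"

abbreviation origin :: "'i \<Rightarrow> complex" where
  "origin \<equiv> (\<lambda>_. 0)"

text \<open>
  A function on an open subset S of C^I is holomorphic if it is continuous and holomorphic
  in each variable separately.
\<close>

definition holo_fun :: "'i set \<Rightarrow> ('i \<Rightarrow> complex) set \<Rightarrow> (('i \<Rightarrow> complex) \<Rightarrow> complex) \<Rightarrow> bool" where
  "holo_fun I S f \<longleftrightarrow> openin (top_of_set (Cspace I)) S \<and> continuous_on S f \<and>
     (\<forall>z\<in>S. \<forall>i\<in>I. (\<lambda>w. f (z(i := w))) field_differentiable at (z i))"

definition pd :: "'i \<Rightarrow> (('i \<Rightarrow> complex) \<Rightarrow> complex) \<Rightarrow> ('i \<Rightarrow> complex) \<Rightarrow> complex" where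
  "pd i f z = deriv (\<lambda>w. f (z(i := w))) (z i)"

text \<open>Polynomial functions, in variables indexed by a type.\<close>

inductive poly_fun :: "(('v \<Rightarrow> complex) \<Rightarrow> complex) \<Rightarrow> bool" where
  const: "poly_fun (\<lambda>_. c)"
| var: "poly_fun (\<lambda>z. z v)"
| add: "poly_fun p \<Longrightarrow> poly_fun q \<Longrightarrow> poly_fun (\<lambda>z. p z + q z)"
| mult: "poly_fun p \<Longrightarrow> poly_fun q \<Longrightarrow> poly_fun (\<lambda>z. p z * q z)"


section \<open>Complex manifolds\<close>

text \<open>
  A complex manifold modelled on C^I, where I is \<open>mindex\<close>, so that the dimension is the
  cardinality of I: a topological space with an atlas. A chart is given by its (open) domain
  and its coordinate map to C^I.
\<close>

record ('p, 'i) cmfd =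
  mtop :: "'p topology"
  mindex :: "'i set"
  mcharts :: "('p set \<times> ('p \<Rightarrow> 'i \<Rightarrow> complex)) set"

definition Cmfd :: "'i set \<Rightarrow> ('i \<Rightarrow> complex, 'i) cmfd" where
  "Cmfd I = \<lparr>mtop = top_of_set (Cspace I), mindex = I, mcharts = {(Cspace I, \<lambda>z. z)}\<rparr>"

definition holomorphic_map ::
  "('p, 'i) cmfd \<Rightarrow> ('q, 'j) cmfd \<Rightarrow> 'p set \<Rightarrow> ('p \<Rightarrow> 'q) \<Rightarrow> bool" where
  "holomorphic_map M N W f \<longleftrightarrow> openin (mtop M) W \<and>
     continuous_map (subtopology (mtop M) W) (mtop N) f \<and>
     (\<forall>(V, c)\<in>mcharts M. \<forall>(V', d)\<in>mcharts N. \<forall>j\<in>mindex N.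
        holo_fun (mindex M) (c ` (W \<inter> V \<inter> f -` V')) (\<lambda>z. d (f (inv_into V c z)) j))"

text \<open>f maps the open set W biholomorphically onto an open subset of N.\<close>

definition biholomorphism_on ::
  "('p, 'i) cmfd \<Rightarrow> ('q, 'j) cmfd \<Rightarrow> 'p set \<Rightarrow> ('p \<Rightarrow> 'q) \<Rightarrow> bool" where
  "biholomorphism_on M N W f \<longleftrightarrow> holomorphic_map M N W f \<and> inj_on f W \<and>
     openin (mtop N) (f ` W) \<and> holomorphic_map N M (f ` W) (inv_into W f)"


section \<open>Jets and frame bundles\<close>

text \<open>
  Germs at 0 of local biholomorphisms (C^m, 0) \<open>\<rightarrow>\<close> M, with m = dim M. A germ is
  represented by a total function whose values away from 0 are irrelevant.
\<close>

definition frame_germ :: "('p, 'i) cmfd \<Rightarrow> (('i \<Rightarrow> complex) \<Rightarrow> 'p) \<Rightarrow> bool" where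
  "frame_germ M r \<longleftrightarrow> (\<exists>W. origin \<in> W \<and> biholomorphism_on (Cmfd (mindex M)) M W r)"

text \<open>
  Multi-indices are finite multisets of coordinate indices. The coordinate (i, \<open>\<mu>\<close>) of the
  k-jet at 0 of a C^I-valued map g is the partial derivative of order \<open>\<mu>\<close> of the i-th
  component of g at 0, a constant multiple of a Taylor coefficient. (Sorting \<open>\<mu>\<close> only fixes
  the order of differentiation, which is immaterial.)
\<close>

definition jet_index :: "'i set \<Rightarrow> nat \<Rightarrow> ('i \<times> 'i multiset) set" where
  "jet_index I k = {(i, \<mu>). i \<in> I \<and> set_mset \<mu> \<subseteq> I \<and> size \<mu> \<le> k}"

definition jet_coords ::
  "'i::linorder set \<Rightarrow> nat \<Rightarrow> (('i \<Rightarrow> complex) \<Rightarrow> 'i \<Rightarrow> complex) \<Rightarrow> 'i \<times> 'i multiset \<Rightarrow> complex" where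
  "jet_coords I k g = (\<lambda>(i, \<mu>). if (i, \<mu>) \<in> jet_index I k
     then foldr pd (sorted_list_of_multiset \<mu>) (\<lambda>z. g z i) origin else 0)"

text \<open>The k-jet at 0 of r, as an equivalence class of (representatives of) germs.\<close>

definition jet ::
  "('p, 'i::linorder) cmfd \<Rightarrow> nat \<Rightarrow> (('i \<Rightarrow> complex) \<Rightarrow> 'p) \<Rightarrow> (('i \<Rightarrow> complex) \<Rightarrow> 'p) set" where
  "jet M k r = {r'. frame_germ M r' \<and> r' origin = r origin \<and>
     (\<forall>(V, c)\<in>mcharts M. r origin \<in> V \<longrightarrow>
        jet_coords (mindex M) k (c \<circ> r') = jet_coords (mindex M) k (c \<circ> r))}"

text \<open>
  The bundle R^k(M) of k-frames as a complex manifold. A chart of M induces a chart of R^k(M),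
  given by the partial derivatives of the coordinate expression of the frame; the
  topology is the one for which these charts are homeomorphisms onto open sets.
\<close>

definition frame_chart ::
  "('p, 'i::linorder) cmfd \<Rightarrow> nat \<Rightarrow> 'p set \<times> ('p \<Rightarrow> 'i \<Rightarrow> complex) \<Rightarrow>
   (('i \<Rightarrow> complex) \<Rightarrow> 'p) set set \<times> ((('i \<Rightarrow> complex) \<Rightarrow> 'p) set \<Rightarrow> 'i \<times> 'i multiset \<Rightarrow> complex)" where
  "frame_chart M k C =
     ({jet M k r | r. frame_germ M r \<and> r origin \<in> fst C},
      (\<lambda>\<xi>. jet_coords (mindex M) k (snd C \<circ> (SOME r. r \<in> \<xi>))))"

definition frame_bundle ::
  "('p, 'i::linorder) cmfd \<Rightarrow> nat \<Rightarrow> ((('i \<Rightarrow> complex) \<Rightarrow> 'p) set, 'i \<times> 'i multiset) cmfd" where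
  "frame_bundle M k =
     \<lparr>mtop = topology_generated_by
        {D \<inter> e -` S | D e S. (D, e) \<in> frame_chart M k ` mcharts M \<and>
           openin (top_of_set (Cspace (jet_index (mindex M) k))) S},
      mindex = jet_index (mindex M) k,
      mcharts = frame_chart M k ` mcharts M\<rparr>"


section \<open>The jet group and its algebraic actions on affine varieties\<close>

text \<open>
  The group D^k of k-jets at 0 of local biholomorphisms g of C^I fixing 0, with
  composition. Its coordinates are \<open>jet_coords I k g\<close>, and it is the principal open subset
  where the determinant of the linear part does not vanish. So a regular
  function on the product of D^k and an affine variety Z is a polynomial in the coordinates of both
  factors, divided by a power of that determinant.
\<close>

definition fixing_germ :: "'i set \<Rightarrow> (('i \<Rightarrow> complex) \<Rightarrow> 'i \<Rightarrow> complex) \<Rightarrow> bool" where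
  "fixing_germ I g \<longleftrightarrow> frame_germ (Cmfd I) g \<and> g origin = origin"

definition linear_part_det ::
  "'i::linorder set \<Rightarrow> (('i \<Rightarrow> complex) \<Rightarrow> 'i \<Rightarrow> complex) \<Rightarrow> complex" where
  "linear_part_det I g =
     (\<Sum>p | p permutes I. of_int (sign p) * (\<Prod>i\<in>I. pd (p i) (\<lambda>z. g z i) origin))"

definition algebraic_set :: "'l set \<Rightarrow> ('l \<Rightarrow> complex) set \<Rightarrow> bool" where
  "algebraic_set L Z \<longleftrightarrow>
     (\<exists>P. (\<forall>p\<in>P. poly_fun p) \<and> Z = {z \<in> Cspace L. \<forall>p\<in>P. p z = 0})"

text \<open>
  Nonsingularity (Jacobian criterion): near each of its points, Z is cut out by polynomials
  vanishing on Z whose differentials are linearly independent at that point.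
\<close>

definition nonsingular :: "'l set \<Rightarrow> ('l \<Rightarrow> complex) set \<Rightarrow> bool" where
  "nonsingular L Z \<longleftrightarrow>
     (\<forall>z\<in>Z. \<exists>n (p :: nat \<Rightarrow> ('l \<Rightarrow> complex) \<Rightarrow> complex) W.
        (\<forall>a<n. poly_fun (p a) \<and> (\<forall>w\<in>Z. p a w = 0)) \<and>
        openin (top_of_set (Cspace L)) W \<and> z \<in> W \<and>
        Z \<inter> W = {w \<in> W. \<forall>a<n. p a w = 0} \<and>
        (\<forall>c. (\<forall>l\<in>L. (\<Sum>a<n. c a * pd l (p a) z) = 0) \<longrightarrow> (\<forall>a<n. c a = 0)))"

text \<open>A smooth complex affine variety: a closed nonsingular algebraic subset of C^L, not
  necessarily irreducible.\<close>

definition smooth_affine_variety :: "'l set \<Rightarrow> ('l \<Rightarrow> complex) set \<Rightarrow> bool" where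
  "smooth_affine_variety L Z \<longleftrightarrow> finite L \<and> algebraic_set L Z \<and> nonsingular L Z"

definition algebraic_jet_action ::
  "'i::linorder set \<Rightarrow> nat \<Rightarrow> 'l set \<Rightarrow> ('l \<Rightarrow> complex) set \<Rightarrow>
   ((('i \<Rightarrow> complex) \<Rightarrow> 'i \<Rightarrow> complex) set \<Rightarrow> ('l \<Rightarrow> complex) \<Rightarrow> 'l \<Rightarrow> complex) \<Rightarrow> bool" where
  "algebraic_jet_action I k L Z act \<longleftrightarrow>
     (\<forall>g z. fixing_germ I g \<and> z \<in> Z \<longrightarrow> act (jet (Cmfd I) k g) z \<in> Z) \<and>
     (\<forall>z\<in>Z. act (jet (Cmfd I) k (\<lambda>w. w)) z = z) \<and>
     (\<forall>g h z. fixing_germ I g \<and> fixing_germ I h \<and> z \<in> Z \<longrightarrow>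
        act (jet (Cmfd I) k (g \<circ> h)) z = act (jet (Cmfd I) k g) (act (jet (Cmfd I) k h) z)) \<and>
     (\<forall>l\<in>L. \<exists>P e. poly_fun P \<and>
        (\<forall>g z. fixing_germ I g \<and> z \<in> Z \<longrightarrow>
           act (jet (Cmfd I) k g) z l =
             P (case_sum (jet_coords I k g) z) / linear_part_det I g ^ e))"


section \<open>Holomorphic geometric structures of affine type\<close>

text \<open>
  D^k acts on R^k(M) on the right by precomposition and on Z on the left. Equivariance
  thus means \<open>\<phi>(\<xi>\<cdot>\<gamma>) = \<gamma>\<^sup>-\<^sup>1 \<cdot> \<phi>(\<xi>)\<close>, that is, \<open>\<gamma> \<cdot> \<phi>(\<xi>\<cdot>\<gamma>) = \<phi>(\<xi>)\<close>.
\<close>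

definition affine_geometric_structure ::
  "('p, 'i::linorder) cmfd \<Rightarrow> nat \<Rightarrow> 'l set \<Rightarrow> ('l \<Rightarrow> complex) set \<Rightarrow>
   ((('i \<Rightarrow> complex) \<Rightarrow> 'i \<Rightarrow> complex) set \<Rightarrow> ('l \<Rightarrow> complex) \<Rightarrow> 'l \<Rightarrow> complex) \<Rightarrow>
   ((('i \<Rightarrow> complex) \<Rightarrow> 'p) set \<Rightarrow> 'l \<Rightarrow> complex) \<Rightarrow> bool" where
  "affine_geometric_structure M k L Z act \<phi> \<longleftrightarrow> k \<ge> 1 \<and>
     smooth_affine_variety L Z \<and> algebraic_jet_action (mindex M) k L Z act \<and>
     holomorphic_map (frame_bundle M k) (Cmfd L) (topspace (mtop (frame_bundle M k))) \<phi> \<and>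
     \<phi> ` topspace (mtop (frame_bundle M k)) \<subseteq> Z \<and>
     (\<forall>r g. frame_germ M r \<and> fixing_germ (mindex M) g \<longrightarrow>
        act (jet (Cmfd (mindex M)) k g) (\<phi> (jet M k (r \<circ> g))) = \<phi> (jet M k r))"

definition local_isometry ::
  "('p, 'i::linorder) cmfd \<Rightarrow> nat \<Rightarrow> ((('i \<Rightarrow> complex) \<Rightarrow> 'p) set \<Rightarrow> 'z) \<Rightarrow>
   'p set \<Rightarrow> ('p \<Rightarrow> 'p) \<Rightarrow> bool" where
  "local_isometry M k \<phi> W f \<longleftrightarrow> biholomorphism_on M M W f \<and>
     (\<forall>r. frame_germ M r \<and> r origin \<in> W \<longrightarrow> \<phi> (jet M k (f \<circ> r)) = \<phi> (jet M k r))"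


section \<open>Vector fields\<close>

text \<open>
  A tangent vector at p is a family of coordinate vectors, one for each chart at p,
  related by the differentials of the transition maps (and set to 0 on the other charts).
\<close>

type_synonym ('p, 'i) tvec = "'p set \<times> ('p \<Rightarrow> 'i \<Rightarrow> complex) \<Rightarrow> 'i \<Rightarrow> complex"

definition tangent_space :: "('p, 'i) cmfd \<Rightarrow> 'p \<Rightarrow> ('p, 'i) tvec set" where
  "tangent_space M p = {v.
     (\<forall>C. C \<notin> mcharts M \<or> p \<notin> fst C \<longrightarrow> v C = origin) \<and>
     (\<forall>C\<in>mcharts M. p \<in> fst C \<longrightarrow> v C \<in> Cspace (mindex M)) \<and>
     (\<forall>C\<in>mcharts M. \<forall>C'\<in>mcharts M. p \<in> fst C \<and> p \<in> fst C' \<longrightarrow>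
        (\<forall>i\<in>mindex M. v C' i =
           (\<Sum>j\<in>mindex M. pd j (\<lambda>z. snd C' (inv_into (fst C) (snd C) z) i) (snd C p) * v C j)))}"

definition holomorphic_vector_field ::
  "('p, 'i) cmfd \<Rightarrow> 'p set \<Rightarrow> ('p \<Rightarrow> ('p, 'i) tvec) \<Rightarrow> bool" where
  "holomorphic_vector_field M V X \<longleftrightarrow> openin (mtop M) V \<and>
     (\<forall>p\<in>V. X p \<in> tangent_space M p) \<and>
     (\<forall>C\<in>mcharts M. \<forall>i\<in>mindex M.
        holo_fun (mindex M) (snd C ` (V \<inter> fst C)) (\<lambda>z. X (inv_into (fst C) (snd C) z) C i))"

text \<open>Holomorphic integral curves in V, in complex time of absolute value less than \<open>\<epsilon>\<close>.\<close>

definition integral_curve ::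
  "('p, 'i) cmfd \<Rightarrow> 'p set \<Rightarrow> ('p \<Rightarrow> ('p, 'i) tvec) \<Rightarrow> real \<Rightarrow> (complex \<Rightarrow> 'p) \<Rightarrow> bool" where
  "integral_curve M V X \<epsilon> \<gamma> \<longleftrightarrow>
     continuous_map (top_of_set (ball 0 \<epsilon>)) (subtopology (mtop M) V) \<gamma> \<and>
     (\<forall>\<tau>\<in>ball 0 \<epsilon>. \<forall>C\<in>mcharts M. \<gamma> \<tau> \<in> fst C \<longrightarrow>
        (\<forall>i\<in>mindex M.
           ((\<lambda>w. snd C (\<gamma> w) i) has_field_derivative X (\<gamma> \<tau>) C i) (at \<tau>)))"

text \<open>
  X is a Killing field on V if around each point of V its local flow \<open>\<Psi>\<close>, which is
  unique, acts by local isometries.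
\<close>

definition killing_field ::
  "('p, 'i::linorder) cmfd \<Rightarrow> nat \<Rightarrow> ((('i \<Rightarrow> complex) \<Rightarrow> 'p) set \<Rightarrow> 'z) \<Rightarrow>
   'p set \<Rightarrow> ('p \<Rightarrow> ('p, 'i) tvec) \<Rightarrow> bool" where
  "killing_field M k \<phi> V X \<longleftrightarrow> holomorphic_vector_field M V X \<and>
     (\<forall>x\<in>V. \<exists>W \<epsilon> \<Psi>. openin (mtop M) W \<and> x \<in> W \<and> W \<subseteq> V \<and> \<epsilon> > 0 \<and>
        (\<forall>p\<in>W. \<Psi> 0 p = p \<and> integral_curve M V X \<epsilon> (\<lambda>\<tau>. \<Psi> \<tau> p)) \<and>
        (\<forall>\<tau>\<in>ball 0 \<epsilon>. local_isometry M k \<phi> W (\<Psi> \<tau>)))"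

text \<open>
  The next definition presupposes that the transition maps of the atlas are locally
  affine, so that the atlas also defines a complex affine structure on M.
\<close>

definition affine_vector_field ::
  "('p, 'i) cmfd \<Rightarrow> 'p set \<Rightarrow> ('p \<Rightarrow> ('p, 'i) tvec) \<Rightarrow> bool" where
  "affine_vector_field M V X \<longleftrightarrow> holomorphic_vector_field M V X \<and>
     (\<forall>C\<in>mcharts M. \<forall>p\<in>V \<inter> fst C.
        \<exists>W (A :: 'i \<Rightarrow> 'i \<Rightarrow> complex) b. openin (mtop M) W \<and> p \<in> W \<and> W \<subseteq> V \<inter> fst C \<and>
          (\<forall>q\<in>W. \<forall>i\<in>mindex M. X q C i = (\<Sum>j\<in>mindex M. A i j * snd C q j) + b i))"

text \<open>A sheaf of local vector fields is given as the set of pairs (V, X), X being a section over V.\<close>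

definition transitive_on ::
  "('p, 'i) cmfd \<Rightarrow> 'p set \<Rightarrow> ('p set \<times> ('p \<Rightarrow> ('p, 'i) tvec)) set \<Rightarrow> bool" where
  "transitive_on M S \<L> \<longleftrightarrow>
     (\<forall>x\<in>S. \<forall>v\<in>tangent_space M x. \<exists>(n::nat) X c.
        (\<forall>a<n. \<exists>V. (V, X a) \<in> \<L> \<and> x \<in> V) \<and>
        (\<forall>C i. v C i = (\<Sum>a<n. c a * X a x C i)))"

definition locally_homogeneous_on ::
  "('p, 'i::linorder) cmfd \<Rightarrow> nat \<Rightarrow> ((('i \<Rightarrow> complex) \<Rightarrow> 'p) set \<Rightarrow> 'z) \<Rightarrow> 'p set \<Rightarrow> bool" where
  "locally_homogeneous_on M k \<phi> S \<longleftrightarrow> transitive_on M S {(V, X). killing_field M k \<phi> V X}"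


section \<open>Oeljeklaus--Toma manifolds\<close>

definition number_field_of_degree :: "'f::field_char_0 itself \<Rightarrow> nat \<Rightarrow> bool" where
  "number_field_of_degree _ n \<longleftrightarrow>
     (\<exists>B::'f set. finite B \<and> card B = n \<and>
        \<not> module.dependent (\<lambda>(q::rat) x. of_rat q * x) B \<and>
        module.span (\<lambda>(q::rat) x. of_rat q * x) B = UNIV)"

definition field_embedding :: "('f::field_char_0 \<Rightarrow> complex) \<Rightarrow> bool" where
  "field_embedding h \<longleftrightarrow> h 1 = 1 \<and> (\<forall>x y. h (x + y) = h x + h y) \<and> (\<forall>x y. h (x * y) = h x * h y)"

definition ordered_embeddings :: "nat \<Rightarrow> nat \<Rightarrow> (nat \<Rightarrow> 'f::field_char_0 \<Rightarrow> complex) \<Rightarrow> bool" where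
  "ordered_embeddings s t \<sigma> \<longleftrightarrow>
     number_field_of_degree TYPE('f) (s + 2 * t) \<and>
     bij_betw \<sigma> {1..s + 2 * t} {h. field_embedding h} \<and>
     (\<forall>i\<in>{1..s}. range (\<sigma> i) \<subseteq> \<real>) \<and>
     (\<forall>i\<in>{s + 1..s + 2 * t}. \<not> range (\<sigma> i) \<subseteq> \<real>) \<and>
     (\<forall>i\<in>{1..t}. \<forall>x. \<sigma> (s + i) x = cnj (\<sigma> (s + i + t) x))"

definition integers_of :: "'f::field_char_0 set" where
  "integers_of = {a. algebraic_int a}"

text \<open>For the real embeddings, \<open>0 < Re (\<sigma> i u)\<close> means that \<open>\<sigma> i u\<close> is positive.\<close>

definition positive_units :: "nat \<Rightarrow> (nat \<Rightarrow> 'f::field_char_0 \<Rightarrow> complex) \<Rightarrow> 'f set" where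
  "positive_units s \<sigma> =
     {u \<in> integers_of. u \<noteq> 0 \<and> inverse u \<in> integers_of \<and> (\<forall>i\<in>{1..s}. Re (\<sigma> i u) > 0)}"

definition ot_domain :: "nat \<Rightarrow> nat \<Rightarrow> (nat \<Rightarrow> complex) set" where
  "ot_domain s t = {z \<in> Cspace {1..s + t}. \<forall>i\<in>{1..s}. Im (z i) > 0}"

text \<open>The affine transformation \<open>M\<^sub>u \<circ> T\<^sub>a\<close> of C^(s+t).\<close>

definition ot_map ::
  "nat \<Rightarrow> nat \<Rightarrow> (nat \<Rightarrow> 'f::field_char_0 \<Rightarrow> complex) \<Rightarrow> 'f \<Rightarrow> 'f \<Rightarrow> (nat \<Rightarrow> complex) \<Rightarrow> nat \<Rightarrow> complex" where
  "ot_map s t \<sigma> u a z = (\<lambda>i. if i \<in> {1..s + t} then \<sigma> i u * (z i + \<sigma> i a) else 0)"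

definition ot_orbit ::
  "nat \<Rightarrow> nat \<Rightarrow> (nat \<Rightarrow> 'f::field_char_0 \<Rightarrow> complex) \<Rightarrow> 'f set \<Rightarrow> (nat \<Rightarrow> complex) \<Rightarrow> (nat \<Rightarrow> complex) set" where
  "ot_orbit s t \<sigma> U z = {ot_map s t \<sigma> u a z | u a. u \<in> U \<and> a \<in> integers_of}"

text \<open>The quotient topology on the set of orbits: the preimage of a set S of orbits is \<open>\<Union>S\<close>.\<close>

definition ot_topology ::
  "nat \<Rightarrow> nat \<Rightarrow> (nat \<Rightarrow> 'f::field_char_0 \<Rightarrow> complex) \<Rightarrow> 'f set \<Rightarrow> (nat \<Rightarrow> complex) set topology" where
  "ot_topology s t \<sigma> U = topology (\<lambda>S. S \<subseteq> ot_orbit s t \<sigma> U ` ot_domain s t \<and>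
     openin (top_of_set (ot_domain s t)) (\<Union>S))"

definition admissible :: "nat \<Rightarrow> nat \<Rightarrow> (nat \<Rightarrow> 'f::field_char_0 \<Rightarrow> complex) \<Rightarrow> 'f set \<Rightarrow> bool" where
  "admissible s t \<sigma> U \<longleftrightarrow>
     U \<subseteq> positive_units s \<sigma> \<and> 1 \<in> U \<and> (\<forall>u\<in>U. \<forall>v\<in>U. u * v \<in> U) \<and> (\<forall>u\<in>U. inverse u \<in> U) \<and>
     (\<forall>K. compact K \<and> K \<subseteq> ot_domain s t \<longrightarrow>
        finite {(u, a). u \<in> U \<and> a \<in> integers_of \<and> ot_map s t \<sigma> u a ` K \<inter> K \<noteq> {}}) \<and>
     compact_space (ot_topology s t \<sigma> U)"

text \<open>
  The points are the orbits. The charts are the inverses of the quotient map on the open sets W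
  on which it is injective; their transition maps are locally of the form \<open>M\<^sub>u \<circ> T\<^sub>a\<close>, so that
  this atlas defines both the complex structure and the standard affine structure.
\<close>

definition ot_manifold ::
  "nat \<Rightarrow> nat \<Rightarrow> (nat \<Rightarrow> 'f::field_char_0 \<Rightarrow> complex) \<Rightarrow> 'f set \<Rightarrow> ((nat \<Rightarrow> complex) set, nat) cmfd" where
  "ot_manifold s t \<sigma> U =
     \<lparr>mtop = ot_topology s t \<sigma> U,
      mindex = {1..s + t},
      mcharts = {(ot_orbit s t \<sigma> U ` W, \<lambda>p. THE z. z \<in> p \<inter> W) | W.
        openin (top_of_set (ot_domain s t)) W \<and> inj_on (ot_orbit s t \<sigma> U) W}\<rparr>"

end

theory Submission
  imports Defs "HOL-Complex_Analysis.Complex_Analysis" "HOL-Real_Asymp.Real_Asymp" "Jordan_Normal_Form.Char_Poly"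
begin

text \<open>
  Let \<open>\<Omega>\<close> be the domain \<open>H\<^sup>s \<times> \<complex>\<^sup>t\<close> and \<open>\<pi>\<close> its projection to the OT manifold M. The local vector fields
  on M that are constant on \<open>\<Omega>\<close> are affine and transitive. The theorem holds because all of them
  are Killing fields: a holomorphic geometric structure \<open>\<phi>\<close> of affine type is invariant under all local
  translations.

  Translations take the standard frame at \<open>\<pi> z\<close>, the projection of the translation of 0 to z, to
  the standard frame at another point. Any frame at \<open>\<pi> z\<close> is the standard frame composed with a germ g that fixes 0
  (\<open>frame_germ_lift\<close>), and a translation moves z and keeps g. By equivariance it
  therefore suffices that \<open>\<phi>\<close> takes the same value on all standard frames
  (\<open>structure_translation_invariant\<close>). As a function of z, this value is holomorphic. It is also invariant
  under translation by the integers of the number field, because deck transformations \<open>T\<^sub>a\<close> do not change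
  the projection. Because \<open>\<phi>\<close> is of affine type, its components are complex-valued
  functions, and what remains is that a holomorphic function F on \<open>\<Omega>\<close> that is periodic with respect to the
  integers is constant (\<open>periodic_holomorphic_constant\<close>).

  For this, fix the imaginary parts of the coordinates at the real places. The integers form a cocompact
  lattice in \<open>\<real>\<^sup>s \<times> \<complex>\<^sup>t\<close> (\<open>bounded_distance_to_lattice\<close>), so F is bounded on what is left, and
  by Liouville's theorem it does not depend on the coordinates at the complex places. As t is positive, the projection of the
  lattice to \<open>\<real>\<^sup>s\<close> is dense (\<open>real_places_dense\<close>). By continuity F is invariant under real
  translations, so its derivatives at the real places vanish as well.

  Two ingredients are developed along the way. Algebraic integers form a ring, which makes the orbits
  an equivalence relation. And partial derivatives of holomorphic functions are
  holomorphic (\<open>holo_fun_pd\<close>), which is needed to see that the jet of a frame in one chart determines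
  it in the others, hence that jet coordinates are injective on the frame bundle.
\<close>

section \<open>Functions on complex coordinate space\<close>

lemma zero_in_Cspace: "origin \<in> Cspace I" by (simp add: Cspace_def)

lemma Cspace_upd: "z \<in> Cspace I \<Longrightarrow> i \<in> I \<Longrightarrow> z(i := w) \<in> Cspace I"
  by (auto simp: Cspace_def)

abbreviation open_in :: "'i set \<Rightarrow> ('i \<Rightarrow> complex) set \<Rightarrow> bool" where
  "open_in I S \<equiv> openin (top_of_set (Cspace I)) S"

definition polydisc :: "'i set \<Rightarrow> ('i \<Rightarrow> complex) \<Rightarrow> real \<Rightarrow> ('i \<Rightarrow> complex) set" where
  "polydisc I z r = {w \<in> Cspace I. \<forall>i\<in>I. dist (w i) (z i) < r}"

lemma polydisc_center: "z \<in> Cspace I \<Longrightarrow> 0 < r \<Longrightarrow> z \<in> polydisc I z r"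
  by (auto simp: polydisc_def)

lemma open_in_polydisc:
  assumes "finite I"
  shows "open_in I (polydisc I z r)"
proof -
  define X where "X = (\<lambda>i. if i \<in> I then ball (z i) r else UNIV)"
  have "open (Pi\<^sub>E UNIV X)"
  proof (rule open_PiE)
    show "\<And>i. open (X i)" by (simp add: X_def)
    show "finite {i. X i \<noteq> UNIV}" by (rule finite_subset[OF _ assms]) (auto simp: X_def)
  qed
  moreover have "polydisc I z r = Cspace I \<inter> Pi\<^sub>E UNIV X"
    by (auto simp: polydisc_def X_def PiE_def Pi_def dist_commute split: if_splits)
  ultimately show ?thesis by (auto simp: openin_open)
qed

text \<open>
  The topology of \<open>'i \<Rightarrow> complex\<close> has neighbourhoods that restrict finitely many coordinates, each with a
  radius of its own. On C^I all coordinates outside the finite set I are 0, so the least of the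
  radii over I gives a polydisc.
\<close>

lemma open_in_contains_polydisc:
  assumes I: "finite I" and S: "open_in I S" and z: "z \<in> S"
  shows "\<exists>r>0. polydisc I z r \<subseteq> S"
proof -
  obtain T where T: "open T" "S = Cspace I \<inter> T" using S by (auto simp: openin_open)
  have "z \<in> T" using T z by auto
  from product_topology_open_contains_basis[of "\<lambda>_. euclidean" UNIV T z] T(1) this
  obtain X where X: "z \<in> Pi\<^sub>E UNIV X" "\<And>i. open (X i)" "Pi\<^sub>E UNIV X \<subseteq> T"
    by (auto simp: open_fun_def)
  have "\<forall>i. \<exists>r>0. ball (z i) r \<subseteq> X i"
    using X(1,2) by (metis PiE_mem UNIV_I openE)
  then obtain r where r: "\<And>i. r i > 0" "\<And>i. ball (z i) (r i) \<subseteq> X i" by metis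
  define R where "R = Min (insert 1 (r ` I))"
  have R: "R > 0" "\<And>i. i \<in> I \<Longrightarrow> R \<le> r i" unfolding R_def using I r(1) by auto
  have "polydisc I z R \<subseteq> S"
  proof
    fix w assume w: "w \<in> polydisc I z R"
    have "w i \<in> X i" for i
    proof (cases "i \<in> I")
      case True
      then have "dist (z i) (w i) < r i" using w R(2)[OF True] by (auto simp: polydisc_def dist_commute)
      then show ?thesis using r(2)[of i] by auto
    next
      case False
      then have "w i = z i" using w z T(2) by (auto simp: polydisc_def Cspace_def)
      then show ?thesis using X(1) by (auto simp: PiE_def)
    qed
    then have "w \<in> T" using X(3) by (auto simp: PiE_def)
    then show "w \<in> S" using w T(2) by (auto simp: polydisc_def)
  qed
  then show ?thesis using R(1) by blast
qed

lemma open_in_slice: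
  assumes "finite I" "open_in I S" "z \<in> Cspace I" "i \<in> I"
  shows "open {w. z(i := w) \<in> S}"
  unfolding open_contains_ball
proof (intro ballI)
  fix w assume "w \<in> {w. z(i := w) \<in> S}"
  then obtain r where r: "r > 0" "polydisc I (z(i := w)) r \<subseteq> S"
    using open_in_contains_polydisc[OF assms(1,2)] by blast
  have "ball w r \<subseteq> {w. z(i := w) \<in> S}"
  proof
    fix w' assume "w' \<in> ball w r"
    then have "z(i := w') \<in> polydisc I (z(i := w)) r"
      using r(1) assms(3,4) by (auto simp: polydisc_def Cspace_def dist_commute)
    then show "w' \<in> {w. z(i := w) \<in> S}" using r(2) by auto
  qed
  then show "\<exists>e>0. ball w e \<subseteq> {w. z(i := w) \<in> S}" using r(1) by blast
qed

lemma holo_fun_diff: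
  "holo_fun I S f \<Longrightarrow> z \<in> S \<Longrightarrow> i \<in> I \<Longrightarrow> (\<lambda>w. f (z(i := w))) field_differentiable at (z i)"
  by (simp add: holo_fun_def)

lemma holo_fun_slice:
  assumes "finite I" "holo_fun I S f" "z \<in> Cspace I" "i \<in> I"
  shows "(\<lambda>w. f (z(i := w))) holomorphic_on {w. z(i := w) \<in> S}"
proof (rule holomorphic_onI)
  fix w assume "w \<in> {w. z(i := w) \<in> S}"
  then have "(\<lambda>w'. f ((z(i := w))(i := w'))) field_differentiable at ((z(i := w)) i)"
    using holo_fun_diff[OF assms(2) _ assms(4)] by blast
  then show "(\<lambda>w. f (z(i := w))) field_differentiable at w within {w. z(i := w) \<in> S}"
    by (simp add: field_differentiable_at_within)
qed

lemma holo_fun_openin: "holo_fun I S f \<Longrightarrow> open_in I S"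
  by (simp add: holo_fun_def)

lemma holo_fun_sub: "holo_fun I S f \<Longrightarrow> S \<subseteq> Cspace I"
  using holo_fun_openin openin_imp_subset by blast

lemma eventually_slice:
  assumes "finite I" "open_in I S" "z \<in> S" "i \<in> I"
  shows "\<forall>\<^sub>F w in nhds (z i). z(i := w) \<in> S"
proof -
  have "z \<in> Cspace I" using assms(2,3) openin_imp_subset by blast
  from open_in_slice[OF assms(1,2) this assms(4)] show ?thesis
    using assms(3) eventually_nhds_in_open[of "{w. z(i := w) \<in> S}" "z i"] by simp
qed

lemma holo_fun_cong:
  assumes "finite I" "open_in I S" "S \<subseteq> S'" "holo_fun I S' f"
    "\<And>z. z \<in> S \<Longrightarrow> g z = f z"
  shows "holo_fun I S g"
  unfolding holo_fun_def
proof (intro conjI ballI)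
  show "continuous_on S g"
  proof -
    have "continuous_on S f" using assms(3,4) continuous_on_subset unfolding holo_fun_def by blast
    then show ?thesis by (rule continuous_on_eq) (simp add: assms(5))
  qed
  fix z i assume zi: "z \<in> S" "i \<in> I"
  have "(\<lambda>w. f (z(i := w))) field_differentiable at (z i)"
    by (rule holo_fun_diff[OF assms(4) subsetD[OF assms(3) zi(1)] zi(2)])
  moreover have "\<forall>\<^sub>F w in nhds (z i). f (z(i := w)) = g (z(i := w))"
    using eventually_slice[OF assms(1,2) zi] by eventually_elim (simp add: assms(5))
  ultimately show "(\<lambda>w. g (z(i := w))) field_differentiable at (z i)"
    unfolding field_differentiable_def by (simp add: DERIV_cong_ev[OF refl _ refl])
qed (use assms in auto)

lemma pd_cong:
  assumes "finite I" "open_in I S" "z \<in> S" "i \<in> I"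
    "\<And>z. z \<in> S \<Longrightarrow> f z = g z"
  shows "pd i f z = pd i g z"
proof -
  have "\<forall>\<^sub>F w in nhds (z i). f (z(i := w)) = g (z(i := w))"
    using eventually_slice[OF assms(1-4)] by eventually_elim (simp add: assms(5))
  then show ?thesis unfolding pd_def by (intro deriv_cong_ev) auto
qed

lemma foldr_pd_cong:
  assumes "finite I" "open_in I S" "set l \<subseteq> I"
    "\<And>z. z \<in> S \<Longrightarrow> f z = g z" "z \<in> S"
  shows "foldr pd l f z = foldr pd l g z"
  using assms(3,5)
proof (induction l arbitrary: z)
  case Nil then show ?case using assms(4) by simp
next
  case (Cons i l)
  have "pd i (foldr pd l f) z = pd i (foldr pd l g) z"
    by (rule pd_cong[OF assms(1,2) Cons.prems(2)]) (use Cons in auto)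
  then show ?case by (simp only: foldr.simps o_apply)
qed

lemma continuous_on_local:
  assumes "\<And>z. z \<in> S \<Longrightarrow> \<exists>T. openin (top_of_set S) T \<and> z \<in> T \<and> continuous_on T f"
  shows "continuous_on S f"
  unfolding continuous_on_def
proof
  fix z assume z: "z \<in> S"
  then obtain T where T: "openin (top_of_set S) T" "z \<in> T" "continuous_on T f" using assms by blast
  then obtain O' where O: "open O'" "T = S \<inter> O'" by (auto simp: openin_open)
  have "at z within T = at z within S"
    using O T(2) by (intro at_within_nhd[of _ O']) auto
  then show "(f \<longlongrightarrow> f z) (at z within S)" using T(2,3) by (auto simp: continuous_on_def)
qed

lemma continuous_on_upd:
  "continuous_on A (\<lambda>z::'i \<Rightarrow> complex. z(i := g z))" if "continuous_on A g"
proof (rule continuous_on_coordinatewise_then_product)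
  fix j
  have "continuous_on A (\<lambda>z::'i \<Rightarrow> complex. z j)"
    by (rule continuous_on_subset[OF continuous_on_product_coordinates]) auto
  then show "continuous_on A (\<lambda>z. (z(i := g z)) j)"
    using that by (cases "j = i") auto
qed

text \<open>
  Taylor's formula with Cauchy's estimate for the second derivative. The bound depends on g
  only through B, and this uniformity is what makes difference quotients converge
  uniformly in the next lemma.
\<close>

lemma second_order_bound:
  assumes "g holomorphic_on ball 0 (3 * \<rho>)" "\<And>w. w \<in> ball 0 (3 * \<rho>) \<Longrightarrow> norm (g w) \<le> B"
    "\<rho> > 0" "norm h < \<rho>"
  shows "norm (g h - g 0 - deriv g 0 * h) \<le> 2 * B / \<rho>\<^sup>2 * norm h ^ 2"
proof -
  define F where "F = (\<lambda>i::nat. (deriv ^^ i) g)"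
  have d: "(F i has_field_derivative F (Suc i) x) (at x within ball 0 \<rho>)" if "x \<in> ball 0 \<rho>" for i x
  proof -
    have "F i holomorphic_on ball 0 (3 * \<rho>)" unfolding F_def
      using assms(1) by (intro holomorphic_higher_deriv) auto
    then have "(F i has_field_derivative deriv (F i) x) (at x)"
      using that assms(3) by (intro holomorphic_derivI[of _ "ball 0 (3 * \<rho>)"]) auto
    then show ?thesis unfolding F_def by (auto intro: DERIV_subset)
  qed
  have b: "norm (F (Suc 1) x) \<le> 2 * B / \<rho>\<^sup>2" if x: "x \<in> ball 0 \<rho>" for x
  proof -
    have sub: "cball x \<rho> \<subseteq> ball 0 (3 * \<rho>)"
    proof
      fix y assume "y \<in> cball x \<rho>"
      then have "dist 0 y < 3 * \<rho>" using x dist_triangle[of 0 y x] assms(3) by (auto simp: dist_commute)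
      then show "y \<in> ball 0 (3 * \<rho>)" by simp
    qed
    have "norm ((deriv ^^ 2) g x) \<le> fact 2 * B / \<rho> ^ 2"
    proof (rule Cauchy_inequality)
      show "g holomorphic_on ball x \<rho>" using assms(1) sub ball_subset_cball holomorphic_on_subset by blast
      show "continuous_on (cball x \<rho>) g"
        using assms(1) sub holomorphic_on_imp_continuous_on continuous_on_subset by blast
      show "0 < \<rho>" by fact
      fix y assume "norm (x - y) = \<rho>"
      then have "y \<in> ball 0 (3 * \<rho>)" using sub by (auto simp: dist_norm)
      then show "norm (g y) \<le> B" by (rule assms(2))
    qed
    then show ?thesis unfolding F_def by (simp add: numeral_2_eq_2)
  qed
  have "norm (F 0 h - (\<Sum>i\<le>1. F i 0 * (h - 0) ^ i / fact i)) \<le> 2 * B / \<rho>\<^sup>2 * norm (h - 0) ^ Suc 1 / fact 1"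
    by (rule complex_Taylor[where S = "ball 0 \<rho>"]) (use d b assms(3,4) in auto)
  then show ?thesis unfolding F_def by (simp add: algebra_simps power2_eq_square)
qed

text \<open>
  Near \<open>z0\<close> the difference quotients of f in direction i converge uniformly to \<open>pd i f\<close>, because f is
  bounded there by continuity. So the limit is again continuous, and by Weierstrass's theorem it
  is holomorphic in each variable.
\<close>

lemma holo_fun_pd_local:
  assumes "finite I" "holo_fun I S f" "i \<in> I" "z0 \<in> S"
  shows "\<exists>Q. open_in I Q \<and> z0 \<in> Q \<and> Q \<subseteq> S \<and> continuous_on Q (pd i f) \<and>
    (\<forall>j\<in>I. (\<lambda>w. pd i f (z0(j := w))) field_differentiable at (z0 j))"
proof -
  note S = holo_fun_openin[OF assms(2)]
  have z0: "z0 \<in> Cspace I" using assms(2,4) holo_fun_sub by blast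
  have "continuous_on S f" using assms(2) by (simp add: holo_fun_def)
  then have "openin (top_of_set S) (S \<inter> f -` ball (f z0) 1)"
    by (intro continuous_openin_preimage_gen) auto
  from openin_trans[OF this S] have V: "open_in I (S \<inter> f -` ball (f z0) 1)" .
  have "z0 \<in> S \<inter> f -` ball (f z0) 1" using assms(4) by simp
  from open_in_contains_polydisc[OF assms(1) V this]
  obtain r where r: "r > 0" "polydisc I z0 r \<subseteq> S \<inter> f -` ball (f z0) 1" by (elim exE conjE)
  (* A base point in Q moves by less than \<rho>, and the discs in direction i have radius 3\<rho>. *)
  define \<rho> B Q where "\<rho> = r / 4" and "B = norm (f z0) + 1" and "Q = polydisc I z0 \<rho>"
  have rho: "\<rho> > 0" using r(1) by (simp add: \<rho>_def)
  have bd: "norm (f z) \<le> B" if "z \<in> polydisc I z0 (4 * \<rho>)" for z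
  proof -
    have "dist (f z0) (f z) < 1" using r(2) that by (auto simp: \<rho>_def)
    then show ?thesis unfolding B_def using norm_triangle_ineq2[of "f z" "f z0"]
      by (simp add: dist_norm norm_minus_commute)
  qed
  have QS: "polydisc I z0 (4 * \<rho>) \<subseteq> S" using r(2) by (simp add: \<rho>_def)
  have Qs: "Q \<subseteq> polydisc I z0 (4 * \<rho>)" unfolding Q_def polydisc_def using rho by fastforce
  have big: "z(i := z i + w) \<in> polydisc I z0 (4 * \<rho>)" if "z \<in> Q" "norm w < 3 * \<rho>" for z w
  proof -
    have "dist (z i + w) (z0 i) \<le> dist (z i) (z0 i) + norm w"
      using norm_triangle_ineq[of "z i - z0 i" w] by (simp add: dist_norm algebra_simps)
    also have "\<dots> < 4 * \<rho>" using that assms(3) by (auto simp: Q_def polydisc_def)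
    finally have "dist (z i + w) (z0 i) < 4 * \<rho>" .
    then show ?thesis using that(1) Qs assms(3) by (auto simp: polydisc_def Cspace_def)
  qed
  define h :: "nat \<Rightarrow> complex" where "h = (\<lambda>n. of_real (\<rho> / (real n + 2)))"
  have h: "norm (h n) < \<rho>" "h n \<noteq> 0" for n using rho by (auto simp: h_def field_simps norm_divide intro!: add_pos_nonneg simp del: of_real_add)
  have h0: "(\<lambda>n. norm (h n)) \<longlonglongrightarrow> 0"
  proof -
    have "(\<lambda>n. \<rho> / (real n + 2)) \<longlonglongrightarrow> 0" by real_asymp
    moreover have "norm (h n) = \<rho> / (real n + 2)" for n unfolding h_def using rho by (simp only: norm_of_real abs_of_nonneg) (simp add: field_simps)
    ultimately show ?thesis by simp
  qed
  define D where "D = (\<lambda>n z. (f (z(i := z i + h n)) - f z) / h n)"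
  have est: "norm (D n z - pd i f z) \<le> 2 * B / \<rho>\<^sup>2 * norm (h n)" if z: "z \<in> Q" for n z
  proof -
    define g where "g = (\<lambda>w. f (z(i := z i + w)))"
    have zC: "z \<in> Cspace I" using z by (auto simp: Q_def polydisc_def)
    have hg: "g holomorphic_on ball 0 (3 * \<rho>)"
    proof -
      have "(\<lambda>w. f (z(i := w))) \<circ> (\<lambda>w. z i + w) holomorphic_on ball 0 (3 * \<rho>)"
        by (rule holomorphic_on_compose_gen[OF _ holo_fun_slice[OF assms(1,2) zC assms(3)]])
           (use subsetD[OF QS big[OF z]] in \<open>auto simp del: image_add_ball intro!: holomorphic_intros\<close>)
      then show ?thesis by (simp add: g_def o_def)
    qed
    have "norm (g w) \<le> B" if "w \<in> ball 0 (3 * \<rho>)" for w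
      using bd big[OF z] that by (simp add: g_def)
    from second_order_bound[OF hg this rho h(1), of n]
    have "norm (g (h n) - g 0 - deriv g 0 * h n) \<le> 2 * B / \<rho>\<^sup>2 * norm (h n) ^ 2" .
    moreover have "deriv g 0 = pd i f z"
    proof -
      have "deriv g 0 = deriv (\<lambda>w. f (z(i := w))) (z i + 0)"
      proof -
        have "(\<lambda>w. f (z(i := w))) field_differentiable at (z i)"
          using z Qs QS by (intro holo_fun_diff[OF assms(2) _ assms(3)]) auto
        then have "((\<lambda>w. f (z(i := w))) has_field_derivative deriv (\<lambda>w. f (z(i := w))) (z i)) (at (0 + z i))"
          by (simp add: field_differentiable_derivI)
        then have "(g has_field_derivative deriv (\<lambda>w. f (z(i := w))) (z i)) (at 0)"
          unfolding g_def DERIV_shift by (simp only: add.commute)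
        then show ?thesis by (simp add: DERIV_imp_deriv)
      qed
      then show ?thesis by (simp add: pd_def)
    qed
    moreover have "D n z - pd i f z = (g (h n) - g 0 - pd i f z * h n) / h n"
      using h(2)[of n] by (simp add: D_def g_def field_simps)
    ultimately have "norm (D n z - pd i f z) \<le> (2 * B / \<rho>\<^sup>2 * norm (h n) ^ 2) / norm (h n)"
      using h(2)[of n] by (simp only: norm_divide) (rule divide_right_mono, auto)
    also have "\<dots> = 2 * B / \<rho>\<^sup>2 * norm (h n)" using h(2)[of n] by (simp add: power2_eq_square)
    finally show ?thesis .
  qed
  have ul: "uniform_limit Q D (pd i f) sequentially"
  proof (rule uniform_limitI)
    fix e :: real assume "e > 0"
    have "(\<lambda>n. 2 * B / \<rho>\<^sup>2 * norm (h n)) \<longlonglongrightarrow> 0" using tendsto_mult_left[OF h0, of "2 * B / \<rho>\<^sup>2"] by (simp only: mult_zero_right)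
    then have "\<forall>\<^sub>F n in sequentially. 2 * B / \<rho>\<^sup>2 * norm (h n) < e"
      using \<open>e > 0\<close> by (rule order_tendstoD)
    then show "\<forall>\<^sub>F n in sequentially. \<forall>z\<in>Q. dist (D n z) (pd i f z) < e"
    proof eventually_elim
      case (elim n)
      show ?case unfolding dist_norm using le_less_trans[OF est elim] by blast
    qed
  qed
  have Qo: "open_in I Q" unfolding Q_def by (rule open_in_polydisc[OF assms(1)])
  have cont: "continuous_on Q (pd i f)"
  proof (rule uniform_limit_theorem[OF _ ul])
    have "continuous_on Q (D n)" for n
    proof -
      have "continuous_on Q (\<lambda>z. f (z(i := z i + h n)))"
      proof (rule continuous_on_compose2[OF \<open>continuous_on S f\<close>])
        show "continuous_on Q (\<lambda>z. z(i := z i + h n))"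
          by (intro continuous_on_upd continuous_intros continuous_on_subset[OF continuous_on_product_coordinates]) auto
        show "(\<lambda>z. z(i := z i + h n)) ` Q \<subseteq> S" using big h(1)[of n] QS rho by fastforce
      qed
      moreover have "continuous_on Q f" using \<open>continuous_on S f\<close> Qs QS continuous_on_subset by blast
      ultimately show ?thesis unfolding D_def using h(2)[of n] by (intro continuous_intros) auto
    qed
    then show "\<forall>\<^sub>F n in sequentially. continuous_on Q (D n)" by simp
  qed auto
  have diff: "(\<lambda>w. pd i f (z0(j := w))) field_differentiable at (z0 j)" if j: "j \<in> I" for j
  proof -
    define A where "A = ball (z0 j) \<rho>"
    have inQ: "z0(j := w) \<in> Q" if "w \<in> A" for w
      using that j rho z0 by (auto simp: Q_def A_def polydisc_def Cspace_def dist_commute)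
    have "(\<lambda>w. pd i f (z0(j := w))) holomorphic_on A"
    proof (rule holomorphic_uniform_sequence[where f = "\<lambda>n w. D n (z0(j := w))"])
      show "open A" by (simp add: A_def)
      show "(\<lambda>w. D n (z0(j := w))) holomorphic_on A" for n
      proof -
        have 1: "(\<lambda>w. f (z0(j := w))) holomorphic_on A"
          by (rule holomorphic_on_subset[OF holo_fun_slice[OF assms(1,2) z0 j]]) (use inQ Qs QS in auto)
        have 2: "(\<lambda>w. f ((z0(j := w))(i := (z0(j := w)) i + h n))) holomorphic_on A"
        proof (cases "i = j")
          case True
          have "(\<lambda>w. f (z0(j := w))) \<circ> (\<lambda>w. w + h n) holomorphic_on A"
            by (rule holomorphic_on_compose_gen[OF _ holo_fun_slice[OF assms(1,2) z0 j]])
               (use big[OF inQ] QS less_trans[OF h(1)[of n]] rho True in \<open>auto intro!: holomorphic_intros dest: subsetD\<close>)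
          then show ?thesis using True by (simp add: o_def)
        next
          case False
          have "z0(i := z0 i + h n) \<in> Cspace I" using z0 assms(3) by (simp add: Cspace_upd)
          from holo_fun_slice[OF assms(1,2) this j]
          have "(\<lambda>w. f (z0(i := z0 i + h n, j := w))) holomorphic_on A"
          proof (rule holomorphic_on_subset)
            show "A \<subseteq> {w. z0(i := z0 i + h n, j := w) \<in> S}"
            proof
              fix w assume "w \<in> A"
              from big[OF inQ[OF this], of "h n"] have "z0(j := w, i := z0 i + h n) \<in> S"
                using QS h(1)[of n] rho False by auto
              then show "w \<in> {w. z0(i := z0 i + h n, j := w) \<in> S}"
                using False by (simp add: fun_upd_twist)
            qed
          qed
          then show ?thesis using False by (simp add: fun_upd_twist)
        qed
        show ?thesis unfolding D_def using 1 2 h(2)[of n] by (intro holomorphic_intros) auto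
      qed
      fix x assume x: "x \<in> A"
      then obtain d where d: "d > 0" "cball x d \<subseteq> A" using open_contains_cball[of A] open_ball unfolding A_def by meson
      have "uniform_limit (cball x d) (\<lambda>n w. D n (z0(j := w))) (\<lambda>w. pd i f (z0(j := w))) sequentially"
      proof (rule uniform_limitI)
        fix e :: real assume "e > 0"
        from uniform_limitD[OF ul this]
        show "\<forall>\<^sub>F n in sequentially. \<forall>w\<in>cball x d. dist (D n (z0(j := w))) (pd i f (z0(j := w))) < e"
          by eventually_elim (use d(2) inQ in blast)
      qed
      then show "\<exists>d>0. cball x d \<subseteq> A \<and>
          uniform_limit (cball x d) (\<lambda>n w. D n (z0(j := w))) (\<lambda>w. pd i f (z0(j := w))) sequentially"
        using d by blast
    qed
    then show ?thesis using rho by (intro holomorphic_on_imp_differentiable_at[of _ A]) (auto simp: A_def)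
  qed
  have "z0 \<in> Q" using z0 rho by (simp add: Q_def polydisc_center)
  then show ?thesis using Qo cont diff subset_trans[OF Qs QS] by (intro exI conjI ballI)
qed

lemma holo_fun_pd:
  assumes "finite I" "holo_fun I S f" "i \<in> I"
  shows "holo_fun I S (pd i f)"
  unfolding holo_fun_def
proof (intro conjI ballI)
  show "open_in I S" using assms(2) by (rule holo_fun_openin)
  show "continuous_on S (pd i f)"
  proof (rule continuous_on_local)
    fix z assume z: "z \<in> S"
    show "\<exists>T. openin (top_of_set S) T \<and> z \<in> T \<and> continuous_on T (pd i f)"
      using holo_fun_pd_local[OF assms z]
    proof (elim exE conjE, intro exI conjI)
      fix Q assume Q: "open_in I Q" "Q \<subseteq> S"
      show "openin (top_of_set S) Q"
        by (rule openin_subset_trans[OF Q holo_fun_sub[OF assms(2)]])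
    qed
  qed
  fix z j assume z: "z \<in> S" and j: "j \<in> I"
  from holo_fun_pd_local[OF assms z] show "(\<lambda>w. pd i f (z(j := w))) field_differentiable at (z j)"
    by (elim exE conjE) (rule bspec[OF _ j])
qed

lemma holo_fun_foldr_pd:
  assumes "finite I" "holo_fun I S f" "set l \<subseteq> I"
  shows "holo_fun I S (foldr pd l f)"
  using assms(3) by (induction l) (auto intro: holo_fun_pd assms)

text \<open>
  Outside the points of differentiability \<open>deriv\<close> takes an arbitrary value, which does not scale with
  the function. Hence the argument needs that all iterated partial derivatives of f are holomorphic.
\<close>

lemma foldr_pd_affine:
  assumes "finite I" "holo_fun I S f" "set l \<subseteq> I" "z \<in> S"
  shows "foldr pd l (\<lambda>z. c * f z + d) z = c * foldr pd l f z + (if l = [] then d else 0)"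
  using assms(3,4)
proof (induction l arbitrary: z)
  case Nil then show ?case by simp
next
  case (Cons i l)
  have i: "i \<in> I" and l: "set l \<subseteq> I" using Cons.prems by auto
  let ?g = "foldr pd l f" and ?d = "if l = [] then d else 0"
  have "pd i (foldr pd l (\<lambda>z. c * f z + d)) z = pd i (\<lambda>z. c * ?g z + ?d) z"
    by (rule pd_cong[OF assms(1) holo_fun_openin[OF assms(2)] Cons.prems(2) i]) (rule Cons.IH[OF l])
  also have "\<dots> = c * pd i ?g z"
  proof -
    have "(\<lambda>w. ?g (z(i := w))) field_differentiable at (z i)"
      by (rule holo_fun_diff[OF holo_fun_foldr_pd[OF assms(1,2) l] Cons.prems(2) i])
    then have "((\<lambda>w. c * ?g (z(i := w)) + ?d) has_field_derivative c * pd i ?g z) (at (z i))"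
      unfolding pd_def by (auto intro!: derivative_eq_intros field_differentiable_derivI)
    then show ?thesis unfolding pd_def[of i "\<lambda>z. c * ?g z + ?d"] by (rule DERIV_imp_deriv)
  qed
  finally show ?case by simp
qed

lemma jet_coords_cong:
  assumes "finite I" "open_in I S" "origin \<in> S"
    "\<And>z i. z \<in> S \<Longrightarrow> i \<in> I \<Longrightarrow> f z i = g z i"
  shows "jet_coords I k f = jet_coords I k g"
proof -
  have "foldr pd (sorted_list_of_multiset \<mu>) (\<lambda>z. f z i) origin =
      foldr pd (sorted_list_of_multiset \<mu>) (\<lambda>z. g z i) origin" if "i \<in> I" "set_mset \<mu> \<subseteq> I" for i \<mu>
    by (rule foldr_pd_cong[OF assms(1,2) _ _ assms(3)]) (use that assms(4) in auto)
  then show ?thesis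
    by (intro ext) (simp add: jet_coords_def jet_index_def split: prod.split)
qed

text \<open>
  The only instance of the chain rule for jets that occurs below: transition maps of an OT manifold
  scale and translate each coordinate separately.
\<close>

lemma jet_coords_affine:
  assumes "finite I" "\<And>i. i \<in> I \<Longrightarrow> holo_fun I S (\<lambda>z. f z i)" "origin \<in> S"
    "\<And>z i. z \<in> S \<Longrightarrow> i \<in> I \<Longrightarrow> g z i = c i * f z i + d i"
  shows "jet_coords I k g =
    (\<lambda>(i, \<mu>). if (i, \<mu>) \<in> jet_index I k
       then c i * jet_coords I k f (i, \<mu>) + (if \<mu> = {#} then d i else 0) else 0)"
proof -
  have "foldr pd (sorted_list_of_multiset \<mu>) (\<lambda>z. g z i) origin =
      c i * foldr pd (sorted_list_of_multiset \<mu>) (\<lambda>z. f z i) origin + (if \<mu> = {#} then d i else 0)"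
    if i: "i \<in> I" and mu: "set_mset \<mu> \<subseteq> I" for i \<mu>
  proof -
    have "foldr pd (sorted_list_of_multiset \<mu>) (\<lambda>z. g z i) origin =
       foldr pd (sorted_list_of_multiset \<mu>) (\<lambda>z. c i * f z i + d i) origin"
      by (rule foldr_pd_cong[OF assms(1) holo_fun_openin[OF assms(2)[OF i]] _ _ assms(3)])
         (use mu assms(4) i in auto)
    also have "\<dots> = c i * foldr pd (sorted_list_of_multiset \<mu>) (\<lambda>z. f z i) origin +
        (if sorted_list_of_multiset \<mu> = [] then d i else 0)"
      by (rule foldr_pd_affine[OF assms(1) assms(2)[OF i] _ assms(3)]) (use mu in auto)
    also have "(sorted_list_of_multiset \<mu> = []) = (\<mu> = {#})"
      by (metis mset_sorted_list_of_multiset mset.simps(1) sorted_list_of_multiset_empty)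
    finally show ?thesis .
  qed
  then show ?thesis
    by (intro ext) (simp add: jet_coords_def jet_index_def split: prod.split)
qed

section \<open>Holomorphic maps between open sets of complex space\<close>

lemma holo_fun_local:
  assumes "finite I" "S \<subseteq> Cspace I"
    "\<And>z. z \<in> S \<Longrightarrow> \<exists>T. z \<in> T \<and> T \<subseteq> S \<and> holo_fun I T f"
  shows "holo_fun I S f"
  unfolding holo_fun_def
proof (intro conjI ballI)
  show "open_in I S"
  proof (subst openin_subopen, intro ballI)
    fix z assume "z \<in> S"
    from assms(3)[OF this] show "\<exists>T. open_in I T \<and> z \<in> T \<and> T \<subseteq> S"
      using holo_fun_openin by (elim exE conjE) (intro exI conjI)
  qed
  show "continuous_on S f"
  proof (rule continuous_on_local)
    fix z assume "z \<in> S"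
    from assms(3)[OF this] show "\<exists>T. openin (top_of_set S) T \<and> z \<in> T \<and> continuous_on T f"
    proof (elim exE conjE, intro exI conjI)
      fix T assume "T \<subseteq> S" "holo_fun I T f"
      then show "openin (top_of_set S) T" by (intro openin_subset_trans[OF holo_fun_openin _ assms(2)])
      show "continuous_on T f" using \<open>holo_fun I T f\<close> by (simp add: holo_fun_def)
    qed
  qed
  fix z i assume z: "z \<in> S" and i: "i \<in> I"
  from assms(3)[OF z] show "(\<lambda>w. f (z(i := w))) field_differentiable at (z i)"
    by (elim exE conjE) (rule holo_fun_diff[OF _ _ i])
qed

lemma holo_fun_const: "open_in I S \<Longrightarrow> holo_fun I S (\<lambda>_. c)"
  by (simp add: holo_fun_def)

lemma holo_fun_coord:
  assumes "open_in I S"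
  shows "holo_fun I S (\<lambda>z. z j)"
  unfolding holo_fun_def
proof (intro conjI ballI)
  show "continuous_on S (\<lambda>z. z j)"
    by (rule continuous_on_subset[OF continuous_on_product_coordinates]) auto
  show "(\<lambda>w. (z(i := w)) j) field_differentiable at (z i)" for z :: "'a \<Rightarrow> complex" and i
    by (cases "i = j") (auto intro: derivative_intros simp: field_differentiable_ident)
qed (rule assms)

lemma holo_fun_affine:
  assumes "holo_fun I S f"
  shows "holo_fun I S (\<lambda>z. c * f z + d)"
  using assms unfolding holo_fun_def
  by (auto intro!: continuous_intros derivative_intros)

text \<open>
  The deck transformations \<open>M\<^sub>u \<circ> T\<^sub>a\<close> and the translations of C^I have this form.
\<close>

definition diag_affine :: "'i set \<Rightarrow> ('i \<Rightarrow> complex) \<Rightarrow> ('i \<Rightarrow> complex) \<Rightarrow> ('i \<Rightarrow> complex) \<Rightarrow> 'i \<Rightarrow> complex" where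
  "diag_affine I c d z = (\<lambda>i. if i \<in> I then c i * z i + d i else 0)"

lemma diag_affine_Cspace: "diag_affine I c d z \<in> Cspace I"
  by (simp add: diag_affine_def Cspace_def)

lemma continuous_on_into_Cspace:
  assumes "\<And>i. i \<in> I \<Longrightarrow> continuous_on S (\<lambda>z. h z i)" "\<And>z. z \<in> S \<Longrightarrow> h z \<in> Cspace I"
  shows "continuous_on S h"
proof (rule continuous_on_coordinatewise_then_product)
  fix i
  show "continuous_on S (\<lambda>z. h z i)"
  proof (cases "i \<in> I")
    case False
    show ?thesis by (rule continuous_on_eq[OF continuous_on_const[of S 0]]) (use assms(2) False in \<open>auto simp: Cspace_def\<close>)
  qed (rule assms(1))
qed

lemma continuous_on_diag_affine: "continuous_on S (diag_affine I c d)"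
proof (rule continuous_on_into_Cspace[of I])
  fix i assume "i \<in> I"
  have "continuous_on S (\<lambda>z::'a \<Rightarrow> complex. c i * z i + d i)"
    by (intro continuous_intros continuous_on_subset[OF continuous_on_product_coordinates]) auto
  then show "continuous_on S (\<lambda>z. diag_affine I c d z i)" using \<open>i \<in> I\<close> by (simp add: diag_affine_def)
qed (rule diag_affine_Cspace)

lemma openin_preimage:
  assumes "openin (top_of_set C) S" "continuous_on S h" "openin (top_of_set D) T" "h ` S \<subseteq> D"
  shows "openin (top_of_set C) {z \<in> S. h z \<in> T}"
proof -
  have "openin (top_of_set S) (S \<inter> h -` T)"
    using continuous_openin_preimage[OF assms(2) _ assms(3)] assms(4) by auto
  then have "openin (top_of_set C) (S \<inter> h -` T)" using assms(1) openin_trans by blast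
  moreover have "S \<inter> h -` T = {z \<in> S. h z \<in> T}" by auto
  ultimately show ?thesis by simp
qed

text \<open>
  A diagonal map carries lines in direction i to lines in direction i, so that separate holomorphy is
  preserved by the chain rule in one variable.
\<close>

lemma holo_fun_comp_diag_affine:
  assumes I: "finite I" and S: "open_in I S" and f: "holo_fun I T f"
    and ST: "\<And>z. z \<in> S \<Longrightarrow> diag_affine I c d z \<in> T"
  shows "holo_fun I S (\<lambda>z. f (diag_affine I c d z))"
  unfolding holo_fun_def
proof (intro conjI ballI)
  show "continuous_on S (\<lambda>z. f (diag_affine I c d z))"
    by (rule continuous_on_compose2[of T f]) (use f ST continuous_on_diag_affine in \<open>auto simp: holo_fun_def\<close>)
  fix z i assume z: "z \<in> S" and i: "i \<in> I"
  have zC: "z \<in> Cspace I" using S z openin_imp_subset by blast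
  let ?w = "diag_affine I c d z"
  have "(\<lambda>w. f (?w(i := w))) field_differentiable at (?w i)"
    by (rule holo_fun_diff[OF f ST[OF z] i])
  then have "(\<lambda>w. f (?w(i := w))) \<circ> (\<lambda>w. c i * w + d i) field_differentiable at (z i)"
    using i by (intro field_differentiable_compose) (auto intro!: derivative_intros simp: diag_affine_def)
  moreover have "?w(i := c i * w + d i) = diag_affine I c d (z(i := w))" for w
    using i by (auto simp: diag_affine_def)
  ultimately show "(\<lambda>w. f (diag_affine I c d (z(i := w)))) field_differentiable at (z i)"
    by (simp add: o_def)
qed (rule S)

lemma Cmfd_simps: "mtop (Cmfd I) = top_of_set (Cspace I)" "mindex (Cmfd I) = I"
  "mcharts (Cmfd I) = {(Cspace I, \<lambda>z. z)}"
  by (simp_all add: Cmfd_def)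

lemma holo_fun_continuous_map:
  assumes "\<And>i. i \<in> I \<Longrightarrow> holo_fun I S (\<lambda>z. h z i)" "\<And>z. z \<in> S \<Longrightarrow> h z \<in> Cspace I"
  shows "continuous_on S h"
  by (rule continuous_on_into_Cspace[of I]) (use assms in \<open>auto simp: holo_fun_def\<close>)

lemma subtopology_open_in: "open_in I W \<Longrightarrow> subtopology (top_of_set (Cspace I)) W = top_of_set W"
  by (frule openin_imp_subset) (simp add: subtopology_subtopology Int_absorb1)

lemma open_in_preimage_map:
  assumes "open_in I W" "continuous_map (subtopology (top_of_set (Cspace I)) W) X f" "openin X V"
  shows "open_in I {z \<in> W. f z \<in> V}"
  using openin_continuous_map_preimage[OF assms(2,3)] assms(1)
  unfolding subtopology_open_in[OF assms(1)] by (auto intro: openin_trans)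

text \<open>
  The domain has the identity as its single chart, so that only the charts of the target matter.
\<close>

lemma holomorphic_map_from_Cmfd_iff:
  assumes I: "finite I"
  shows "holomorphic_map (Cmfd I) N W f \<longleftrightarrow> open_in I W \<and>
    continuous_map (subtopology (top_of_set (Cspace I)) W) (mtop N) f \<and>
    (\<forall>(V, d)\<in>mcharts N. \<forall>j\<in>mindex N. holo_fun I {z \<in> W. f z \<in> V} (\<lambda>z. d (f z) j))"
proof (cases "open_in I W")
  case True
  then have WC: "W \<subseteq> Cspace I" using openin_imp_subset by blast
  have h: "holo_fun I ((\<lambda>z. z) ` (W \<inter> Cspace I \<inter> f -` V)) (\<lambda>z. d (f (inv_into (Cspace I) (\<lambda>z. z) z)) j) \<longleftrightarrow>
      holo_fun I {z \<in> W. f z \<in> V} (\<lambda>z. d (f z) j)" if "j \<in> mindex N" for V d j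
  proof -
    have eq: "(\<lambda>z. z) ` (W \<inter> Cspace I \<inter> f -` V) = {z \<in> W. f z \<in> V}" using WC by auto
    have e: "d (f (inv_into (Cspace I) (\<lambda>z. z) z)) j = d (f z) j" if "z \<in> {z \<in> W. f z \<in> V}" for z
      using WC that inv_into_f_f[of "\<lambda>z. z" "Cspace I" z] by auto
    show ?thesis unfolding eq
    proof
      assume h: "holo_fun I {z \<in> W. f z \<in> V} (\<lambda>z. d (f (inv_into (Cspace I) (\<lambda>z. z) z)) j)"
      show "holo_fun I {z \<in> W. f z \<in> V} (\<lambda>z. d (f z) j)"
        by (rule holo_fun_cong[OF I holo_fun_openin[OF h] order_refl h]) (simp only: e)
    next
      assume h: "holo_fun I {z \<in> W. f z \<in> V} (\<lambda>z. d (f z) j)"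
      show "holo_fun I {z \<in> W. f z \<in> V} (\<lambda>z. d (f (inv_into (Cspace I) (\<lambda>z. z) z)) j)"
        by (rule holo_fun_cong[OF I holo_fun_openin[OF h] order_refl h]) (simp only: e)
    qed
  qed
  have "holo_fun I ((\<lambda>z. z) ` (W \<inter> Cspace I \<inter> f -` fst C)) (\<lambda>z. snd C (f (inv_into (Cspace I) (\<lambda>z. z) z)) j) \<longleftrightarrow>
      holo_fun I {z \<in> W. f z \<in> fst C} (\<lambda>z. snd C (f z) j)" if "j \<in> mindex N" for C j by (rule h[OF that])
  then show ?thesis unfolding holomorphic_map_def Cmfd_simps by (simp add: case_prod_beta)
qed (simp add: holomorphic_map_def Cmfd_simps)

lemma holomorphic_map_Cmfd_iff:
  assumes I: "finite I"
  shows "holomorphic_map (Cmfd I) (Cmfd I) W g \<longleftrightarrow>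
     open_in I W \<and> (\<forall>z\<in>W. g z \<in> Cspace I) \<and> (\<forall>i\<in>I. holo_fun I W (\<lambda>z. g z i))"
proof (cases "open_in I W \<and> (\<forall>z\<in>W. g z \<in> Cspace I)")
  case True
  then have W: "open_in I W" and g: "\<And>z. z \<in> W \<Longrightarrow> g z \<in> Cspace I" by auto
  have "{z \<in> W. g z \<in> Cspace I} = W" using g by auto
  moreover have "continuous_map (top_of_set W) (top_of_set (Cspace I)) g" if "\<forall>i\<in>I. holo_fun I W (\<lambda>z. g z i)"
  proof -
    have "continuous_on W g" by (rule holo_fun_continuous_map[OF _ g]) (use that in auto)
    then show ?thesis using g by (auto simp: continuous_map_in_subtopology)
  qed
  ultimately show ?thesis
    unfolding holomorphic_map_from_Cmfd_iff[OF I] Cmfd_simps subtopology_open_in[OF W] using True by auto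
next
  case False
  have "\<not> holomorphic_map (Cmfd I) (Cmfd I) W g"
  proof
    assume "holomorphic_map (Cmfd I) (Cmfd I) W g"
    note g' = this[unfolded holomorphic_map_from_Cmfd_iff[OF I] Cmfd_simps]
    note W = conjunct1[OF g']
    have "g ` W \<subseteq> Cspace I"
      using continuous_map_image_subset_topspace[OF conjunct1[OF conjunct2[OF g']]]
      unfolding subtopology_open_in[OF W] by simp
    then show False using False W by (simp add: image_subset_iff)
  qed
  then show ?thesis using False by blast
qed

lemma holomorphic_map_cong:
  assumes I: "finite I" and f: "holomorphic_map (Cmfd I) N W f" and eq: "\<And>z. z \<in> W \<Longrightarrow> g z = f z"
  shows "holomorphic_map (Cmfd I) N W g"
proof -
  note f' = f[unfolded holomorphic_map_from_Cmfd_iff[OF I]]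
  have W: "open_in I W" and fc: "continuous_map (subtopology (top_of_set (Cspace I)) W) (mtop N) f"
    and fh: "\<And>V d j. (V, d) \<in> mcharts N \<Longrightarrow> j \<in> mindex N \<Longrightarrow> holo_fun I {z \<in> W. f z \<in> V} (\<lambda>z. d (f z) j)"
    using f' by auto
  have "continuous_map (subtopology (top_of_set (Cspace I)) W) (mtop N) g"
    by (rule continuous_map_eq[OF fc]) (simp add: eq subtopology_open_in[OF W])
  moreover have "holo_fun I {z \<in> W. g z \<in> V} (\<lambda>z. d (g z) j)"
    if "(V, d) \<in> mcharts N" "j \<in> mindex N" for V d j
  proof -
    have "{z \<in> W. g z \<in> V} = {z \<in> W. f z \<in> V}" using eq by auto
    with fh[OF that] show ?thesis
      using holo_fun_cong[OF I holo_fun_openin order_refl fh[OF that]] eq by simp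
  qed
  ultimately show ?thesis using W unfolding holomorphic_map_from_Cmfd_iff[OF I] by auto
qed

lemma biholomorphism_Cmfd_iff:
  assumes I: "finite I"
  shows "biholomorphism_on (Cmfd I) (Cmfd I) W g \<longleftrightarrow>
    open_in I W \<and> (\<forall>z\<in>W. g z \<in> Cspace I) \<and> (\<forall>i\<in>I. holo_fun I W (\<lambda>z. g z i)) \<and>
    inj_on g W \<and> open_in I (g ` W) \<and> (\<forall>i\<in>I. holo_fun I (g ` W) (\<lambda>z. inv_into W g z i))"
proof -
  have "\<forall>z\<in>g ` W. inv_into W g z \<in> Cspace I" if "open_in I W"
    using inv_into_into[of _ g W] openin_imp_subset[OF that] by blast
  then show ?thesis unfolding biholomorphism_on_def holomorphic_map_Cmfd_iff[OF I] Cmfd_simps by blast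
qed

lemma biholomorphism_CmfdI:
  assumes I: "finite I" and S: "open_in I S"
    and h: "\<And>i. i \<in> I \<Longrightarrow> holo_fun I S (\<lambda>z. h z i)" "\<And>z. z \<in> S \<Longrightarrow> h z \<in> Cspace I" "open_in I (h ` S)"
    and k: "\<And>i. i \<in> I \<Longrightarrow> holo_fun I (h ` S) (\<lambda>z. k z i)" "\<And>z. z \<in> S \<Longrightarrow> k (h z) = z"
  shows "biholomorphism_on (Cmfd I) (Cmfd I) S h"
  unfolding biholomorphism_Cmfd_iff[OF I]
proof (intro conjI ballI S h)
  show inj: "inj_on h S" by (rule inj_on_inverseI) (rule k(2))
  show "holo_fun I (h ` S) (\<lambda>z. inv_into S h z i)" if "i \<in> I" for i
    by (rule holo_fun_cong[OF I h(3) order_refl k(1)[OF that]]) (use inj k(2) in \<open>auto simp: inv_into_f_f\<close>)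
qed

lemma biholomorphism_Cmfd_inverse:
  assumes I: "finite I" and g: "biholomorphism_on (Cmfd I) (Cmfd I) W g"
  shows "biholomorphism_on (Cmfd I) (Cmfd I) (g ` W) (inv_into W g)"
proof -
  have g': "open_in I W" "\<And>i. i \<in> I \<Longrightarrow> holo_fun I W (\<lambda>z. g z i)" "inj_on g W" "open_in I (g ` W)"
    "\<And>i. i \<in> I \<Longrightarrow> holo_fun I (g ` W) (\<lambda>z. inv_into W g z i)"
    using g unfolding biholomorphism_Cmfd_iff[OF I] by auto
  have im: "inv_into W g ` g ` W = W" using g'(3) by (simp add: inv_into_image_cancel)
  show ?thesis
  proof (rule biholomorphism_CmfdI[OF I g'(4,5), where k = g], unfold im)
    show "inv_into W g z \<in> Cspace I" if "z \<in> g ` W" for z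
      using inv_into_into[OF that] openin_imp_subset[OF g'(1)] by blast
  qed (use g' in \<open>auto simp: f_inv_into_f\<close>)
qed

definition shift :: "'i set \<Rightarrow> ('i \<Rightarrow> complex) \<Rightarrow> ('i \<Rightarrow> complex) \<Rightarrow> 'i \<Rightarrow> complex" where
  "shift I z = diag_affine I (\<lambda>_. 1) z"

lemma shift_apply: "shift I z y = (\<lambda>i. if i \<in> I then y i + z i else 0)"
  by (rule ext) (simp add: shift_def diag_affine_def)

lemma shift_Cspace: "shift I z y \<in> Cspace I"
  by (simp add: shift_def diag_affine_Cspace)

lemma shift_cancel:
  "y \<in> Cspace I \<Longrightarrow> shift I z (shift I (\<lambda>i. - z i) y) = y"
  "y \<in> Cspace I \<Longrightarrow> shift I (\<lambda>i. - z i) (shift I z y) = y"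
  by (auto simp: shift_apply Cspace_def)

lemma continuous_on_shift: "continuous_on A (shift I z)"
  unfolding shift_def by (rule continuous_on_diag_affine)

lemma biholomorphism_shift:
  assumes I: "finite I" and S: "open_in I S"
  shows "biholomorphism_on (Cmfd I) (Cmfd I) S (shift I z)"
proof (rule biholomorphism_CmfdI[OF I S, where k = "shift I (\<lambda>i. - z i)"])
  have SC: "S \<subseteq> Cspace I" using S openin_imp_subset by blast
  have "shift I z ` S = {y \<in> Cspace I. shift I (\<lambda>i. - z i) y \<in> S}"
  proof (intro equalityI subsetI)
    fix y assume y: "y \<in> {y \<in> Cspace I. shift I (\<lambda>i. - z i) y \<in> S}"
    then have "shift I z (shift I (\<lambda>i. - z i) y) = y" by (intro shift_cancel) simp
    then show "y \<in> shift I z ` S" using y by (metis (mono_tags, lifting) CollectD imageI)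
  qed (use SC in \<open>auto simp: shift_cancel shift_Cspace\<close>)
  also have "open_in I \<dots>"
    by (rule openin_preimage[OF _ continuous_on_shift S]) (auto simp: shift_Cspace)
  finally show o: "open_in I (shift I z ` S)" .
  have hol: "holo_fun I A (\<lambda>y. shift I z' y i)" if "open_in I A" "i \<in> I" for A z' i
    using holo_fun_affine[OF holo_fun_coord[OF that(1), of i], of 1 "z' i"] that(2) by (simp add: shift_apply)
  show "holo_fun I S (\<lambda>y. shift I z y i)" "holo_fun I (shift I z ` S) (\<lambda>y. shift I (\<lambda>i. - z i) y i)"
    if "i \<in> I" for i by (rule hol[OF S that], rule hol[OF o that])
qed (use S openin_imp_subset in \<open>auto simp: shift_Cspace intro!: shift_cancel\<close>)

lemma shift_origin: "z \<in> Cspace I \<Longrightarrow> shift I z origin = z"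
  by (auto simp: shift_apply Cspace_def)

lemma shift_self: "shift I (\<lambda>i. - z i) z = origin"
  by (auto simp: shift_apply)

lemma jet_cong:
  assumes "finite (mindex N)" "open_in (mindex N) S" "origin \<in> S"
    "\<And>w. w \<in> S \<Longrightarrow> r w = r' w"
  shows "jet N k r = jet N k r'"
proof -
  have "jet_coords (mindex N) k (c \<circ> r) = jet_coords (mindex N) k (c \<circ> r')" for c
    by (rule jet_coords_cong[OF assms(1-3)]) (simp add: assms(4))
  then show ?thesis unfolding jet_def using assms(4)[OF assms(3)] by simp
qed

text \<open>
  The inverse of a jet in the jet group. It comes from the inverse germ, because a jet depends
  on the germ only, and so no formula for the jet of a composition enters.
\<close>

lemma fixing_germ_inverse:
  assumes I: "finite I" and g: "fixing_germ I g"
  obtains h where "fixing_germ I h" "jet (Cmfd I) k (h \<circ> g) = jet (Cmfd I) k (\<lambda>w. w)"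
proof -
  obtain W where W: "origin \<in> W" "biholomorphism_on (Cmfd I) (Cmfd I) W g" and g0: "g origin = origin"
    using g by (auto simp: fixing_germ_def frame_germ_def Cmfd_simps)
  have inj: "inj_on g W" and Wo: "open_in I W"
    using W(2) by (auto simp: biholomorphism_Cmfd_iff[OF I])
  have h0: "inv_into W g origin = origin" using inv_into_f_f[OF inj W(1)] g0 by simp
  have "origin \<in> g ` W" using W(1) g0 by force
  then have "fixing_germ I (inv_into W g)"
    using biholomorphism_Cmfd_inverse[OF I W(2)] h0 unfolding fixing_germ_def frame_germ_def Cmfd_simps
    by (intro conjI exI)
  moreover have "jet (Cmfd I) k (inv_into W g \<circ> g) = jet (Cmfd I) k (\<lambda>w. w)"
    by (rule jet_cong[of _ W]) (use I Wo W(1) inj in \<open>auto simp: Cmfd_simps inv_into_f_f\<close>)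
  ultimately show thesis by (rule that)
qed

section \<open>Algebraic integers\<close>

definition zspan :: "'k set \<Rightarrow> ('k \<Rightarrow> 'a::comm_ring_1) \<Rightarrow> 'a set" where
  "zspan K v = {\<Sum>l\<in>K. of_int (c l) * v l | c. True}"

lemma zspanI: "y = (\<Sum>l\<in>K. of_int (c l) * v l) \<Longrightarrow> y \<in> zspan K v"
  by (auto simp: zspan_def)

lemma zspan_add: "x \<in> zspan K v \<Longrightarrow> y \<in> zspan K v \<Longrightarrow> x + y \<in> zspan K v"
proof -
  assume "x \<in> zspan K v" "y \<in> zspan K v"
  then obtain c d where "x = (\<Sum>l\<in>K. of_int (c l) * v l)" "y = (\<Sum>l\<in>K. of_int (d l) * v l)"
    by (auto simp: zspan_def)
  then have "x + y = (\<Sum>l\<in>K. of_int (c l + d l) * v l)"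
    by (simp add: sum.distrib ring_distribs)
  then show ?thesis by (rule zspanI[where c = "\<lambda>l. c l + d l"])
qed

lemma zspan_int_mult: "x \<in> zspan K v \<Longrightarrow> of_int n * x \<in> zspan K v"
proof -
  assume "x \<in> zspan K v"
  then obtain c where "x = (\<Sum>l\<in>K. of_int (c l) * v l)" by (auto simp: zspan_def)
  then have "of_int n * x = (\<Sum>l\<in>K. of_int (n * c l) * v l)"
    by (simp add: sum_distrib_left mult.assoc)
  then show ?thesis by (rule zspanI[where c = "\<lambda>l. n * c l"])
qed

lemma zspan_0: "0 \<in> zspan K v"
  by (rule zspanI[where c = "\<lambda>_. 0"]) simp

lemma zspan_sum: "(\<And>a. a \<in> A \<Longrightarrow> f a \<in> zspan K v) \<Longrightarrow> sum f A \<in> zspan K v"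
  by (induction A rule: infinite_finite_induct) (auto intro: zspan_0 zspan_add)

lemma zspan_base: "finite K \<Longrightarrow> k \<in> K \<Longrightarrow> v k \<in> zspan K v"
  by (rule zspanI[where c = "\<lambda>l. if l = k then 1 else 0"]) (simp add: if_distrib[of "\<lambda>x. x * _"] if_distrib[of of_int] cong: if_cong)

lemma zspan_mult:
  assumes "\<And>k. k \<in> K \<Longrightarrow> a * v k \<in> zspan K v" "y \<in> zspan K v"
  shows "a * y \<in> zspan K v"
proof -
  obtain c where c: "y = (\<Sum>l\<in>K. of_int (c l) * v l)" using assms(2) by (auto simp: zspan_def)
  have "a * y = (\<Sum>l\<in>K. of_int (c l) * (a * v l))"
    unfolding c by (simp add: sum_distrib_left mult_ac)
  also have "\<dots> \<in> zspan K v" by (intro zspan_sum zspan_int_mult assms(1))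
  finally show ?thesis .
qed

text \<open>
  By the hypothesis x is an eigenvalue of an integer matrix, hence a root of its characteristic
  polynomial, which is monic with integer coefficients.
\<close>

lemma algebraic_int_eigenvalue:
  fixes x :: "'a::field_char_0" and N :: nat
  assumes "\<And>k. k < N \<Longrightarrow> x * w k = (\<Sum>l<N. of_int (A k l) * w l)" "k0 < N" "w k0 \<noteq> 0"
  shows "algebraic_int x"
proof -
  define B where "B = Matrix.mat N N (\<lambda>(k, l). A k l)"
  define C where "C = (map_mat of_int B :: 'a Matrix.mat)"
  define v where "v = Matrix.vec N w"
  have B: "B \<in> carrier_mat N N" and C: "C \<in> carrier_mat N N" by (auto simp: B_def C_def)
  have "eigenvector C v x"
    unfolding eigenvector_def
  proof (intro conjI)
    show "v \<in> carrier_vec (dim_row C)" using C by (simp add: v_def)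
    have "vec_index v k0 \<noteq> vec_index (0\<^sub>v N) k0" using assms by (simp add: v_def)
    then show "v \<noteq> 0\<^sub>v (dim_row C)" using C by auto
    show "C *\<^sub>v v = x \<cdot>\<^sub>v v"
    proof (rule eq_vecI)
      fix i assume "i < dim_vec (x \<cdot>\<^sub>v v)"
      then have i: "i < N" by (simp add: v_def)
      then show "vec_index (C *\<^sub>v v) i = vec_index (x \<cdot>\<^sub>v v) i"
        using assms(1)[OF i] by (simp add: C_def B_def v_def scalar_prod_def lessThan_atLeast0)
    qed (simp add: C_def B_def v_def)
  qed
  then have "poly (char_poly C) x = 0"
    using eigenvalue_root_char_poly[OF C] by (auto simp: eigenvalue_def)
  moreover have "char_poly C = map_poly of_int (char_poly B)"
    unfolding C_def by (rule of_int_hom.char_poly_hom[OF B])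
  moreover have "lead_coeff (char_poly B) = 1" using degree_monic_char_poly[OF B] by simp
  ultimately show ?thesis unfolding algebraic_int_altdef_ipoly by metis
qed

lemma algebraic_int_zspan:
  fixes x :: "'a::field_char_0"
  assumes "finite K" "\<And>k. k \<in> K \<Longrightarrow> x * v k \<in> zspan K v" "k0 \<in> K" "v k0 \<noteq> 0"
  shows "algebraic_int x"
proof -
  obtain e where e: "bij_betw e {..<card K} K"
    using ex_bij_betw_nat_finite[OF assms(1)] by (auto simp: lessThan_atLeast0)
  have "\<forall>k\<in>K. \<exists>c. x * v k = (\<Sum>l\<in>K. of_int (c l) * v l)" using assms(2) by (auto simp: zspan_def)
  then obtain c where c: "\<And>k. k \<in> K \<Longrightarrow> x * v k = (\<Sum>l\<in>K. of_int (c k l) * v l)" by metis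
  have "k0 \<in> e ` {..<card K}" using e assms(3) by (simp add: bij_betw_def)
  then obtain n0 where n0: "n0 < card K" "e n0 = k0" by auto
  show ?thesis
  proof (rule algebraic_int_eigenvalue[where w = "v \<circ> e" and N = "card K" and ?k0.0 = n0
        and A = "\<lambda>k l. c (e k) (e l)"])
    fix k assume "k < card K"
    then have "e k \<in> K" using e by (auto simp: bij_betw_def)
    from c[OF this] show "x * (v \<circ> e) k = (\<Sum>l<card K. of_int (c (e k) (e l)) * (v \<circ> e) l)"
      using sum.reindex_bij_betw[OF e, of "\<lambda>l. of_int (c (e k) l) * v l"] by simp
  next
    show "n0 < card K" by fact
    show "(v \<circ> e) n0 \<noteq> 0" using n0 assms(4) by simp
  qed
qed

text \<open>
  Solve an integral equation of x for its highest power.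
\<close>

lemma algebraic_int_power_reduce:
  fixes x :: "'a::field_char_0"
  assumes "algebraic_int x"
  obtains m where "m > 0" "x ^ m \<in> zspan {..<m} (\<lambda>i. x ^ i)"
proof -
  obtain p where p: "poly (map_poly of_int p) x = 0" "lead_coeff p = 1"
    using assms algebraic_int_altdef_ipoly by blast
  define m where "m = degree p"
  have "poly (map_poly of_int p) x = (\<Sum>i\<le>m. of_int (coeff p i) * x ^ i)"
    by (simp add: poly_altdef m_def coeff_map_poly degree_map_poly)
  also have "\<dots> = (\<Sum>i<m. of_int (coeff p i) * x ^ i) + x ^ m"
    using p(2) by (simp add: m_def flip: lessThan_Suc_atMost)
  finally have e: "x ^ m = - (\<Sum>i<m. of_int (coeff p i) * x ^ i)" using p(1)
    by (simp add: eq_neg_iff_add_eq_0 add.commute)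
  show thesis
  proof
    show "m > 0"
    proof (rule ccontr)
      assume "\<not> m > 0"
      then show False using e by simp
    qed
    show "x ^ m \<in> zspan {..<m} (\<lambda>i. x ^ i)"
      by (rule zspanI[where c = "\<lambda>i. - coeff p i"]) (simp add: e sum_negf)
  qed
qed

text \<open>
  The products of powers of x and y, with exponents below the degrees of integral equations of x
  and y, span a finitely generated group that is stable under multiplication by x and by y.
\<close>

lemma algebraic_int_add_mult:
  fixes x y :: "'a::field_char_0"
  assumes "algebraic_int x" "algebraic_int y"
  shows "algebraic_int (x + y)" "algebraic_int (x * y)"
proof -
  obtain m where m: "m > 0" "x ^ m \<in> zspan {..<m} (\<lambda>i. x ^ i)"
    using algebraic_int_power_reduce[OF assms(1)] .
  obtain n where n: "n > 0" "y ^ n \<in> zspan {..<n} (\<lambda>i. y ^ i)"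
    using algebraic_int_power_reduce[OF assms(2)] .
  define K where "K = {..<m} \<times> {..<n}"
  define v where "v = (\<lambda>(i, j). x ^ i * y ^ j)"
  have K: "finite K" "(0, 0) \<in> K" "v (0, 0) \<noteq> 0" using m n by (auto simp: K_def v_def)
  have b: "x ^ i * y ^ j \<in> zspan K v" if "i < m" "j < n" for i j
    using zspan_base[OF K(1), of "(i, j)" v] that by (auto simp: K_def v_def)
  have X: "x * v k \<in> zspan K v" if k: "k \<in> K" for k
  proof -
    obtain i j where ij: "k = (i, j)" "i < m" "j < n" using k by (auto simp: K_def)
    show ?thesis
    proof (cases "Suc i < m")
      case True
      then show ?thesis using b[OF True ij(3)] by (simp add: ij v_def mult_ac)
    next
      case False
      then have i: "Suc i = m" using ij by simp
      obtain c where "x ^ m = (\<Sum>l<m. of_int (c l) * x ^ l)" using m(2) by (auto simp: zspan_def)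
      moreover have "x * v k = x ^ m * y ^ j" by (simp add: ij v_def flip: i)
      ultimately have "x * v k = (\<Sum>l<m. of_int (c l) * (x ^ l * y ^ j))"
        by (simp only: sum_distrib_right mult.assoc)
      also have "\<dots> \<in> zspan K v" using ij b by (intro zspan_sum zspan_int_mult) auto
      finally show ?thesis .
    qed
  qed
  have Y: "y * v k \<in> zspan K v" if k: "k \<in> K" for k
  proof -
    obtain i j where ij: "k = (i, j)" "i < m" "j < n" using k by (auto simp: K_def)
    show ?thesis
    proof (cases "Suc j < n")
      case True
      then show ?thesis using b[OF ij(2) True] by (simp add: ij v_def mult_ac)
    next
      case False
      then have i: "Suc j = n" using ij by simp
      obtain c where "y ^ n = (\<Sum>l<n. of_int (c l) * y ^ l)" using n(2) by (auto simp: zspan_def)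
      moreover have "y * v k = x ^ i * y ^ n" by (simp add: ij v_def flip: i)
      ultimately have "y * v k = (\<Sum>l<n. of_int (c l) * (x ^ i * y ^ l))"
        by (simp only: sum_distrib_left mult.left_commute)
      also have "\<dots> \<in> zspan K v" using ij b by (intro zspan_sum zspan_int_mult) auto
      finally show ?thesis .
    qed
  qed
  show "algebraic_int (x + y)"
    by (rule algebraic_int_zspan[where K = K and v = v and ?k0.0 = "(0, 0)"]) (auto simp: K ring_distribs intro!: zspan_add X Y)
  show "algebraic_int (x * y)"
    by (rule algebraic_int_zspan[where K = K and v = v and ?k0.0 = "(0, 0)"]) (simp_all add: K mult.assoc zspan_mult X Y)
qed

lemma integers_of_add: "a \<in> integers_of \<Longrightarrow> b \<in> integers_of \<Longrightarrow> a + b \<in> integers_of"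
  by (simp add: integers_of_def algebraic_int_add_mult)

lemma integers_of_mult: "a \<in> integers_of \<Longrightarrow> b \<in> integers_of \<Longrightarrow> a * b \<in> integers_of"
  by (simp add: integers_of_def algebraic_int_add_mult)

lemma integers_of_0: "0 \<in> integers_of" by (simp add: integers_of_def)

lemma integers_of_uminus: "a \<in> integers_of \<Longrightarrow> - a \<in> integers_of"
  by (simp add: integers_of_def)

lemma integers_of_of_int: "of_int n \<in> integers_of"
  by (simp add: integers_of_def int_imp_algebraic_int)

lemma integers_of_sum: "(\<And>a. a \<in> A \<Longrightarrow> f a \<in> integers_of) \<Longrightarrow> sum f A \<in> integers_of"
  by (induction A rule: infinite_finite_induct) (auto intro: integers_of_0 integers_of_add)

lemma common_denominator:
  assumes "finite Q"
  obtains D :: int where "D > 0" "\<And>q. q \<in> Q \<Longrightarrow> of_int D * (q::rat) \<in> \<int>"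
proof -
  have "\<exists>D::int. D > 0 \<and> (\<forall>q\<in>Q. of_int D * q \<in> \<int>)" using assms
  proof (induction Q)
    case empty then show ?case by (intro exI[of _ 1]) auto
  next
    case (insert q Q)
    then obtain D :: int where D: "D > 0" "\<forall>q\<in>Q. of_int D * q \<in> \<int>" by auto
    obtain a b where ab: "q = Rat.Fract a b" "b > 0" by (cases q) auto
    have "of_int (D * b) * r \<in> \<int>" if "r \<in> insert q Q" for r
    proof (cases "r = q")
      case True
      have "of_int (D * b) * r = (of_int (D * a) :: rat)"
        using ab True by (simp add: Fract_of_int_quotient)
      then show ?thesis by (metis Ints_of_int)
    next
      case False
      then have "of_int D * r \<in> \<int>" using D(2) that by blast
      then have "of_int b * (of_int D * r) \<in> \<int>" by (rule Ints_mult[OF Ints_of_int])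
      then show ?thesis by (simp only: of_int_mult mult_ac)
    qed
    then show ?case using D(1) ab(2) by (intro exI[of _ "D * b"]) auto
  qed
  then show thesis using that by auto
qed

lemma vector_space_rat: "vector_space (\<lambda>(q::rat) (x::'f::field_char_0). of_rat q * x)"
  by unfold_locales (auto simp: of_rat_add of_rat_mult algebra_simps)

text \<open>
  Multiplication by x has a rational matrix in a basis of the field. Clearing denominators makes it
  an integer matrix, so that a positive integer multiple of x is integral. Scaling
  each element of a basis in this way gives the result.
\<close>

lemma number_field_integral_basis:
  assumes "number_field_of_degree TYPE('f::field_char_0) n"
  obtains B :: "'f::field_char_0 set" where "finite B" "B \<subseteq> integers_of"
    "\<And>x. \<exists>r. x = (\<Sum>b\<in>B. of_rat (r b) * b)"
    "\<And>c :: 'f::field_char_0 \<Rightarrow> int. (\<Sum>b\<in>B. of_int (c b) * b) = 0 \<Longrightarrow> \<forall>b\<in>B. c b = 0"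
proof -
  interpret V: vector_space "\<lambda>(q::rat) (x::'f). of_rat q * x" by (rule vector_space_rat)
  obtain B :: "'f set" where B: "finite B" "V.independent B" "V.span B = UNIV"
    using assms unfolding number_field_of_degree_def by auto
  have span: "\<exists>r. x = (\<Sum>b\<in>B. of_rat (r b) * b)" for x
    using V.span_finite[OF B(1)] B(3) by auto
  have ex_den: "\<exists>D::int. D > 0 \<and> of_int D * x \<in> integers_of" for x :: 'f
  proof -
    have "\<forall>b. \<exists>r. x * b = (\<Sum>l\<in>B. of_rat (r l) * l)" using span by blast
    then obtain r where r: "\<And>b. x * b = (\<Sum>l\<in>B. of_rat (r b l) * l)" by metis
    have "finite ((\<lambda>(b, l). r b l) ` (B \<times> B))" using B(1) by auto
    from common_denominator[OF this] obtain D :: int where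
      D: "D > 0" "\<And>q. q \<in> (\<lambda>(b, l). r b l) ` (B \<times> B) \<Longrightarrow> of_int D * q \<in> \<int>" by auto
    have "\<forall>b\<in>B. \<forall>l\<in>B. \<exists>k::int. of_int D * r b l = of_int k" using D(2) by (auto elim!: Ints_cases)
    then obtain k where k: "\<And>b l. b \<in> B \<Longrightarrow> l \<in> B \<Longrightarrow> of_int D * r b l = of_int (k b l)" by metis
    have "of_int D * x * b \<in> zspan B (\<lambda>b. b)" if b: "b \<in> B" for b
    proof (rule zspanI[where c = "k b"])
      have "of_int D * x * b = (\<Sum>l\<in>B. of_int D * (of_rat (r b l) * l))"
        using r[of b] by (simp add: mult.assoc sum_distrib_left)
      also have "\<dots> = (\<Sum>l\<in>B. of_int (k b l) * l)"
      proof (rule sum.cong)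
        fix l assume l: "l \<in> B"
        have "of_int D * (of_rat (r b l) * l) = of_rat (of_int D * r b l) * l"
          by (simp add: of_rat_mult mult.assoc)
        also have "\<dots> = of_int (k b l) * l" by (simp add: k[OF b l])
        finally show "of_int D * (of_rat (r b l) * l) = of_int (k b l) * l" .
      qed simp
      finally show "of_int D * x * b = (\<Sum>l\<in>B. of_int (k b l) * l)" .
    qed
    moreover obtain b0 where "b0 \<in> B" "b0 \<noteq> 0"
    proof -
      obtain r where "(1::'f) = (\<Sum>b\<in>B. of_rat (r b) * b)" using span by blast
      then have "(\<Sum>b\<in>B. of_rat (r b) * b) \<noteq> 0" by (metis zero_neq_one)
      then obtain b where "b \<in> B" "of_rat (r b) * b \<noteq> 0" by (meson sum.not_neutral_contains_not_neutral)
      then show thesis using that by auto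
    qed
    ultimately have "algebraic_int (of_int D * x)" using algebraic_int_zspan[OF B(1), of "of_int D * x" "\<lambda>b. b"] by blast
    then show ?thesis using D(1) by (auto simp: integers_of_def)
  qed
  then obtain D :: "'f \<Rightarrow> int" where D: "\<And>x. D x > 0" "\<And>x. of_int (D x) * x \<in> integers_of" by metis
  define f where "f = (\<lambda>b::'f. of_int (D b) * b)"
  have ind: "\<forall>b\<in>B. c b = 0" if "(\<Sum>b\<in>B. of_rat (c b) * b) = 0" for c
    using B(1,2) that unfolding V.dependent_finite[OF B(1)] by blast
  have inj: "inj_on f B"
  proof (rule inj_onI, rule ccontr)
    fix x y assume xy: "x \<in> B" "y \<in> B" "f x = f y" "x \<noteq> y"
    define c :: "'f \<Rightarrow> rat" where "c = (\<lambda>b. if b = x then of_int (D x) else if b = y then - of_int (D y) else 0)"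
    have "(\<Sum>b\<in>B. of_rat (c b) * b) = (\<Sum>b\<in>{x, y}. of_rat (c b) * b)"
      by (rule sum.mono_neutral_right) (use B(1) xy in \<open>auto simp: c_def\<close>)
    also have "\<dots> = 0" using xy by (simp add: c_def f_def of_rat_minus)
    finally have "c x = 0" using ind xy(1) by blast
    then show False using D(1)[of x] by (simp add: c_def)
  qed
  show thesis
  proof
    show "finite (f ` B)" using B(1) by simp
    show "f ` B \<subseteq> integers_of" using D(2) by (auto simp: f_def)
    show "\<exists>r. x = (\<Sum>b\<in>f ` B. of_rat (r b) * b)" for x
    proof -
      obtain r where r: "x = (\<Sum>b\<in>B. of_rat (r b) * b)" using span by blast
      define g where "g = the_inv_into B f"
      have g: "g (f b) = b" if "b \<in> B" for b using the_inv_into_f_f[OF inj that] by (simp add: g_def)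
      have "x = (\<Sum>b\<in>B. of_rat (r (g (f b)) / of_int (D (g (f b)))) * f b)"
        unfolding r
      proof (rule sum.cong)
        fix b assume b: "b \<in> B"
        show "of_rat (r b) * b = of_rat (r (g (f b)) / of_int (D (g (f b)))) * f b"
          using D(1)[of b] g[OF b] by (simp add: f_def of_rat_divide)
      qed simp
      also have "\<dots> = (\<Sum>b\<in>f ` B. of_rat (r (g b) / of_int (D (g b))) * b)"
        by (simp add: sum.reindex[OF inj])
      finally show ?thesis by (intro exI[of _ "\<lambda>b. r (g b) / of_int (D (g b))"])
    qed
    show "\<forall>b\<in>f ` B. c b = 0" if "(\<Sum>b\<in>f ` B. of_int (c b) * b) = 0" for c :: "'f \<Rightarrow> int"
    proof -
      have "(\<Sum>b\<in>B. of_rat (of_int (c (f b) * D b)) * b) = 0"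
      proof -
        have "(\<Sum>b\<in>B. of_rat (of_int (c (f b) * D b)) * b) = (\<Sum>b\<in>B. of_int (c (f b)) * f b)"
          by (rule sum.cong) (simp_all add: f_def of_rat_mult mult.assoc)
        then show ?thesis using that by (simp add: sum.reindex[OF inj])
      qed
      from ind[OF this] show ?thesis using D(1) by (auto simp: mult_eq_0_iff) (metis less_irrefl)
    qed
  qed
qed

text \<open>
  Dedekind's argument: in a relation, replace x by \<open>x * y\<close> and subtract \<open>g y\<close> times the relation. This
  eliminates g, and the relation that remains has coefficients \<open>c h * (h y - g y)\<close>.
\<close>

lemma embeddings_independent:
  assumes "finite H" "H \<subseteq> {h::'f::field_char_0 \<Rightarrow> complex. field_embedding h}"
    "\<And>x. (\<Sum>h\<in>H. c h * h x) = 0"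
  shows "\<forall>h\<in>H. c h = 0"
  using assms
proof (induction H arbitrary: c)
  case empty then show ?case by simp
next
  case (insert g H)
  have g: "field_embedding g" and H: "\<And>h. h \<in> H \<Longrightarrow> field_embedding h" using insert.prems(1) by auto
  have *: "(\<Sum>h\<in>H. c h * h x) = - (c g * g x)" for x
    using insert.prems(2)[of x] insert.hyps by (simp add: eq_neg_iff_add_eq_0 add.commute)
  have "c h = 0" if h: "h \<in> H" for h
  proof -
    have "(\<Sum>h\<in>H. (c h * (h y - g y)) * h x) = 0" for x y
    proof -
      have "(\<Sum>h\<in>H. (c h * (h y - g y)) * h x) = (\<Sum>h\<in>H. c h * h (x * y)) - g y * (\<Sum>h\<in>H. c h * h x)"
        unfolding sum_distrib_left sum_subtractf[symmetric]
        by (rule sum.cong) (use H in \<open>auto simp: field_embedding_def algebra_simps\<close>)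
      also have "\<dots> = 0" unfolding * using g by (simp add: field_embedding_def algebra_simps)
      finally show ?thesis .
    qed
    then have "\<forall>h\<in>H. c h * (h y - g y) = 0" for y
      using insert.prems(1) by (intro insert.IH) auto
    moreover obtain y where "h y \<noteq> g y" using h insert.hyps(2) by (metis ext)
    ultimately show ?thesis using h by fastforce
  qed
  moreover from this have "c g = 0" using *[of 1] g by (simp add: field_embedding_def)
  ultimately show ?case by auto
qed

text \<open>
  Gaussian elimination. Let the rows in I be solvable, and let p be a further row. Subtracting from
  a suitable unit vector q what it contributes in the rows of I gives a vector e that
  all rows of I annihilate and row p does not. Multiples of e adjust the value in row p.
\<close>

lemma independent_rows_solvable:
  fixes A :: "'i \<Rightarrow> 'j \<Rightarrow> 'a::field"
  assumes "finite I" "finite J"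
    "\<And>c. (\<And>j. j \<in> J \<Longrightarrow> (\<Sum>i\<in>I. c i * A i j) = 0) \<Longrightarrow> \<forall>i\<in>I. c i = 0"
  shows "\<exists>d. \<forall>i\<in>I. (\<Sum>j\<in>J. A i j * d j) = x i"
proof -
  have "\<forall>x. \<exists>d. \<forall>i\<in>I. (\<Sum>j\<in>J. A i j * d j) = x i" using assms(1,3)
  proof (induction I)
    case empty then show ?case by simp
  next
    case (insert p I)
    have "\<forall>x. \<exists>d. \<forall>i\<in>I. (\<Sum>j\<in>J. A i j * d j) = x i"
    proof (rule insert.IH)
      fix c assume c: "\<And>j. j \<in> J \<Longrightarrow> (\<Sum>i\<in>I. c i * A i j) = 0"
      have "\<forall>i\<in>insert p I. (if i = p then 0 else c i) = 0"
      proof (rule insert.prems)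
        fix j assume "j \<in> J"
        have "(\<Sum>i\<in>I. (if i = p then 0 else c i) * A i j) = (\<Sum>i\<in>I. c i * A i j)"
          by (rule sum.cong) (use insert.hyps in auto)
        then show "(\<Sum>i\<in>insert p I. (if i = p then 0 else c i) * A i j) = 0"
          using insert.hyps c[OF \<open>j \<in> J\<close>] by simp
      qed
      then show "\<forall>i\<in>I. c i = 0" using insert.hyps by (metis insertI2)
    qed
    then obtain S where S: "\<And>x i. i \<in> I \<Longrightarrow> (\<Sum>j\<in>J. A i j * S x j) = x i" by metis
    define u where "u = (\<lambda>i. S (\<lambda>k. if k = i then 1 else 0))"
    have u: "(\<Sum>j\<in>J. A k j * u i j) = (if k = i then 1 else 0)" if "k \<in> I" for i k
      using S[OF that] by (simp add: u_def)
    define \<alpha> where "\<alpha> = (\<lambda>i. \<Sum>j\<in>J. A p j * u i j)"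
    obtain q where q: "q \<in> J" "A p q - (\<Sum>i\<in>I. \<alpha> i * A i q) \<noteq> 0"
    proof -
      have "\<not> (\<forall>i\<in>insert p I. (if i = p then 1 else - \<alpha> i) = 0)" by auto
      with insert.prems[of "\<lambda>i. if i = p then 1 else - \<alpha> i"] obtain q where q: "q \<in> J"
        "(\<Sum>i\<in>insert p I. (if i = p then 1 else - \<alpha> i) * A i q) \<noteq> 0" by blast
      moreover have "(\<Sum>i\<in>I. (if i = p then 1 else - \<alpha> i) * A i q) = (\<Sum>i\<in>I. - (\<alpha> i * A i q))"
        by (rule sum.cong) (use insert.hyps in auto)
      ultimately show thesis using that[OF q(1)] insert.hyps by (simp add: sum_negf)
    qed
    define e where "e = (\<lambda>j. (if j = q then 1 else 0) - (\<Sum>i\<in>I. A i q * u i j))"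
    have Ae: "(\<Sum>j\<in>J. A k j * e j) = A k q - (\<Sum>i\<in>I. A i q * (\<Sum>j\<in>J. A k j * u i j))" for k
    proof -
      have "(\<Sum>j\<in>J. A k j * e j) = (\<Sum>j\<in>J. A k j * (if j = q then 1 else 0)) - (\<Sum>j\<in>J. \<Sum>i\<in>I. A i q * (A k j * u i j))"
        unfolding e_def by (simp add: right_diff_distrib sum_subtractf sum_distrib_left mult_ac)
      also have "(\<Sum>j\<in>J. A k j * (if j = q then 1 else 0)) = A k q"
        using assms(2) q(1) by (simp add: if_distrib[of "\<lambda>x. _ * x"] cong: if_cong)
      also have "(\<Sum>j\<in>J. \<Sum>i\<in>I. A i q * (A k j * u i j)) = (\<Sum>i\<in>I. A i q * (\<Sum>j\<in>J. A k j * u i j))"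
        by (subst sum.swap) (simp add: sum_distrib_left)
      finally show ?thesis .
    qed
    have e0: "(\<Sum>j\<in>J. A k j * e j) = 0" if k: "k \<in> I" for k
      unfolding Ae using u[OF k] k insert.hyps(1) by (simp add: if_distrib[of "\<lambda>x. _ * x"] cong: if_cong)
    have e1: "(\<Sum>j\<in>J. A p j * e j) \<noteq> 0"
      unfolding Ae using q(2) by (simp add: \<alpha>_def mult.commute)
    show ?case
    proof
      fix x
      define t where "t = (x p - (\<Sum>j\<in>J. A p j * S x j)) / (\<Sum>j\<in>J. A p j * e j)"
      have "(\<Sum>j\<in>J. A k j * (S x j + t * e j)) = (\<Sum>j\<in>J. A k j * S x j) + t * (\<Sum>j\<in>J. A k j * e j)" for k
        by (simp add: ring_distribs sum.distrib sum_distrib_left mult_ac)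
      then have "\<forall>i\<in>insert p I. (\<Sum>j\<in>J. A i j * (S x j + t * e j)) = x i"
        using e0 e1 S by (auto simp: t_def)
      then show "\<exists>d. \<forall>i\<in>insert p I. (\<Sum>j\<in>J. A i j * d j) = x i" by (intro exI)
    qed
  qed
  then show ?thesis by blast
qed

lemma field_embedding_simps:
  assumes "field_embedding h"
  shows "h 0 = 0" "h 1 = 1" "h (x + y) = h x + h y" "h (x * y) = h x * h y" "h (- x) = - h x"
    "h (of_int n) = of_int n" "h (of_rat q) = of_rat q" "h (sum f A) = (\<Sum>a\<in>A. h (f a))"
    "h x = 0 \<longleftrightarrow> x = 0" "h (inverse x) = inverse (h x)"
proof -
  have a: "h (x + y) = h x + h y" and m: "h (x * y) = h x * h y" and one: "h 1 = 1" for x y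
    using assms by (auto simp: field_embedding_def)
  show "h (x + y) = h x + h y" "h (x * y) = h x * h y" "h 1 = 1" by (fact a m one)+
  have 0: "h 0 = 0" using a[of 0 0] by simp
  then show "h 0 = 0" .
  have neg: "h (- x) = - h x" for x using a[of x "- x"] 0 by (simp add: eq_neg_iff_add_eq_0 add.commute)
  then show "h (- x) = - h x" .
  have nat: "h (of_nat n) = of_nat n" for n by (induction n) (auto simp: 0 a one)
  have int: "h (of_int n) = of_int n" for n by (cases n) (auto simp: nat neg simp flip: of_nat_Suc)
  then show "h (of_int n) = of_int n" .
  have inv: "h (inverse x) = inverse (h x)" for x
  proof (cases "x = 0")
    case False
    then have "h x * h (inverse x) = 1" by (simp add: one flip: m)
    then show ?thesis by (metis inverse_unique)
  qed (simp add: 0)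
  then show "h (inverse x) = inverse (h x)" .
  show "h x = 0 \<longleftrightarrow> x = 0"
  proof
    assume "h x = 0"
    show "x = 0"
    proof (rule ccontr)
      assume "x \<noteq> 0"
      then have "h x * h (inverse x) = 1" by (simp add: one flip: m)
      then show False using \<open>h x = 0\<close> by simp
    qed
  qed (simp add: 0)
  show "h (of_rat q) = of_rat q"
    by (cases q) (simp add: of_rat_rat divide_inverse m inv int)
  show "h (sum f A) = (\<Sum>a\<in>A. h (f a))"
    by (induction A rule: infinite_finite_induct) (auto simp: 0 a)
qed

section \<open>The lattice of integers and periodic functions\<close>

locale embedded_number_field =
  fixes s t :: nat and \<sigma> :: "nat \<Rightarrow> 'f::field_char_0 \<Rightarrow> complex"
  assumes s_pos: "s > 0" and t_pos: "t > 0" and embeddings: "ordered_embeddings s t \<sigma>"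
begin

lemma embedding: "i \<in> {1..s + 2 * t} \<Longrightarrow> field_embedding (\<sigma> i)"
  using embeddings unfolding ordered_embeddings_def bij_betw_def by auto

lemma embedding': "i \<in> {1..s + t} \<Longrightarrow> field_embedding (\<sigma> i)"
  by (rule embedding) auto

lemma real_embedding: "i \<in> {1..s} \<Longrightarrow> \<sigma> i x \<in> \<real>"
  using embeddings unfolding ordered_embeddings_def by blast

lemma embeddings_vanish:
  assumes "\<And>x. (\<Sum>i\<in>{1..s + 2 * t}. c i * \<sigma> i x) = 0" "i \<in> {1..s + 2 * t}"
  shows "c i = 0"
proof -
  have b: "bij_betw \<sigma> {1..s + 2 * t} {h. field_embedding h}"
    using embeddings by (simp add: ordered_embeddings_def)
  define g where "g = the_inv_into {1..s + 2 * t} \<sigma>"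
  have inj: "inj_on \<sigma> {1..s + 2 * t}" using b by (simp add: bij_betw_def)
  have g: "g (\<sigma> i) = i" if "i \<in> {1..s + 2 * t}" for i
    unfolding g_def by (rule the_inv_into_f_f[OF inj that])
  have "\<forall>h\<in>\<sigma> ` {1..s + 2 * t}. c (g h) = 0"
  proof (rule embeddings_independent)
    show "\<sigma> ` {1..s + 2 * t} \<subseteq> {h. field_embedding h}" using b by (simp add: bij_betw_def)
    fix x
    have "(\<Sum>h\<in>\<sigma> ` {1..s + 2 * t}. c (g h) * h x) = (\<Sum>i\<in>{1..s + 2 * t}. c (g (\<sigma> i)) * \<sigma> i x)"
      by (simp only: sum.reindex[OF inj] o_def)
    also have "\<dots> = (\<Sum>i\<in>{1..s + 2 * t}. c i * \<sigma> i x)" by (rule sum.cong) (simp_all add: g)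
    finally show "(\<Sum>h\<in>\<sigma> ` {1..s + 2 * t}. c (g h) * h x) = 0" using assms(1) by simp
  qed simp
  then show ?thesis using g assms(2) by auto
qed

text \<open>
  The vectors \<open>(\<sigma> i b)\<^sub>i\<close>, with i ranging over all embeddings, span the full complex space by Dedekind's
  theorem. Complex conjugation permutes the embeddings by \<open>bar\<close>, so that the real parts of the complex
  coefficients of a conjugation-invariant vector are coefficients of the same vector.
\<close>

lemma real_combination:
  assumes B: "finite B" "\<And>x::'f. \<exists>r. x = (\<Sum>b\<in>B. of_rat (r b) * b)"
    and v: "\<And>i. i \<in> {1..s} \<Longrightarrow> v i \<in> \<real>"
  shows "\<exists>d::'f \<Rightarrow> real. \<forall>i\<in>{1..s + t}. (\<Sum>b\<in>B. of_real (d b) * \<sigma> i b) = v i"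
proof -
  define J where "J = {1..s + 2 * t}"
  define v' where "v' = (\<lambda>i. if i \<le> s + t then v i else cnj (v (i - t)))"
  define bar where "bar = (\<lambda>i. if i \<le> s then i else if i \<le> s + t then i + t else i - t)"
  have cnj_\<sigma>: "\<sigma> (s + j) x = cnj (\<sigma> (s + j + t) x)" if "j \<in> {1..t}" for j x
    using embeddings that unfolding ordered_embeddings_def by blast
  have bar: "bar i \<in> J \<and> (\<forall>x. \<sigma> (bar i) x = cnj (\<sigma> i x)) \<and> v' (bar i) = cnj (v' i)" if i: "i \<in> J" for i
  proof -
    consider "i \<le> s" | "s < i" "i \<le> s + t" | "s + t < i" by linarith
    then show ?thesis
    proof cases
      case 1
      then show ?thesis using i real_embedding[of i] v[of i]
        by (auto simp: bar_def v'_def J_def Reals_cnj_iff)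
    next
      case 2
      have "\<sigma> i x = cnj (\<sigma> (i + t) x)" for x using cnj_\<sigma>[of "i - s" x] 2 by (simp add: Suc_le_eq)
      then show ?thesis using 2 i by (auto simp: bar_def v'_def J_def)
    next
      case 3
      have "\<sigma> (i - t) x = cnj (\<sigma> i x)" for x using cnj_\<sigma>[of "i - t - s" x] 3 i by (simp add: J_def Suc_le_eq)
      then show ?thesis using 3 i by (auto simp: bar_def v'_def J_def)
    qed
  qed
  have "\<exists>e. \<forall>i\<in>J. (\<Sum>b\<in>B. \<sigma> i b * e b) = v' i"
  proof (rule independent_rows_solvable)
    show "finite J" by (simp add: J_def)
    show "finite B" by fact
    fix c assume c: "\<And>b. b \<in> B \<Longrightarrow> (\<Sum>i\<in>J. c i * \<sigma> i b) = 0"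
    have "(\<Sum>i\<in>J. c i * \<sigma> i x) = 0" for x
    proof -
      obtain r where r: "x = (\<Sum>b\<in>B. of_rat (r b) * b)" using B(2) by blast
      have "(\<Sum>i\<in>J. c i * \<sigma> i x) = (\<Sum>i\<in>J. \<Sum>b\<in>B. of_rat (r b) * (c i * \<sigma> i b))"
      proof (rule sum.cong)
        fix i assume "i \<in> J"
        then have "field_embedding (\<sigma> i)" using embedding by (simp add: J_def)
        then show "c i * \<sigma> i x = (\<Sum>b\<in>B. of_rat (r b) * (c i * \<sigma> i b))"
          unfolding r by (simp add: field_embedding_simps sum_distrib_left mult_ac)
      qed simp
      also have "\<dots> = (\<Sum>b\<in>B. of_rat (r b) * (\<Sum>i\<in>J. c i * \<sigma> i b))"
        by (subst sum.swap) (simp add: sum_distrib_left)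
      also have "\<dots> = 0" using c by simp
      finally show ?thesis .
    qed
    then show "\<forall>i\<in>J. c i = 0" using embeddings_vanish unfolding J_def by blast
  qed
  then obtain e where e: "\<And>i. i \<in> J \<Longrightarrow> (\<Sum>b\<in>B. \<sigma> i b * e b) = v' i" by blast
  have "(\<Sum>b\<in>B. of_real (Re (e b)) * \<sigma> i b) = v i" if i: "i \<in> {1..s + t}" for i
  proof -
    have iJ: "i \<in> J" and vi: "v' i = v i" using i by (auto simp: J_def v'_def)
    have "(\<Sum>b\<in>B. of_real (Re (e b)) * \<sigma> i b) = (\<Sum>b\<in>B. (\<sigma> i b * e b + cnj (\<sigma> (bar i) b * e b)) / 2)"
      using bar[OF iJ] by (intro sum.cong) (auto simp: complex_eq_iff)
    also have "\<dots> = ((\<Sum>b\<in>B. \<sigma> i b * e b) + cnj (\<Sum>b\<in>B. \<sigma> (bar i) b * e b)) / 2"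
      by (simp add: sum_divide_distrib sum.distrib add_divide_distrib)
    also have "\<dots> = v i" using e[OF iJ] e[of "bar i"] bar[OF iJ] vi by simp
    finally show ?thesis .
  qed
  then show ?thesis by (intro exI[of _ "\<lambda>b. Re (e b)"]) blast
qed

text \<open>
  The last condition says that the images of B span \<open>\<real>\<^sup>s \<times> \<complex>\<^sup>t\<close> over the reals.
\<close>

definition lattice_basis :: "'f set \<Rightarrow> bool" where
  "lattice_basis B \<longleftrightarrow> finite B \<and> B \<subseteq> integers_of \<and>
     (\<forall>c :: 'f \<Rightarrow> int. (\<Sum>b\<in>B. of_int (c b) * b) = 0 \<longrightarrow> (\<forall>b\<in>B. c b = 0)) \<and>
     (\<forall>v. (\<forall>i\<in>{1..s}. v i \<in> \<real>) \<longrightarrow>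
       (\<exists>d::'f \<Rightarrow> real. \<forall>i\<in>{1..s + t}. (\<Sum>b\<in>B. of_real (d b) * \<sigma> i b) = v i))"

lemma ex_lattice_basis: "\<exists>B. lattice_basis B"
proof -
  have "number_field_of_degree TYPE('f) (s + 2 * t)" using embeddings by (simp add: ordered_embeddings_def)
  then show ?thesis
  proof (rule number_field_integral_basis)
    fix B :: "'f set"
    assume B: "finite B" "B \<subseteq> integers_of"
      "\<And>x. \<exists>r. x = (\<Sum>b\<in>B. of_rat (r b) * b)"
      "\<And>c :: 'f \<Rightarrow> int. (\<Sum>b\<in>B. of_int (c b) * b) = 0 \<Longrightarrow> \<forall>b\<in>B. c b = 0"
    have "lattice_basis B"
      unfolding lattice_basis_def
    proof (intro conjI allI impI)
      show "\<exists>d::'f \<Rightarrow> real. \<forall>i\<in>{1..s + t}. (\<Sum>b\<in>B. of_real (d b) * \<sigma> i b) = v i"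
        if "\<forall>i\<in>{1..s}. v i \<in> \<real>" for v
        by (rule real_combination[OF B(1,3)]) (use that in blast)
    qed (fact B(1) B(2) B(4))+
    then show ?thesis by (rule exI)
  qed
qed

lemma embedding_int_combination:
  "i \<in> {1..s + t} \<Longrightarrow> \<sigma> i (\<Sum>b\<in>B. of_int (p b) * b) = (\<Sum>b\<in>B. of_int (p b) * \<sigma> i b)"
  using embedding' by (simp add: field_embedding_simps)

lemma int_combination_integer:
  "B \<subseteq> integers_of \<Longrightarrow> (\<Sum>b\<in>B. of_int (p b) * b) \<in> (integers_of :: 'f set)"
  by (intro integers_of_sum integers_of_mult integers_of_of_int) auto

text \<open>
  Since t is positive, the images of a basis in \<open>\<real>\<^sup>s\<close> satisfy a nontrivial real linear relation: take
  the coefficients of a vector that vanishes at the real places and not at the first complex one.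
  Simultaneous Dirichlet approximation of the coefficients gives integers that nearly satisfy the relation.
\<close>

lemma small_integer:
  assumes "\<epsilon> > 0"
  obtains a where "a \<in> integers_of" "a \<noteq> 0" "\<And>i. i \<in> {1..s} \<Longrightarrow> norm (\<sigma> i a) < \<epsilon>"
proof -
  obtain B where lB: "lattice_basis B" using ex_lattice_basis by (rule exE)
  then have B: "finite B" "B \<subseteq> integers_of" by (simp_all add: lattice_basis_def)
  have comb: "\<exists>d::'f \<Rightarrow> real. \<forall>i\<in>{1..s + t}. (\<Sum>b\<in>B. of_real (d b) * \<sigma> i b) = v i"
    if "\<And>i. i \<in> {1..s} \<Longrightarrow> v i \<in> \<real>" for v
    using lB that by (simp add: lattice_basis_def)
  have ind: "\<forall>b\<in>B. c b = 0" if "(\<Sum>b\<in>B. of_int (c b) * b) = 0" for c :: "'f \<Rightarrow> int"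
    using lB that by (simp add: lattice_basis_def)
  have "\<exists>d::'f \<Rightarrow> real. \<forall>i\<in>{1..s + t}. (\<Sum>b\<in>B. of_real (d b) * \<sigma> i b) = (if i = s + 1 then 1 else 0)"
    by (rule comb) auto
  then obtain d0 :: "'f \<Rightarrow> real" where
    "\<forall>i\<in>{1..s + t}. (\<Sum>b\<in>B. of_real (d0 b) * \<sigma> i b) = (if i = s + 1 then 1 else 0)" by (rule exE)
  note d0 = this[rule_format]
  have "(\<Sum>b\<in>B. of_real (d0 b) * \<sigma> (s + 1) b) \<noteq> 0" using d0[of "s + 1"] t_pos by simp
  then obtain b0 where b0: "b0 \<in> B" "of_real (d0 b0) * \<sigma> (s + 1) b0 \<noteq> 0"
    by (meson sum.not_neutral_contains_not_neutral)
  (* Normalizing one coefficient to 1 keeps its integer approximation away from 0. *)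
  define d where "d = (\<lambda>b. d0 b / d0 b0)"
  have db0: "d b0 = 1" using b0 by (simp add: d_def)
  have d: "(\<Sum>b\<in>B. of_real (d b) * \<sigma> i b) = 0" if "i \<in> {1..s}" for i
  proof -
    have "(\<Sum>b\<in>B. of_real (d b) * \<sigma> i b) = (\<Sum>b\<in>B. of_real (d0 b) * \<sigma> i b) / of_real (d0 b0)"
      by (simp add: d_def sum_divide_distrib)
    also have "\<dots> = 0" using d0[of i] that by simp
    finally show ?thesis .
  qed
  define R where "R = (\<Sum>i\<in>{1..s}. \<Sum>b\<in>B. norm (\<sigma> i b))"
  have R: "(\<Sum>b\<in>B. norm (\<sigma> i b)) \<le> R" if "i \<in> {1..s}" for i
    unfolding R_def by (rule member_le_sum[OF that]) (auto intro: sum_nonneg)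
  have R0: "R \<ge> 0" unfolding R_def by (intro sum_nonneg) auto
  obtain N :: nat where N: "N > 0" "R / real N < \<epsilon>"
  proof -
    obtain N :: nat where "R / \<epsilon> < real N" using reals_Archimedean2 by blast
    then have "R / real (Suc N) < \<epsilon>" using assms R0 by (simp add: field_simps)
    then show thesis by (rule that[of "Suc N", rotated]) simp
  qed
  obtain e where e: "bij_betw e {..<card B} B"
    using ex_bij_betw_nat_finite[OF B(1)] by (auto simp: lessThan_atLeast0)
  obtain q p where qp: "0 < q" "q \<le> int (N ^ card B)"
    "\<And>i. i < card B \<Longrightarrow> \<bar>of_int q * d (e i) - of_int (p i)\<bar> < 1 / real N"
    using Dirichlet_approx_simult[OF N(1), where \<theta> = "\<lambda>i. d (e i)" and n = "card B"] by metis
  define g where "g = (\<lambda>b. p (the_inv_into {..<card B} e b))"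
  have g: "\<bar>of_int q * d b - of_int (g b)\<bar> < 1 / real N" if "b \<in> B" for b
  proof -
    have inj: "inj_on e {..<card B}" and "b \<in> e ` {..<card B}" using e that by (auto simp: bij_betw_def)
    then obtain i where i: "i < card B" "e i = b" by auto
    then have "the_inv_into {..<card B} e b = i" using the_inv_into_f_f[OF inj, of i] by simp
    then show ?thesis using qp(3)[OF i(1)] i(2) by (simp add: g_def)
  qed
  define a where "a = (\<Sum>b\<in>B. of_int (g b) * b)"
  show thesis
  proof
    show "a \<in> integers_of" unfolding a_def by (rule int_combination_integer[OF B(2)])
    show "a \<noteq> 0"
    proof
      assume "a = 0"
      then have "g b0 = 0" using ind b0(1) unfolding a_def by blast
      then have "real_of_int q < 1 / real N" using g[OF b0(1)] db0 qp(1) by simp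
      also have "\<dots> \<le> 1" using N(1) by simp
      finally show False using qp(1) by simp
    qed
    fix i assume i: "i \<in> {1..s}"
    have "\<sigma> i a = (\<Sum>b\<in>B. of_int (g b) * \<sigma> i b) - of_int q * (\<Sum>b\<in>B. of_real (d b) * \<sigma> i b)"
      using d[OF i] embedding_int_combination[of i g B] i by (simp add: a_def)
    also have "\<dots> = (\<Sum>b\<in>B. of_real (of_int (g b) - of_int q * d b) * \<sigma> i b)"
      by (simp add: sum_distrib_left sum_subtractf algebra_simps)
    finally have "norm (\<sigma> i a) \<le> (\<Sum>b\<in>B. norm (of_real (of_int (g b) - of_int q * d b) * \<sigma> i b))"
      using norm_sum by metis
    also have "\<dots> \<le> (\<Sum>b\<in>B. 1 / real N * norm (\<sigma> i b))"
    proof (rule sum_mono)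
      fix b assume "b \<in> B"
      have "norm (of_real (of_int (g b) - of_int q * d b) :: complex) \<le> 1 / real N"
        unfolding norm_of_real using g[OF \<open>b \<in> B\<close>] by (simp add: abs_minus_commute)
      then show "norm (of_real (of_int (g b) - of_int q * d b) * \<sigma> i b) \<le> 1 / real N * norm (\<sigma> i b)"
        unfolding norm_mult by (rule mult_right_mono) simp
    qed
    also have "\<dots> = (\<Sum>b\<in>B. norm (\<sigma> i b)) / real N" by (simp add: sum_divide_distrib)
    also have "\<dots> \<le> R / real N" using R[OF i] by (simp add: divide_right_mono)
    also have "\<dots> < \<epsilon>" by (rule N(2))
    finally show "norm (\<sigma> i a) < \<epsilon>" .
  qed
qed

text \<open>
  Round down the coefficients in a lattice basis. The lattice of integers is thus cocompact.
\<close>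

lemma bounded_distance_to_lattice:
  "\<exists>R\<ge>0. \<forall>v. (\<forall>i\<in>{1..s}. v i \<in> \<real>) \<longrightarrow>
    (\<exists>a\<in>integers_of. \<forall>i\<in>{1..s + t}. norm (\<sigma> i a - v i) \<le> R)"
proof -
  obtain B where B: "lattice_basis B" using ex_lattice_basis by (rule exE)
  define R where "R = (\<Sum>i\<in>{1..s + t}. \<Sum>b\<in>B. norm (\<sigma> i b))"
  have "\<exists>a\<in>integers_of. \<forall>i\<in>{1..s + t}. norm (\<sigma> i a - v i) \<le> R" if v: "\<forall>i\<in>{1..s}. v i \<in> \<real>" for v
  proof -
    obtain d :: "'f \<Rightarrow> real" where d: "\<forall>i\<in>{1..s + t}. (\<Sum>b\<in>B. of_real (d b) * \<sigma> i b) = v i"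
      using B v unfolding lattice_basis_def by blast
    have "norm (\<sigma> i (\<Sum>b\<in>B. of_int \<lfloor>d b\<rfloor> * b) - v i) \<le> R" if i: "i \<in> {1..s + t}" for i
    proof -
      have "\<sigma> i (\<Sum>b\<in>B. of_int \<lfloor>d b\<rfloor> * b) - v i = (\<Sum>b\<in>B. of_real (of_int \<lfloor>d b\<rfloor> - d b) * \<sigma> i b)"
        unfolding embedding_int_combination[OF i] d[rule_format, OF i, symmetric]
        by (simp add: sum_subtractf algebra_simps)
      also have "norm \<dots> \<le> (\<Sum>b\<in>B. norm (of_real (of_int \<lfloor>d b\<rfloor> - d b) * \<sigma> i b))" by (rule norm_sum)
      also have "\<dots> \<le> (\<Sum>b\<in>B. 1 * norm (\<sigma> i b))"
      proof (rule sum_mono)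
        fix b
        have "norm (of_real (of_int \<lfloor>d b\<rfloor> - d b) :: complex) \<le> 1"
          unfolding norm_of_real by linarith
        then show "norm (of_real (of_int \<lfloor>d b\<rfloor> - d b) * \<sigma> i b) \<le> 1 * norm (\<sigma> i b)"
          unfolding norm_mult by (rule mult_right_mono) simp
      qed
      also have "\<dots> = (\<Sum>b\<in>B. norm (\<sigma> i b))" by simp
      also have "\<dots> \<le> R" unfolding R_def by (rule member_le_sum[OF i]) (auto intro: sum_nonneg)
      finally show ?thesis .
    qed
    moreover have "(\<Sum>b\<in>B. of_int \<lfloor>d b\<rfloor> * b) \<in> integers_of"
      using B by (intro int_combination_integer) (simp add: lattice_basis_def)
    ultimately show ?thesis by (intro bexI ballI)
  qed
  moreover have "R \<ge> 0" unfolding R_def by (intro sum_nonneg) auto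
  ultimately show ?thesis by (intro exI[of _ R]) blast
qed

text \<open>
  For a nonzero integer a, the multiples of a approximate \<open>x\<close> at the place i up to \<open>R * norm (\<sigma> i a)\<close>:
  approximate \<open>x i / \<sigma> i a\<close> and multiply by a. And a can be chosen small at all real places.
\<close>

lemma real_places_dense:
  fixes x :: "nat \<Rightarrow> real"
  assumes "\<epsilon> > 0"
  shows "\<exists>a\<in>integers_of. \<forall>i\<in>{1..s}. norm (\<sigma> i a - of_real (x i)) < \<epsilon>"
proof -
  obtain R where R0: "R \<ge> 0" and R: "\<forall>v. (\<forall>i\<in>{1..s}. v i \<in> \<real>) \<longrightarrow>
    (\<exists>a\<in>integers_of. \<forall>i\<in>{1..s + t}. norm (\<sigma> i a - v i) \<le> R)"
    using bounded_distance_to_lattice by (elim exE conjE)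
  obtain a where a: "a \<in> integers_of" "a \<noteq> 0" "\<And>i. i \<in> {1..s} \<Longrightarrow> norm (\<sigma> i a) < \<epsilon> / (R + 1)"
    using small_integer[of "\<epsilon> / (R + 1)"] assms R0 by auto
  have "\<forall>i\<in>{1..s}. of_real (x i) / \<sigma> i a \<in> \<real>" by (auto intro!: Reals_divide real_embedding)
  from R[THEN spec, THEN mp, OF this] obtain b where
    b: "b \<in> integers_of" "\<And>i. i \<in> {1..s + t} \<Longrightarrow> norm (\<sigma> i b - of_real (x i) / \<sigma> i a) \<le> R" by blast
  show ?thesis
  proof (intro bexI ballI)
    show "a * b \<in> integers_of" by (rule integers_of_mult[OF a(1) b(1)])
    fix i assume i: "i \<in> {1..s}"
    then have i': "i \<in> {1..s + t}" by auto
    have "\<sigma> i a \<noteq> 0" using a(2) field_embedding_simps(9)[OF embedding'[OF i']] by simp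
    then have "\<sigma> i (a * b) - of_real (x i) = \<sigma> i a * (\<sigma> i b - of_real (x i) / \<sigma> i a)"
      using field_embedding_simps(4)[OF embedding'[OF i']] by (simp add: algebra_simps)
    also have "norm \<dots> \<le> \<epsilon> / (R + 1) * R" unfolding norm_mult
      by (rule mult_mono) (use a(3)[OF i] b(2)[OF i'] assms R0 in auto)
    also have "\<dots> < \<epsilon>" using assms R0 by (simp add: field_simps)
    finally show "norm (\<sigma> i (a * b) - of_real (x i)) < \<epsilon>" .
  qed
qed

lemma ot_map_1: "ot_map s t \<sigma> 1 a z = (\<lambda>i. if i \<in> {1..s + t} then z i + \<sigma> i a else 0)"
  unfolding ot_map_def by (rule ext) (use embedding' in \<open>auto simp: field_embedding_simps(2)\<close>)

lemma ot_domain_sub: "z \<in> ot_domain s t \<Longrightarrow> z \<in> Cspace {1..s + t}"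
  by (simp add: ot_domain_def)

lemma ot_domain_upd_complex: "z \<in> ot_domain s t \<Longrightarrow> j \<in> {s + 1..s + t} \<Longrightarrow> z(j := w) \<in> ot_domain s t"
  by (auto simp: ot_domain_def Cspace_def)

lemma ot_domain_upd_real: "z \<in> ot_domain s t \<Longrightarrow> j \<in> {1..s} \<Longrightarrow> Im w > 0 \<Longrightarrow> z(j := w) \<in> ot_domain s t"
  by (auto simp: ot_domain_def Cspace_def)

lemma real_embedding_Im: "i \<in> {1..s} \<Longrightarrow> Im (\<sigma> i a) = 0"
  using real_embedding complex_is_Real_iff by blast

lemma translate_in_domain: "z \<in> ot_domain s t \<Longrightarrow> ot_map s t \<sigma> 1 a z \<in> ot_domain s t"
  by (auto simp: ot_domain_def ot_map_1 Cspace_def real_embedding_Im)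

text \<open>
  Translations by integers preserve the imaginary parts at the real places, and they move each point into
  a compact set that depends on these imaginary parts only.
\<close>

lemma bounded_on_real_tubes:
  assumes cont: "continuous_on (ot_domain s t) F"
    and per: "\<And>a z. a \<in> integers_of \<Longrightarrow> z \<in> ot_domain s t \<Longrightarrow> F (ot_map s t \<sigma> 1 a z) = F z"
    and z: "z \<in> ot_domain s t"
  shows "\<exists>C. \<forall>w\<in>ot_domain s t. (\<forall>i\<in>{1..s}. Im (w i) = Im (z i)) \<longrightarrow> norm (F w :: complex) \<le> C"
proof -
  obtain R where R: "\<forall>v. (\<forall>i\<in>{1..s}. v i \<in> \<real>) \<longrightarrow>
    (\<exists>a\<in>integers_of. \<forall>i\<in>{1..s + t}. norm (\<sigma> i a - v i) \<le> R)"
    using bounded_distance_to_lattice by (elim exE conjE)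
  define X where "X = (\<lambda>i. if i \<in> {1..s} then (\<lambda>x. of_real x + \<i> * of_real (Im (z i))) ` {-R..R}
    else if i \<in> {1..s + t} then cball 0 R else {0 :: complex})"
  define K where "K = Pi\<^sub>E UNIV X"
  have "compact (X i)" for i
    unfolding X_def by (auto intro!: compact_continuous_image continuous_intros)
  then have "compact K"
    using compactin_PiE[of "\<lambda>_. euclidean" UNIV X] unfolding K_def by (simp add: euclidean_product_topology)
  have "K \<subseteq> ot_domain s t"
  proof
    fix w assume "w \<in> K"
    then have w: "w i \<in> X i" for i by (auto simp: K_def)
    have "w i = 0" if "i \<notin> {1..s + t}" for i using w[of i] that by (auto simp: X_def)
    moreover have "Im (w i) > 0" if i: "i \<in> {1..s}" for i
    proof -
      have "Im (w i) = Im (z i)" using w[of i] i by (auto simp: X_def)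
      then show ?thesis using z i by (auto simp: ot_domain_def)
    qed
    ultimately show "w \<in> ot_domain s t" by (auto simp: ot_domain_def Cspace_def)
  qed
  then have "continuous_on K F" by (rule continuous_on_subset[OF cont])
  then have "compact (F ` K)" using \<open>compact K\<close> by (rule compact_continuous_image)
  then have "bounded (F ` K)" by (rule compact_imp_bounded)
  then obtain C where C: "\<And>w. w \<in> K \<Longrightarrow> norm (F w) \<le> C" unfolding bounded_iff by auto
  have "norm (F w) \<le> C" if w: "w \<in> ot_domain s t" and eq: "\<forall>i\<in>{1..s}. Im (w i) = Im (z i)" for w
  proof -
    define v where "v = (\<lambda>i. if i \<in> {1..s} then of_real (Re (w i)) else w i)"
    have "\<forall>i\<in>{1..s}. - v i \<in> \<real>" by (simp add: v_def)
    from R[THEN spec, THEN mp, OF this] obtain a where a: "a \<in> integers_of"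
      "\<And>i. i \<in> {1..s + t} \<Longrightarrow> norm (v i + \<sigma> i a) \<le> R" by (auto simp: add.commute)
    have "ot_map s t \<sigma> 1 a w i \<in> X i" for i
    proof -
      consider "i \<in> {1..s}" | "i \<notin> {1..s}" "i \<in> {1..s + t}" | "i \<notin> {1..s + t}" by blast
      then show ?thesis
      proof cases
        case 1
        then have i: "i \<in> {1..s + t}" by auto
        define x where "x = Re (w i) + Re (\<sigma> i a)"
        have "v i + \<sigma> i a = of_real x" using 1 real_embedding_Im[OF 1] by (simp add: v_def x_def complex_eq_iff)
        then have "x \<in> {-R..R}" using a(2)[OF i] by (simp add: abs_le_iff)
        moreover have "ot_map s t \<sigma> 1 a w i = of_real x + \<i> * of_real (Im (z i))"
          using i eq 1 real_embedding_Im[OF 1] by (simp add: ot_map_1 x_def complex_eq_iff)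
        ultimately show ?thesis using 1 by (simp only: X_def if_True image_eqI)
      next
        case 2
        then show ?thesis using a(2)[of i] by (simp add: X_def ot_map_1 v_def)
      next
        case 3
        then show ?thesis by (auto simp: X_def ot_map_1)
      qed
    qed
    then have "ot_map s t \<sigma> 1 a w \<in> K" by (auto simp: K_def PiE_def Pi_def)
    from C[OF this] show ?thesis by (simp add: per[OF a(1) w])
  qed
  then show ?thesis by blast
qed

lemma constant_if_coordinatewise_constant:
  fixes z z' :: "nat \<Rightarrow> complex"
  assumes "finite J" "\<And>z j w. z \<in> ot_domain s t \<Longrightarrow> j \<in> J \<Longrightarrow> z(j := w) \<in> ot_domain s t \<Longrightarrow> F (z(j := w)) = F z"
    "z \<in> ot_domain s t" "z' \<in> ot_domain s t" "\<And>i. i \<notin> J \<Longrightarrow> z i = z' i"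
  shows "F z = F z'"
  using assms
proof (induction J arbitrary: z)
  case empty
  then have "z = z'" by auto
  then show ?case by simp
next
  case (insert j J)
  have d: "z(j := z' j) \<in> ot_domain s t"
    using insert.prems(2,3) by (auto simp: ot_domain_def Cspace_def)
  have "F z = F (z(j := z' j))" by (rule insert.prems(1)[symmetric, OF insert.prems(2) _ d]) simp
  also have "\<dots> = F z'"
  proof (rule insert.IH[OF _ d insert.prems(3)])
    show "F (z(i := w)) = F z" if "z \<in> ot_domain s t" "i \<in> J" "z(i := w) \<in> ot_domain s t" for z i w
      using insert.prems(1) that by blast
    show "(z(j := z' j)) i = z' i" if "i \<notin> J" for i using insert.prems(4) that by simp
  qed
  finally show ?case .
qed

text \<open>
  Along a complex place F is entire, and it is bounded because the imaginary parts at the real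
  places stay fixed. Liouville's theorem applies.
\<close>

lemma constant_in_complex_directions:
  assumes hol: "holo_fun {1..s + t} (ot_domain s t) F"
    and per: "\<And>a z. a \<in> integers_of \<Longrightarrow> z \<in> ot_domain s t \<Longrightarrow> F (ot_map s t \<sigma> 1 a z) = F z"
    and z: "z \<in> ot_domain s t" and j: "j \<in> {s + 1..s + t}"
  shows "F (z(j := w)) = F z"
proof -
  have zw: "z(j := w) \<in> ot_domain s t" for w using ot_domain_upd_complex[OF z j] .
  have "continuous_on (ot_domain s t) F" using hol by (simp add: holo_fun_def)
  from bounded_on_real_tubes[OF this per z] obtain C where
    C: "\<forall>w\<in>ot_domain s t. (\<forall>i\<in>{1..s}. Im (w i) = Im (z i)) \<longrightarrow> norm (F w) \<le> C" by (rule exE)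
  have "(\<lambda>w. F (z(j := w))) constant_on UNIV"
  proof (rule Liouville_theorem)
    have "(\<lambda>w. F (z(j := w))) holomorphic_on {w. z(j := w) \<in> ot_domain s t}"
      by (rule holo_fun_slice[OF _ hol ot_domain_sub[OF z]]) (use j in auto)
    then show "(\<lambda>w. F (z(j := w))) holomorphic_on UNIV" by (simp add: zw)
    show "bounded (range (\<lambda>w. F (z(j := w))))"
      unfolding bounded_iff using C zw j by (intro exI[of _ C]) auto
  qed
  then obtain c where c: "\<And>w. F (z(j := w)) = c" by (auto simp: constant_on_def)
  show ?thesis using c[of w] c[of "z j"] by simp
qed

text \<open>
  An integer that approximates the translation at the real places moves z arbitrarily close to its
  translate, up to the coordinates at the complex places, of which F is independent.
\<close>

lemma invariant_under_real_translations:
  assumes hol: "holo_fun {1..s + t} (ot_domain s t) F"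
    and per: "\<And>a z. a \<in> integers_of \<Longrightarrow> z \<in> ot_domain s t \<Longrightarrow> F (ot_map s t \<sigma> 1 a z) = F z"
    and z: "z \<in> ot_domain s t" and j: "j \<in> {1..s}"
  shows "F (z(j := z j + of_real x)) = F z"
proof -
  define z1 where "z1 = z(j := z j + of_real x)"
  have z1: "z1 \<in> ot_domain s t"
    unfolding z1_def by (rule ot_domain_upd_real[OF z j]) (use z j in \<open>auto simp: ot_domain_def\<close>)
  have cont: "continuous_on (ot_domain s t) F" using hol by (simp add: holo_fun_def)
  have "dist (F z1) (F z) < e" if e: "e > 0" for e
  proof -
    have "openin (top_of_set (ot_domain s t)) (ot_domain s t \<inter> F -` ball (F z1) e)"
      by (rule continuous_openin_preimage_gen[OF cont]) simp
    from openin_trans[OF this holo_fun_openin[OF hol]]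
    have V: "open_in {1..s + t} (ot_domain s t \<inter> F -` ball (F z1) e)" .
    have "z1 \<in> ot_domain s t \<inter> F -` ball (F z1) e" using z1 e by simp
    from open_in_contains_polydisc[OF finite_atLeastAtMost V this]
    obtain r where r: "r > 0" "polydisc {1..s + t} z1 r \<subseteq> ot_domain s t \<inter> F -` ball (F z1) e"
      by (elim exE conjE)
    obtain a where a: "a \<in> integers_of"
      "\<And>i. i \<in> {1..s} \<Longrightarrow> norm (\<sigma> i a - of_real (if i = j then x else 0)) < r"
      using real_places_dense[OF r(1), of "\<lambda>i. if i = j then x else 0"] by blast
    define w where "w = ot_map s t \<sigma> 1 a z"
    (* Undo the effect of the integer a at the complex places. *)
    define w' where "w' = (\<lambda>i. if i \<in> {s + 1..s + t} then z i else w i)"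
    have w: "w \<in> ot_domain s t" unfolding w_def by (rule translate_in_domain[OF z])
    have w'd: "w' \<in> ot_domain s t" using w z by (auto simp: w'_def ot_domain_def Cspace_def)
    have "F w' = F w"
    proof (rule constant_if_coordinatewise_constant[where J = "{s + 1..s + t}" and F = F])
      fix z j w assume z: "z \<in> ot_domain s t" and j: "j \<in> {s + 1..s + t}"
      show "F (z(j := w)) = F z" by (rule constant_in_complex_directions[OF hol per z j])
    qed (use w w'd in \<open>auto simp: w'_def\<close>)
    also have "F w = F z" unfolding w_def by (rule per[OF a(1) z])
    finally have F: "F w' = F z" .
    have "w' \<in> polydisc {1..s + t} z1 r"
      unfolding polydisc_def
    proof (intro CollectI conjI ballI)
      show "w' \<in> Cspace {1..s + t}" by (rule ot_domain_sub[OF w'd])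
      fix i assume i: "i \<in> {1..s + t}"
      show "dist (w' i) (z1 i) < r"
      proof (cases "i \<in> {1..s}")
        case True
        then have "w' i - z1 i = \<sigma> i a - of_real (if i = j then x else 0)"
          using i by (simp add: w'_def w_def ot_map_1 z1_def)
        then show ?thesis using a(2)[OF True] by (simp only: dist_norm)
      next
        case False
        then show ?thesis using i j r(1) by (auto simp: w'_def z1_def)
      qed
    qed
    then show ?thesis using r(2) F by auto
  qed
  then have "dist (F z1) (F z) \<le> 0" by (metis less_irrefl not_le)
  then show ?thesis by (simp add: z1_def)
qed

text \<open>
  The complex derivative can be computed along the real direction, where g is constant.
\<close>

lemma constant_on_upper_half_plane:
  assumes "g holomorphic_on {w. Im w > 0}" "\<And>w x. Im w > 0 \<Longrightarrow> g (w + of_real x) = g w"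
    "Im w > 0" "Im w' > 0"
  shows "g w = g w'"
proof -
  have o: "open {w. Im w > 0}" by (rule open_halfspace_Im_gt)
  have d: "(g has_field_derivative 0) (at w within {w. Im w > 0})" if w: "w \<in> {w. Im w > 0}" for w
  proof -
    have D: "(g has_field_derivative deriv g w) (at w)"
      by (rule holomorphic_derivI[OF assms(1) o w])
    have "((\<lambda>x::real. g (w + of_real x)) has_vector_derivative 1 * deriv g w) (at 0)"
    proof (rule field_vector_diff_chain_at[unfolded o_def, where g = g and f = "\<lambda>x. w + of_real x"])
      show "((\<lambda>x::real. w + of_real x) has_vector_derivative 1) (at 0)"
        by (auto intro!: derivative_eq_intros simp: has_vector_derivative_def scaleR_conv_of_real)
      show "(g has_field_derivative deriv g w) (at (w + of_real 0))" using D by simp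
    qed
    moreover have "(\<lambda>x::real. g (w + of_real x)) = (\<lambda>_. g w)" using assms(2) w by auto
    ultimately have "((\<lambda>_::real. g w) has_vector_derivative deriv g w) (at 0)" by simp
    then have "deriv g w = 0" by (rule vector_derivative_unique_at) (rule has_vector_derivative_const)
    then show ?thesis using D by (simp add: has_field_derivative_at_within)
  qed
  have "convex {w. Im w > 0}" by (rule convex_halfspace_Im_gt)
  then obtain c where "\<And>w. w \<in> {w. Im w > 0} \<Longrightarrow> g w = c"
    using has_field_derivative_zero_constant[OF _ d] by blast
  then show ?thesis using assms(3,4) by simp
qed

text \<open>
  F is independent of each coordinate: at the complex places by Liouville's theorem, at the real
  places because it is invariant under real translations.
\<close>

theorem periodic_holomorphic_constant:
  assumes hol: "holo_fun {1..s + t} (ot_domain s t) F"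
    and per: "\<And>a z. a \<in> integers_of \<Longrightarrow> z \<in> ot_domain s t \<Longrightarrow> F (ot_map s t \<sigma> 1 a z) = F z"
    and z: "z \<in> ot_domain s t" "z' \<in> ot_domain s t"
  shows "F z = F z'"
proof (rule constant_if_coordinatewise_constant[where J = "{1..s + t}" and F = F])
  fix z j w assume z: "z \<in> ot_domain s t" and j: "j \<in> {1..s + t}" and zw: "z(j := w) \<in> ot_domain s t"
  show "F (z(j := w)) = F z"
  proof (cases "j \<in> {1..s}")
    case True
    have "F (z(j := w)) = F (z(j := z j))"
    proof (rule constant_on_upper_half_plane[of "\<lambda>w. F (z(j := w))"])
      show "(\<lambda>w. F (z(j := w))) holomorphic_on {w. Im w > 0}"
        by (rule holomorphic_on_subset[OF holo_fun_slice[OF _ hol ot_domain_sub[OF z] j]])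
           (use ot_domain_upd_real[OF z True] in auto)
      show "F (z(j := w + of_real x)) = F (z(j := w))" if "Im w > 0" for w x
        using invariant_under_real_translations[OF hol per ot_domain_upd_real[OF z True that] True, of x]
        by (simp only: fun_upd_upd fun_upd_same)
      have "\<forall>i\<in>{1..s}. Im ((z(j := w)) i) > 0" using zw by (simp add: ot_domain_def)
      from bspec[OF this True] show "Im w > 0" by simp
      show "Im (z j) > 0" using True z by (simp add: ot_domain_def)
    qed
    then show ?thesis by simp
  next
    case False
    show ?thesis by (rule constant_in_complex_directions[OF hol per z]) (use j False in auto)
  qed
qed (use z in \<open>auto simp: ot_domain_def Cspace_def\<close>)

end

section \<open>Oeljeklaus--Toma manifolds and their charts\<close>

locale ot_setting = embedded_number_field s t \<sigma>
  for s t :: nat and \<sigma> :: "nat \<Rightarrow> 'f::field_char_0 \<Rightarrow> complex" +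
  fixes U :: "'f set"
  assumes admissible: "admissible s t \<sigma> U"
begin

abbreviation "Ix \<equiv> {1..s + t}"
abbreviation "\<Omega> \<equiv> ot_domain s t"
abbreviation "\<Gamma> \<equiv> ot_map s t \<sigma>"
abbreviation "\<pi> \<equiv> ot_orbit s t \<sigma> U"
abbreviation "M \<equiv> ot_manifold s t \<sigma> U"

lemma U_props:
  assumes "u \<in> U"
  shows "u \<noteq> 0" "u \<in> integers_of" "inverse u \<in> integers_of" "inverse u \<in> U" "i \<in> {1..s} \<Longrightarrow> Re (\<sigma> i u) > 0"
  using assms admissible unfolding admissible_def positive_units_def by auto

lemma U_closed: "1 \<in> U" "u \<in> U \<Longrightarrow> v \<in> U \<Longrightarrow> u * v \<in> U"
  using admissible unfolding admissible_def by auto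

lemma ot_map_comp:
  assumes "u \<noteq> 0"
  shows "\<Gamma> v b (\<Gamma> u a z) = \<Gamma> (v * u) (a + inverse u * b) z"
proof
  fix i
  show "\<Gamma> v b (\<Gamma> u a z) i = \<Gamma> (v * u) (a + inverse u * b) z i"
  proof (cases "i \<in> Ix")
    case True
    note e = field_embedding_simps[OF embedding'[OF True]]
    have "\<sigma> i u \<noteq> 0" using assms e(9) by simp
    then show ?thesis using True unfolding ot_map_def e(3,4,10) by (simp add: field_simps)
  qed (auto simp: ot_map_def)
qed

lemma ot_map_0: "z \<in> Cspace Ix \<Longrightarrow> \<Gamma> 1 0 z = z"
  unfolding ot_map_def by (rule ext) (use embedding' in \<open>auto simp: field_embedding_simps Cspace_def\<close>)

lemma ot_map_Cspace: "\<Gamma> u a z \<in> Cspace Ix"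
  by (auto simp: ot_map_def Cspace_def)

lemma orbit_self: "z \<in> Cspace Ix \<Longrightarrow> z \<in> \<pi> z"
  unfolding ot_orbit_def using ot_map_0[of z] U_closed(1) integers_of_0 by (metis (mono_tags, lifting) CollectI)

lemma orbitI: "u \<in> U \<Longrightarrow> a \<in> integers_of \<Longrightarrow> \<Gamma> u a z \<in> \<pi> z"
  by (auto simp: ot_orbit_def)

lemma orbitE:
  assumes "w \<in> \<pi> z"
  obtains u a where "u \<in> U" "a \<in> integers_of" "w = \<Gamma> u a z"
  using assms by (auto simp: ot_orbit_def)

lemma orbit_eq:
  assumes u: "u \<in> U" and a: "a \<in> integers_of"
  shows "\<pi> (\<Gamma> u a z) = \<pi> z"
proof (intro equalityI subsetI)
  fix w assume "w \<in> \<pi> (\<Gamma> u a z)"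
  then obtain v b where vb: "v \<in> U" "b \<in> integers_of" "w = \<Gamma> v b (\<Gamma> u a z)" by (rule orbitE)
  have "w = \<Gamma> (v * u) (a + inverse u * b) z" unfolding vb(3) by (rule ot_map_comp[OF U_props(1)[OF u]])
  then show "w \<in> \<pi> z"
    using orbitI[OF U_closed(2)[OF vb(1) u] integers_of_add[OF a integers_of_mult[OF U_props(3)[OF u] vb(2)]]]
    by simp
next
  fix w assume "w \<in> \<pi> z"
  then obtain v b where vb: "v \<in> U" "b \<in> integers_of" "w = \<Gamma> v b z" by (rule orbitE)
  have "\<Gamma> (v * inverse u) (u * (b - a)) (\<Gamma> u a z) = w"
    unfolding ot_map_comp[OF U_props(1)[OF u]] vb(3) using U_props(1)[OF u] by (simp add: field_simps)
  moreover have "b - a \<in> integers_of" using integers_of_add[OF vb(2) integers_of_uminus[OF a]] by simp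
  ultimately show "w \<in> \<pi> (\<Gamma> u a z)"
    using orbitI[OF U_closed(2)[OF vb(1) U_props(4)[OF u]] integers_of_mult[OF U_props(2)[OF u]]] by metis
qed

lemma orbit_eqE:
  assumes "\<pi> z = \<pi> z'" "z' \<in> Cspace Ix"
  obtains u a where "u \<in> U" "a \<in> integers_of" "z' = \<Gamma> u a z"
  using orbit_self[OF assms(2)] assms(1) orbitE by metis

lemma orbit_mem_iff: "w \<in> \<pi> z \<Longrightarrow> \<pi> w = \<pi> z"
  by (erule orbitE) (simp add: orbit_eq)

lemma ot_map_domain:
  assumes "z \<in> \<Omega>" "u \<in> U"
  shows "\<Gamma> u a z \<in> \<Omega>"
proof -
  have "Im (\<Gamma> u a z i) > 0" if i: "i \<in> {1..s}" for i
  proof -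
    have "Im (\<Gamma> u a z i) = Re (\<sigma> i u) * Im (z i)"
      using i real_embedding_Im[OF i] by (simp add: ot_map_def)
    then show ?thesis using assms i U_props(5)[OF assms(2) i] by (simp add: ot_domain_def)
  qed
  then show ?thesis using ot_map_Cspace by (simp add: ot_domain_def)
qed

lemma orbit_sub_domain: "z \<in> \<Omega> \<Longrightarrow> \<pi> z \<subseteq> \<Omega>"
  by (auto elim!: orbitE simp: ot_map_domain)

lemma ot_map_diag_affine: "\<Gamma> u a = diag_affine Ix (\<lambda>i. \<sigma> i u) (\<lambda>i. \<sigma> i u * \<sigma> i a)"
  by (auto simp: ot_map_def diag_affine_def fun_eq_iff ring_distribs)

lemma continuous_on_ot_map: "continuous_on S (\<Gamma> u a)"
  unfolding ot_map_diag_affine by (rule continuous_on_diag_affine)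

lemma domain_open: "open_in Ix \<Omega>"
proof -
  have "\<Omega> = Cspace Ix \<inter> (\<Inter>i\<in>{1..s}. (\<lambda>z. z i) -` {w. Im w > 0})"
    by (auto simp: ot_domain_def)
  moreover have "open (\<Inter>i\<in>{1..s}. (\<lambda>z::nat \<Rightarrow> complex. z i) -` {w. Im w > 0})"
  proof (intro open_INT ballI)
    fix i show "open ((\<lambda>z::nat \<Rightarrow> complex. z i) -` {w. Im w > 0})"
      by (rule open_vimage[OF open_halfspace_Im_gt]) (rule continuous_on_product_coordinates)
  qed simp
  ultimately show ?thesis by (metis openin_open_Int)
qed

lemma openin_domain_iff: "openin (top_of_set \<Omega>) W \<longleftrightarrow> open_in Ix W \<and> W \<subseteq> \<Omega>"
  using domain_open by (meson openin_imp_subset openin_subset_trans openin_trans)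

lemma orbits_disjoint:
  assumes "S \<subseteq> \<pi> ` \<Omega>" "p \<in> S" "z \<in> p"
  shows "p = \<pi> z"
  using assms orbit_mem_iff by auto

lemma Union_orbits: "S \<subseteq> \<pi> ` \<Omega> \<Longrightarrow> \<Union>S = {z \<in> \<Omega>. \<pi> z \<in> S}"
proof (intro equalityI subsetI)
  fix z assume S: "S \<subseteq> \<pi> ` \<Omega>" and "z \<in> \<Union>S"
  then obtain p where p: "p \<in> S" "z \<in> p" by blast
  then have "p = \<pi> z" using orbits_disjoint[OF S] by blast
  moreover have "z \<in> \<Omega>" using S p orbit_sub_domain by blast
  ultimately show "z \<in> {z \<in> \<Omega>. \<pi> z \<in> S}" using p by auto
next
  fix z assume "z \<in> {z \<in> \<Omega>. \<pi> z \<in> S}"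
  then show "z \<in> \<Union>S" using orbit_self ot_domain_sub by blast
qed

lemma openin_ot_topology:
  "openin (ot_topology s t \<sigma> U) S \<longleftrightarrow> S \<subseteq> \<pi> ` \<Omega> \<and> openin (top_of_set \<Omega>) {z \<in> \<Omega>. \<pi> z \<in> S}"
proof -
  have "istopology (\<lambda>S. S \<subseteq> \<pi> ` \<Omega> \<and> openin (top_of_set \<Omega>) (\<Union>S))"
    unfolding istopology_def
  proof (intro conjI allI impI)
    fix S T assume S: "S \<subseteq> \<pi> ` \<Omega> \<and> openin (top_of_set \<Omega>) (\<Union>S)"
      and T: "T \<subseteq> \<pi> ` \<Omega> \<and> openin (top_of_set \<Omega>) (\<Union>T)"
    then have ST: "S \<inter> T \<subseteq> \<pi> ` \<Omega>" by auto
    have "\<Union>(S \<inter> T) = \<Union>S \<inter> \<Union>T"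
      using S T by (auto simp: Union_orbits[OF ST] Union_orbits)
    then show "S \<inter> T \<subseteq> \<pi> ` \<Omega>" "openin (top_of_set \<Omega>) (\<Union>(S \<inter> T))" using S T ST by auto
  next
    fix K assume K: "\<forall>S\<in>K. S \<subseteq> \<pi> ` \<Omega> \<and> openin (top_of_set \<Omega>) (\<Union>S)"
    then show "\<Union>K \<subseteq> \<pi> ` \<Omega>" by blast
    have "\<Union>(\<Union>K) = \<Union>(Union ` K)" by auto
    moreover have "openin (top_of_set \<Omega>) (\<Union>(Union ` K))" by (rule openin_Union) (use K in auto)
    ultimately show "openin (top_of_set \<Omega>) (\<Union>(\<Union>K))" by simp
  qed
  then have "openin (ot_topology s t \<sigma> U) S \<longleftrightarrow> S \<subseteq> \<pi> ` \<Omega> \<and> openin (top_of_set \<Omega>) (\<Union>S)"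
    unfolding ot_topology_def by (simp add: topology_inverse')
  then show ?thesis by (cases "S \<subseteq> \<pi> ` \<Omega>") (simp_all add: Union_orbits)
qed

lemma M_simps: "mtop M = ot_topology s t \<sigma> U" "mindex M = Ix"
  by (simp_all add: ot_manifold_def)

lemma topspace_M: "topspace (mtop M) = \<pi> ` \<Omega>"
proof
  show "topspace (mtop M) \<subseteq> \<pi> ` \<Omega>"
    using openin_topspace[of "mtop M"] unfolding M_simps openin_ot_topology by blast
  have "{z \<in> \<Omega>. \<pi> z \<in> \<pi> ` \<Omega>} = \<Omega>" by auto
  then have "openin (mtop M) (\<pi> ` \<Omega>)" unfolding M_simps openin_ot_topology by simp
  then show "\<pi> ` \<Omega> \<subseteq> topspace (mtop M)" by (rule openin_subset)
qed

lemma openin_proj_preimage: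
  "openin (mtop M) S \<Longrightarrow> open_in Ix {z \<in> \<Omega>. \<pi> z \<in> S}"
  unfolding M_simps openin_ot_topology openin_domain_iff by simp

lemma proj_open:
  assumes "open_in Ix W" "W \<subseteq> \<Omega>"
  shows "openin (mtop M) (\<pi> ` W)"
  unfolding M_simps openin_ot_topology
proof
  show "\<pi> ` W \<subseteq> \<pi> ` \<Omega>" using assms(2) by auto
  have "{z \<in> \<Omega>. \<pi> z \<in> \<pi> ` W} = (\<Union>(u, a)\<in>U \<times> (integers_of :: 'f set). {z \<in> \<Omega>. \<Gamma> u a z \<in> W})"
  proof (intro equalityI subsetI)
    fix z assume "z \<in> {z \<in> \<Omega>. \<pi> z \<in> \<pi> ` W}"
    then obtain w where w: "z \<in> \<Omega>" "w \<in> W" "\<pi> z = \<pi> w" by auto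
    obtain u a where ua: "u \<in> U" "a \<in> integers_of" "w = \<Gamma> u a z"
      using orbit_eqE[OF w(3)] assms(2) w(2) ot_domain_sub by blast
    then show "z \<in> (\<Union>(u, a)\<in>U \<times> (integers_of :: 'f set). {z \<in> \<Omega>. \<Gamma> u a z \<in> W})" using w by blast
  next
    fix z assume "z \<in> (\<Union>(u, a)\<in>U \<times> (integers_of :: 'f set). {z \<in> \<Omega>. \<Gamma> u a z \<in> W})"
    then obtain u a where ua: "u \<in> U" "a \<in> integers_of" "z \<in> \<Omega>" "\<Gamma> u a z \<in> W" by blast
    then show "z \<in> {z \<in> \<Omega>. \<pi> z \<in> \<pi> ` W}" using orbit_eq[OF ua(1,2), of z] by (metis (mono_tags, lifting) CollectI imageI)
  qed
  also have "openin (top_of_set \<Omega>) \<dots>"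
  proof (rule openin_Union, safe)
    fix u a :: 'f
    have "open_in Ix {z \<in> \<Omega>. \<Gamma> u a z \<in> W}"
      by (rule openin_preimage[OF domain_open continuous_on_ot_map assms(1)]) (use ot_map_Cspace in blast)
    then show "openin (top_of_set \<Omega>) {z \<in> \<Omega>. \<Gamma> u a z \<in> W}"
      unfolding openin_domain_iff by auto
  qed
  finally show "openin (top_of_set \<Omega>) {z \<in> \<Omega>. \<pi> z \<in> \<pi> ` W}" .
qed

text \<open>
  At the first real place, \<open>M\<^sub>u \<circ> T\<^sub>a\<close> multiplies the imaginary part by \<open>\<sigma> 1 u\<close>. A fixed point forces this
  number to be 1, then \<open>\<sigma> 1 a\<close> to be 0, and embeddings are injective.
\<close>

lemma action_free:
  assumes "u \<in> U" "z \<in> \<Omega>" "\<Gamma> u a z = z"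
  shows "u = 1 \<and> a = 0"
proof -
  have 1: "1 \<in> {1..s}" "1 \<in> Ix" using s_pos by auto
  note e = field_embedding_simps[OF embedding'[OF 1(2)]]
  have eq: "\<sigma> 1 u * (z 1 + \<sigma> 1 a) = z 1" using fun_cong[OF assms(3), of 1] 1 by (simp add: ot_map_def)
  have im: "Im (z 1) > 0" using assms(2) 1 by (simp add: ot_domain_def)
  have "Im (\<sigma> 1 u * (z 1 + \<sigma> 1 a)) = Re (\<sigma> 1 u) * Im (z 1)"
    using real_embedding_Im[OF 1(1)] by simp
  then have "Re (\<sigma> 1 u) * Im (z 1) = Im (z 1)" using eq by metis
  then have "Re (\<sigma> 1 u) = 1" using im by simp
  then have "\<sigma> 1 u = 1" using real_embedding_Im[OF 1(1)] by (simp add: complex_eq_iff)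
  moreover from this have "\<sigma> 1 a = 0" using eq by simp
  ultimately have "\<sigma> 1 (u + - 1) = 0" "\<sigma> 1 a = 0" unfolding e(2,3,5) by simp_all
  then have "u + - 1 = 0" "a = 0" unfolding e(9) .
  then show ?thesis by simp
qed

lemma compact_box:
  assumes "finite I"
  shows "compact {w \<in> Cspace I. \<forall>i\<in>I. dist (w i) (z i) \<le> r}"
proof -
  define X where "X = (\<lambda>i. if i \<in> I then cball (z i) r else {0})"
  have "{w \<in> Cspace I. \<forall>i\<in>I. dist (w i) (z i) \<le> r} = Pi\<^sub>E UNIV X"
    by (auto simp: X_def Cspace_def PiE_def Pi_def dist_commute split: if_splits)
  moreover have "compact (Pi\<^sub>E UNIV X)"
    using compactin_PiE[of "\<lambda>_. euclidean" UNIV X] by (simp add: euclidean_product_topology X_def)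
  ultimately show ?thesis by simp
qed

text \<open>
  By proper discontinuity only finitely many deck transformations move a compact neighbourhood K of
  z to a set that meets K. Each of them, except the identity, moves z in some coordinate, hence
  maps every sufficiently small polydisc around z away from itself.
\<close>

lemma evenly_covered:
  assumes z: "z \<in> \<Omega>"
  obtains W where "open_in Ix W" "z \<in> W" "W \<subseteq> \<Omega>" "inj_on \<pi> W"
proof -
  have zC: "z \<in> Cspace Ix" using z by (rule ot_domain_sub)
  obtain r0 where r0: "r0 > 0" "polydisc Ix z r0 \<subseteq> \<Omega>"
    using open_in_contains_polydisc[OF finite_atLeastAtMost domain_open z] by (elim exE conjE)
  define K where "K = {w \<in> Cspace Ix. \<forall>i\<in>Ix. dist (w i) (z i) \<le> r0 / 2}"
  have K: "compact K" "K \<subseteq> \<Omega>"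
  proof -
    show "compact K" unfolding K_def by (rule compact_box) simp
    have "K \<subseteq> polydisc Ix z r0" unfolding K_def polydisc_def using r0(1) by fastforce
    then show "K \<subseteq> \<Omega>" using r0(2) by blast
  qed
  define G where "G = {(u, a). u \<in> U \<and> a \<in> integers_of \<and> \<Gamma> u a ` K \<inter> K \<noteq> {}} - {(1, 0)}"
  have G: "finite G" using admissible K unfolding admissible_def G_def by auto
  have "\<forall>g\<in>G. \<exists>i\<in>Ix. \<Gamma> (fst g) (snd g) z i \<noteq> z i"
  proof (rule ballI, rule ccontr)
    fix g assume g: "g \<in> G" and "\<not> (\<exists>i\<in>Ix. \<Gamma> (fst g) (snd g) z i \<noteq> z i)"
    then have "\<Gamma> (fst g) (snd g) z = z" using zC ot_map_Cspace by (auto simp: fun_eq_iff Cspace_def)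
    moreover have "fst g \<in> U" using g by (auto simp: G_def)
    ultimately have "g = (1, 0)" using action_free[OF _ z] by (metis prod.collapse)
    then show False using g by (simp add: G_def)
  qed
  then obtain k where k: "\<And>g. g \<in> G \<Longrightarrow> k g \<in> Ix" "\<And>g. g \<in> G \<Longrightarrow> \<Gamma> (fst g) (snd g) z (k g) \<noteq> z (k g)"
    by metis
  (* If w and its image under g both lie within \<delta> g of z in the coordinate k g, then z cannot
     be moved as far as it is. *)
  define \<delta> where "\<delta> = (\<lambda>g. dist (\<Gamma> (fst g) (snd g) z (k g)) (z (k g)) / (norm (\<sigma> (k g) (fst g)) + 1))"
  have pos: "norm (\<sigma> i u) + 1 > 0" for i u by (simp add: add_nonneg_pos)
  define \<rho> where "\<rho> = Min (insert (r0 / 2) (\<delta> ` G))"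
  have \<rho>: "\<rho> > 0" "\<rho> \<le> r0 / 2" "\<And>g. g \<in> G \<Longrightarrow> \<rho> \<le> \<delta> g"
  proof -
    have "\<delta> g > 0" if "g \<in> G" for g using k(2)[OF that] pos by (simp add: \<delta>_def)
    then show "\<rho> > 0" unfolding \<rho>_def using G r0(1) by simp
    show "\<rho> \<le> r0 / 2" unfolding \<rho>_def using G by (intro Min_le) auto
    show "\<rho> \<le> \<delta> g" if "g \<in> G" for g unfolding \<rho>_def using G that by (intro Min_le) auto
  qed
  define W where "W = polydisc Ix z \<rho>"
  have WK: "W \<subseteq> K" unfolding W_def K_def polydisc_def using \<rho>(2) by fastforce
  show thesis
  proof
    show "open_in Ix W" unfolding W_def by (rule open_in_polydisc) simp
    show "z \<in> W" unfolding W_def using zC \<rho>(1) by (rule polydisc_center)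
    show "W \<subseteq> \<Omega>" using WK K(2) by blast
    show "inj_on \<pi> W"
    proof (rule inj_onI)
      fix w w' assume w: "w \<in> W" "w' \<in> W" "\<pi> w = \<pi> w'"
      have w'C: "w' \<in> Cspace Ix" and wC: "w \<in> Cspace Ix" using w by (auto simp: W_def polydisc_def)
      obtain u a where ua: "u \<in> U" "a \<in> integers_of" "w' = \<Gamma> u a w" using orbit_eqE[OF w(3) w'C] .
      show "w = w'"
      proof (cases "(u, a) = (1, 0)")
        case True
        then show ?thesis using ua(3) ot_map_0[OF wC] by simp
      next
        case False
        have "\<Gamma> u a ` K \<inter> K \<noteq> {}" using WK w(1,2) ua(3) by blast
        then have g: "(u, a) \<in> G" using ua False by (simp add: G_def)
        define i where "i = k (u, a)"
        have i: "i \<in> Ix" using k(1)[OF g] by (simp add: i_def)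
        have "\<Gamma> u a w i - \<Gamma> u a z i = \<sigma> i u * (w i - z i)" using i by (simp add: ot_map_def algebra_simps)
        then have "dist (\<Gamma> u a w i) (\<Gamma> u a z i) = norm (\<sigma> i u) * dist (w i) (z i)"
          by (simp add: dist_norm norm_mult)
        also have "\<dots> \<le> norm (\<sigma> i u) * \<rho>"
          using w(1) i by (intro mult_left_mono) (auto simp: W_def polydisc_def intro: less_imp_le)
        finally have 1: "dist (\<Gamma> u a w i) (\<Gamma> u a z i) \<le> norm (\<sigma> i u) * \<rho>" .
        have 2: "dist (\<Gamma> u a w i) (z i) < \<rho>"
          using w(2) i unfolding ua(3) W_def polydisc_def by blast
        have "dist (\<Gamma> u a z i) (z i) < norm (\<sigma> i u) * \<rho> + \<rho>"
          using dist_triangle3[of "\<Gamma> u a z i" "z i" "\<Gamma> u a w i"] 1 2 by linarith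
        also have "\<dots> = \<rho> * (norm (\<sigma> i u) + 1)" by (simp add: algebra_simps)
        also have "\<dots> \<le> \<delta> (u, a) * (norm (\<sigma> i u) + 1)"
          using \<rho>(3)[OF g] pos[of i u] by (intro mult_right_mono) auto
        also have "\<dots> = dist (\<Gamma> u a z i) (z i)"
          using pos[of i u] by (simp add: \<delta>_def i_def)
        finally show ?thesis by simp
      qed
    qed
  qed
qed

definition chart_dom :: "(nat \<Rightarrow> complex) set \<Rightarrow> bool" where
  "chart_dom W \<longleftrightarrow> open_in Ix W \<and> W \<subseteq> \<Omega> \<and> inj_on \<pi> W"

definition coord :: "(nat \<Rightarrow> complex) set \<Rightarrow> (nat \<Rightarrow> complex) set \<Rightarrow> nat \<Rightarrow> complex" where
  "coord W p = (THE z. z \<in> p \<inter> W)"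

lemma mcharts_M: "mcharts M = {(\<pi> ` W, coord W) | W. chart_dom W}"
  unfolding ot_manifold_def chart_dom_def openin_domain_iff coord_def[abs_def] by auto

lemma coord_proj:
  assumes W: "chart_dom W" and z: "z \<in> W"
  shows "coord W (\<pi> z) = z"
  unfolding coord_def
proof (rule the_equality)
  have sub: "W \<subseteq> Cspace Ix" using W ot_domain_sub by (auto simp: chart_dom_def)
  show "z \<in> \<pi> z \<inter> W" using z sub orbit_self by blast
  fix y assume "y \<in> \<pi> z \<inter> W"
  then have "\<pi> y = \<pi> z" "y \<in> W" using orbit_mem_iff by auto
  then show "y = z" using W z unfolding chart_dom_def inj_on_def by blast
qed

lemma coord_eq:
  assumes "chart_dom W" "w \<in> W" "\<pi> w = \<pi> z"
  shows "coord W (\<pi> z) = w"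
  using coord_proj[OF assms(1,2)] assms(3) by simp

lemma inj_on_coord: "chart_dom W \<Longrightarrow> inj_on (coord W) (\<pi> ` W)"
  by (rule inj_onI) (auto simp: coord_proj)

lemma inv_coord:
  assumes "chart_dom W" "z \<in> W"
  shows "inv_into (\<pi> ` W) (coord W) z = \<pi> z"
  using inv_into_f_f[OF inj_on_coord[OF assms(1)], of "\<pi> z"] coord_proj[OF assms] assms(2) by simp

lemma chart_image:
  assumes "chart_dom W"
  shows "coord W ` (\<pi> ` W \<inter> S) = {w \<in> W. \<pi> w \<in> S}"
  using coord_proj[OF assms] by force

lemma ex_chart: "z \<in> \<Omega> \<Longrightarrow> \<exists>W. chart_dom W \<and> z \<in> W"
  by (rule evenly_covered) (auto simp: chart_dom_def)

lemma chart_dom_subset: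
  "chart_dom W \<Longrightarrow> open_in Ix W' \<Longrightarrow> W' \<subseteq> W \<Longrightarrow> chart_dom W'"
  unfolding chart_dom_def using inj_on_subset by blast

text \<open>
  Over the open set T, the chart given by W reads the projection \<open>\<pi>\<close> as the deck transformation given
  by u and a. All local computations in charts reduce to this situation.
\<close>

definition chart_lift :: "(nat \<Rightarrow> complex) set \<Rightarrow> 'f \<Rightarrow> 'f \<Rightarrow> (nat \<Rightarrow> complex) set \<Rightarrow> bool" where
  "chart_lift W u a T \<longleftrightarrow> open_in Ix T \<and> T \<subseteq> \<Omega> \<and>
    (\<forall>y\<in>T. \<Gamma> u a y \<in> W \<and> \<pi> (\<Gamma> u a y) = \<pi> y \<and> coord W (\<pi> y) = \<Gamma> u a y)"

lemma chart_liftD: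
  assumes "chart_lift W u a T"
  shows "open_in Ix T" "T \<subseteq> \<Omega>" "y \<in> T \<Longrightarrow> \<Gamma> u a y \<in> W" "y \<in> T \<Longrightarrow> \<pi> (\<Gamma> u a y) = \<pi> y"
    "y \<in> T \<Longrightarrow> coord W (\<pi> y) = \<Gamma> u a y" "y \<in> T \<Longrightarrow> \<pi> y \<in> \<pi> ` W"
proof -
  show "open_in Ix T" "T \<subseteq> \<Omega>" "y \<in> T \<Longrightarrow> \<Gamma> u a y \<in> W" "y \<in> T \<Longrightarrow> \<pi> (\<Gamma> u a y) = \<pi> y"
    "y \<in> T \<Longrightarrow> coord W (\<pi> y) = \<Gamma> u a y"
    using assms unfolding chart_lift_def by auto
  then show "y \<in> T \<Longrightarrow> \<pi> y \<in> \<pi> ` W" by (metis imageI)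
qed

lemma ex_chart_lift:
  assumes W: "chart_dom W" and z: "z \<in> \<Omega>" "\<pi> z \<in> \<pi> ` W"
  obtains u a T where "u \<in> U" "z \<in> T" "chart_lift W u a T"
proof -
  obtain w where w: "w \<in> W" "\<pi> z = \<pi> w" using z(2) by auto
  have "w \<in> Cspace Ix" using W w(1) ot_domain_sub by (auto simp: chart_dom_def)
  with w(2) obtain u a where ua: "u \<in> U" "a \<in> integers_of" "w = \<Gamma> u a z" by (rule orbit_eqE)
  define T where "T = {y \<in> \<Omega>. \<Gamma> u a y \<in> W}"
  have To: "open_in Ix T"
    unfolding T_def
    by (rule openin_preimage[OF domain_open continuous_on_ot_map]) (use W ot_map_Cspace in \<open>auto simp: chart_dom_def\<close>)
  have lifts: "\<Gamma> u a y \<in> W \<and> \<pi> (\<Gamma> u a y) = \<pi> y \<and> coord W (\<pi> y) = \<Gamma> u a y" if "y \<in> T" for y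
    using that orbit_eq[OF ua(1,2)] coord_eq[OF W] by (auto simp: T_def)
  have "T \<subseteq> \<Omega>" by (auto simp: T_def)
  then have lift: "chart_lift W u a T" unfolding chart_lift_def by (intro conjI ballI To lifts)
  have "z \<in> T" using ua(3) w(1) z(1) by (simp add: T_def)
  then show thesis by (rule that[OF ua(1) _ lift])
qed

lemma chart_domD: "chart_dom W \<Longrightarrow> open_in Ix W" "chart_dom W \<Longrightarrow> W \<subseteq> \<Omega>"
  "chart_dom W \<Longrightarrow> inj_on \<pi> W" "chart_dom W \<Longrightarrow> W \<subseteq> Cspace Ix"
  using ot_domain_sub by (auto simp: chart_dom_def)

section \<open>Holomorphic maps into and out of the manifold\<close>

lemma holo_fun_coord_proj:
  assumes W: "chart_dom W" and S: "open_in Ix S"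
    and h: "\<And>i. i \<in> Ix \<Longrightarrow> holo_fun Ix S (\<lambda>z. h z i)" "\<And>z. z \<in> S \<Longrightarrow> h z \<in> \<Omega>" and j: "j \<in> Ix"
  shows "holo_fun Ix {z \<in> S. \<pi> (h z) \<in> \<pi> ` W} (\<lambda>z. coord W (\<pi> (h z)) j)"
proof (rule holo_fun_local)
  show "{z \<in> S. \<pi> (h z) \<in> \<pi> ` W} \<subseteq> Cspace Ix" using S openin_imp_subset by blast
  fix z0 assume "z0 \<in> {z \<in> S. \<pi> (h z) \<in> \<pi> ` W}"
  then have z0: "z0 \<in> S" "\<pi> (h z0) \<in> \<pi> ` W" by auto
  obtain u a T where "u \<in> U" "h z0 \<in> T" and lift: "chart_lift W u a T"
    by (rule ex_chart_lift[OF W h(2)[OF z0(1)] z0(2)])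
  note T = chart_liftD[OF lift]
  define N where "N = {z \<in> S. h z \<in> T}"
  have hC: "h z \<in> Cspace Ix" if "z \<in> S" for z using h(2)[OF that] by (rule ot_domain_sub)
  have N: "open_in Ix N"
    unfolding N_def by (rule openin_preimage[OF S holo_fun_continuous_map[OF h(1) hC] T(1)]) (use hC in auto)
  have "holo_fun Ix N (\<lambda>z. coord W (\<pi> (h z)) j)"
  proof (rule holo_fun_cong[OF _ N _ holo_fun_affine[OF h(1)[OF j]]])
    show "coord W (\<pi> (h z)) j = \<sigma> j u * h z j + \<sigma> j u * \<sigma> j a" if "z \<in> N" for z
      using T(5)[of "h z"] that j by (simp add: N_def ot_map_def algebra_simps)
  qed (auto simp: N_def)
  moreover have "N \<subseteq> {z \<in> S. \<pi> (h z) \<in> \<pi> ` W}" using T(6) by (auto simp: N_def)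
  moreover have "z0 \<in> N" using z0 \<open>h z0 \<in> T\<close> by (simp add: N_def)
  ultimately show "\<exists>T. z0 \<in> T \<and> T \<subseteq> {z \<in> S. \<pi> (h z) \<in> \<pi> ` W} \<and> holo_fun Ix T (\<lambda>z. coord W (\<pi> (h z)) j)"
    by (intro exI conjI)
qed simp

lemma holomorphic_map_into_M:
  assumes S: "open_in Ix S"
    and h: "\<And>i. i \<in> Ix \<Longrightarrow> holo_fun Ix S (\<lambda>z. h z i)" "\<And>z. z \<in> S \<Longrightarrow> h z \<in> \<Omega>"
  shows "holomorphic_map (Cmfd Ix) M S (\<lambda>z. \<pi> (h z))"
  unfolding holomorphic_map_from_Cmfd_iff[OF finite_atLeastAtMost]
proof (intro conjI S)
  have hC: "h z \<in> Cspace Ix" if "z \<in> S" for z using h(2)[OF that] by (rule ot_domain_sub)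
  show "continuous_map (subtopology (top_of_set (Cspace Ix)) S) (mtop M) (\<lambda>z. \<pi> (h z))"
    unfolding subtopology_open_in[OF S] continuous_map_def
  proof (intro conjI allI impI)
    show "(\<lambda>z. \<pi> (h z)) \<in> topspace (top_of_set S) \<rightarrow> topspace (mtop M)"
      using h(2) by (auto simp: topspace_M)
    fix V assume V: "openin (mtop M) V"
    have "{z \<in> S. \<pi> (h z) \<in> V} = {z \<in> S. h z \<in> {y \<in> \<Omega>. \<pi> y \<in> V}}" using h(2) by auto
    moreover have "open_in Ix {z \<in> S. h z \<in> {y \<in> \<Omega>. \<pi> y \<in> V}}"
      by (rule openin_preimage[OF S holo_fun_continuous_map[OF h(1) hC] openin_proj_preimage[OF V]])
         (use hC in auto)
    ultimately show "openin (top_of_set S) {z \<in> topspace (top_of_set S). \<pi> (h z) \<in> V}"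
      using openin_subset_trans[OF _ _ openin_imp_subset[OF S]] by auto
  qed
  show "\<forall>(V, d)\<in>mcharts M. \<forall>j\<in>mindex M. holo_fun Ix {z \<in> S. \<pi> (h z) \<in> V} (\<lambda>z. d (\<pi> (h z)) j)"
    using holo_fun_coord_proj[OF _ S h] by (auto simp: mcharts_M M_simps)
qed

text \<open>
  On \<open>W0\<close> the projection is injective and inverse to a chart, and the other charts differ from this one
  by deck transformations. So holomorphy may be tested on \<open>W0\<close>.
\<close>

lemma holomorphic_map_from_M:
  assumes W0: "chart_dom W0" and f: "holomorphic_map (Cmfd Ix) N W0 (\<lambda>z. f (\<pi> z))"
  shows "holomorphic_map M N (\<pi> ` W0) f"
  unfolding holomorphic_map_def
proof (intro conjI)
  have fc: "continuous_map (subtopology (top_of_set (Cspace Ix)) W0) (mtop N) (\<lambda>z. f (\<pi> z))"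
    and fh: "\<And>V d j. (V, d) \<in> mcharts N \<Longrightarrow> j \<in> mindex N \<Longrightarrow>
      holo_fun Ix {z \<in> W0. f (\<pi> z) \<in> V} (\<lambda>z. d (f (\<pi> z)) j)"
    using f unfolding holomorphic_map_from_Cmfd_iff[OF finite_atLeastAtMost] by auto
  show o: "openin (mtop M) (\<pi> ` W0)" by (rule proj_open[OF chart_domD(1,2)[OF W0]])
  show "continuous_map (subtopology (mtop M) (\<pi> ` W0)) (mtop N) f"
    unfolding continuous_map_def
  proof (intro conjI allI impI)
    have ts: "topspace (subtopology (mtop M) (\<pi> ` W0)) = \<pi> ` W0"
      using chart_domD(2)[OF W0] by (auto simp: topspace_subtopology topspace_M)
    show "f \<in> topspace (subtopology (mtop M) (\<pi> ` W0)) \<rightarrow> topspace (mtop N)"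
      using continuous_map_image_subset_topspace[OF fc]
      unfolding ts subtopology_open_in[OF chart_domD(1)[OF W0]] by auto
    fix V assume "openin (mtop N) V"
    from open_in_preimage_map[OF chart_domD(1)[OF W0] fc this]
    have "openin (mtop M) (\<pi> ` {z \<in> W0. f (\<pi> z) \<in> V})"
      by (rule proj_open) (use chart_domD(2)[OF W0] in auto)
    moreover have "\<pi> ` {z \<in> W0. f (\<pi> z) \<in> V} = {p \<in> \<pi> ` W0. f p \<in> V}" by auto
    ultimately show "openin (subtopology (mtop M) (\<pi> ` W0)) {p \<in> topspace (subtopology (mtop M) (\<pi> ` W0)). f p \<in> V}"
      unfolding openin_open_subtopology[OF o] ts by auto
  qed
  have "holo_fun Ix (coord W ` (\<pi> ` W0 \<inter> \<pi> ` W \<inter> f -` V)) (\<lambda>z. d (f (inv_into (\<pi> ` W) (coord W) z)) j)"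
    if W: "chart_dom W" and V: "(V, d) \<in> mcharts N" "j \<in> mindex N" for W V d j
  proof -
    define A where "A = {w \<in> W. \<pi> w \<in> \<pi> ` W0 \<and> f (\<pi> w) \<in> V}"
    have "\<pi> ` W0 \<inter> \<pi> ` W \<inter> f -` V = \<pi> ` W \<inter> (\<pi> ` W0 \<inter> f -` V)" by auto
    then have eq: "coord W ` (\<pi> ` W0 \<inter> \<pi> ` W \<inter> f -` V) = A"
      using chart_image[OF W] unfolding A_def by auto
    show ?thesis unfolding eq
    proof (rule holo_fun_local)
      show "A \<subseteq> Cspace Ix" using chart_domD(4)[OF W] by (auto simp: A_def)
      fix w assume wA: "w \<in> A"
      then have w: "w \<in> W" "w \<in> \<Omega>" "\<pi> w \<in> \<pi> ` W0" using chart_domD(2)[OF W] by (auto simp: A_def)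
      obtain u a T where "u \<in> U" "w \<in> T" and lift: "chart_lift W0 u a T"
        by (rule ex_chart_lift[OF W0 w(2,3)])
      note T = chart_liftD[OF lift]
      define N where "N = {y \<in> T \<inter> W. \<Gamma> u a y \<in> {z \<in> W0. f (\<pi> z) \<in> V}}"
      have No: "open_in Ix N"
        unfolding N_def
        by (rule openin_preimage[OF openin_Int[OF T(1) chart_domD(1)[OF W]] continuous_on_ot_map holo_fun_openin[OF fh[OF V]]])
           (use ot_map_Cspace in blast)
      have "holo_fun Ix N (\<lambda>y. d (f (\<pi> (\<Gamma> u a y))) j)"
        unfolding ot_map_diag_affine
        by (rule holo_fun_comp_diag_affine[OF _ No fh[OF V]]) (auto simp: N_def ot_map_diag_affine)
      then have "holo_fun Ix N (\<lambda>z. d (f (inv_into (\<pi> ` W) (coord W) z)) j)"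
        by (rule holo_fun_cong[OF finite_atLeastAtMost No order_refl])
           (use T(4) inv_coord[OF W] in \<open>simp add: N_def\<close>)
      moreover have "N \<subseteq> A" using T(4,6) by (auto simp: N_def A_def)
      moreover have "w \<in> N" using wA \<open>w \<in> T\<close> T(3,4) by (simp add: N_def A_def)
      ultimately show "\<exists>T. w \<in> T \<and> T \<subseteq> A \<and> holo_fun Ix T (\<lambda>z. d (f (inv_into (\<pi> ` W) (coord W) z)) j)"
        by (intro exI conjI)
    qed simp
  qed
  then show "\<forall>(V, c)\<in>mcharts M. \<forall>(V', d)\<in>mcharts N. \<forall>j\<in>mindex N.
      holo_fun (mindex M) (c ` (\<pi> ` W0 \<inter> V \<inter> f -` V')) (\<lambda>z. d (f (inv_into V c z)) j)"
    by (auto simp: mcharts_M M_simps)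
qed

lemma biholomorphism_into_M:
  assumes W: "chart_dom W" and h: "biholomorphism_on (Cmfd Ix) (Cmfd Ix) S h" "h ` S \<subseteq> W"
  shows "biholomorphism_on (Cmfd Ix) M S (\<lambda>z. \<pi> (h z))"
  unfolding biholomorphism_on_def
proof (intro conjI)
  have h': "open_in Ix S" "\<And>i. i \<in> Ix \<Longrightarrow> holo_fun Ix S (\<lambda>z. h z i)" "inj_on h S" "open_in Ix (h ` S)"
    using h(1) unfolding biholomorphism_Cmfd_iff[OF finite_atLeastAtMost] by auto
  have k: "holomorphic_map (Cmfd Ix) (Cmfd Ix) (h ` S) (inv_into S h)"
    using h(1) by (simp only: biholomorphism_on_def)
  have hO: "h z \<in> \<Omega>" if "z \<in> S" for z using h(2) that chart_domD(2)[OF W] by blast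
  show "holomorphic_map (Cmfd Ix) M S (\<lambda>z. \<pi> (h z))" by (rule holomorphic_map_into_M[OF h'(1,2) hO])
  have "inj_on \<pi> (h ` S)" by (rule inj_on_subset[OF chart_domD(3)[OF W] h(2)])
  then show inj: "inj_on (\<lambda>z. \<pi> (h z)) S" using comp_inj_on[OF h'(3)] by (simp add: o_def)
  have im: "(\<lambda>z. \<pi> (h z)) ` S = \<pi> ` (h ` S)" by auto
  show "openin (mtop M) ((\<lambda>z. \<pi> (h z)) ` S)"
    unfolding im by (rule proj_open[OF h'(4)]) (use hO in auto)
  have "inv_into S (\<lambda>z. \<pi> (h z)) (\<pi> y) = inv_into S h y" if y: "y \<in> h ` S" for y
  proof -
    obtain z where "z \<in> S" "y = h z" using y by auto
    then show ?thesis using inv_into_f_f[OF inj, of z] inv_into_f_f[OF h'(3), of z] by simp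
  qed
  then have "holomorphic_map (Cmfd Ix) (Cmfd Ix) (h ` S) (\<lambda>y. inv_into S (\<lambda>z. \<pi> (h z)) (\<pi> y))"
    by (rule holomorphic_map_cong[OF finite_atLeastAtMost k])
  then show "holomorphic_map M (Cmfd Ix) ((\<lambda>z. \<pi> (h z)) ` S) (inv_into S (\<lambda>z. \<pi> (h z)))"
    unfolding im by (rule holomorphic_map_from_M[OF chart_dom_subset[OF W h'(4) h(2)]])
qed

lemma biholomorphism_M_M:
  assumes W: "chart_dom W" and S: "S \<subseteq> W"
    and h: "biholomorphism_on (Cmfd Ix) (Cmfd Ix) S h" "h ` S \<subseteq> W"
    and f: "\<And>z. z \<in> S \<Longrightarrow> f (\<pi> z) = \<pi> (h z)"
  shows "biholomorphism_on M M (\<pi> ` S) f"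
  unfolding biholomorphism_on_def
proof (intro conjI)
  have h': "open_in Ix S" "inj_on h S" "open_in Ix (h ` S)"
    using h(1) unfolding biholomorphism_Cmfd_iff[OF finite_atLeastAtMost] by auto
  have hol: "holomorphic_map M M (\<pi> ` A) f'"
    if "A \<subseteq> W" "biholomorphism_on (Cmfd Ix) (Cmfd Ix) A h'" "h' ` A \<subseteq> W" "\<And>z. z \<in> A \<Longrightarrow> f' (\<pi> z) = \<pi> (h' z)"
    for A h' f'
  proof (rule holomorphic_map_from_M)
    have A: "open_in Ix A" "\<And>i. i \<in> Ix \<Longrightarrow> holo_fun Ix A (\<lambda>z. h' z i)"
      using that(2) unfolding biholomorphism_Cmfd_iff[OF finite_atLeastAtMost] by auto
    show "chart_dom A" by (rule chart_dom_subset[OF W A(1) that(1)])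
    have "holomorphic_map (Cmfd Ix) M A (\<lambda>z. \<pi> (h' z))"
      by (rule holomorphic_map_into_M[OF A]) (use that(3) chart_domD(2)[OF W] in auto)
    then show "holomorphic_map (Cmfd Ix) M A (\<lambda>z. f' (\<pi> z))" by (rule holomorphic_map_cong[OF finite_atLeastAtMost]) (simp add: that(4))
  qed
  show "holomorphic_map M M (\<pi> ` S) f" by (rule hol[OF S h f])
  have ip: "inj_on \<pi> (h ` S)" by (rule inj_on_subset[OF chart_domD(3)[OF W] h(2)])
  show inj: "inj_on f (\<pi> ` S)"
  proof (rule inj_onI)
    fix p q assume "p \<in> \<pi> ` S" "q \<in> \<pi> ` S" and eq: "f p = f q"
    then obtain x y where xy: "x \<in> S" "y \<in> S" "p = \<pi> x" "q = \<pi> y" by (elim imageE)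
    have "\<pi> (h x) = \<pi> (h y)" using eq f[OF xy(1)] f[OF xy(2)] xy(3,4) by simp
    then have "h x = h y" by (rule inj_onD[OF ip]) (use xy in blast)+
    then have "x = y" by (rule inj_onD[OF h'(2) _ xy(1,2)])
    then show "p = q" using xy(3,4) by simp
  qed
  have im: "f ` (\<pi> ` S) = \<pi> ` (h ` S)" unfolding image_image by (rule image_cong[OF refl f])
  show "openin (mtop M) (f ` (\<pi> ` S))"
    unfolding im by (rule proj_open[OF h'(3)]) (use h(2) chart_domD(2)[OF W] in auto)
  show "holomorphic_map M M (f ` (\<pi> ` S)) (inv_into (\<pi> ` S) f)"
    unfolding im
  proof (rule hol[OF h(2) biholomorphism_Cmfd_inverse[OF finite_atLeastAtMost h(1)]])
    show "inv_into S h ` h ` S \<subseteq> W" using h'(2) S by (simp add: inv_into_image_cancel)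
    fix y assume "y \<in> h ` S"
    then obtain z where z: "z \<in> S" "y = h z" by auto
    then show "inv_into (\<pi> ` S) f (\<pi> y) = \<pi> (inv_into S h y)"
      using inv_into_f_f[OF inj, of "\<pi> z"] f h'(2) by (simp add: inv_into_f_f)
  qed
qed

section \<open>Frames\<close>

lemma frame_germ_shift:
  assumes g: "fixing_germ Ix g" and z: "z \<in> \<Omega>"
  shows "frame_germ M (\<lambda>w. \<pi> (shift Ix z (g w)))"
proof -
  obtain W where W: "origin \<in> W" "biholomorphism_on (Cmfd Ix) (Cmfd Ix) W g" and g0: "g origin = origin"
    using g by (auto simp: fixing_germ_def frame_germ_def Cmfd_simps)
  note g' = W(2)[unfolded biholomorphism_Cmfd_iff[OF finite_atLeastAtMost]]
  obtain W0 where W0: "chart_dom W0" "z \<in> W0" using ex_chart[OF z] by blast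
  have zC: "z \<in> Cspace Ix" by (rule ot_domain_sub[OF z])
  have gC: "g w \<in> Cspace Ix" if "w \<in> W" for w using g' that by blast
  have inj: "inj_on g W" using g' by blast
  define h where "h = (\<lambda>w. shift Ix z (g w))"
  define S where "S = {w \<in> W. h w \<in> W0}"
  have hol: "holo_fun Ix W (\<lambda>w. h w i)" if "i \<in> Ix" for i
  proof -
    have "holo_fun Ix W (\<lambda>w. g w i)" using g' that by blast
    from holo_fun_affine[OF this, of 1 "z i"] show ?thesis using that by (simp add: h_def shift_apply)
  qed
  have So: "open_in Ix S"
    unfolding S_def
    by (rule openin_preimage[OF _ holo_fun_continuous_map[OF hol] chart_domD(1)[OF W0(1)]])
       (use g' shift_Cspace in \<open>auto simp: h_def\<close>)
  have hS: "h ` S = {y \<in> W0. shift Ix (\<lambda>i. - z i) y \<in> g ` W}"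
  proof (intro equalityI subsetI)
    fix y assume "y \<in> h ` S"
    then show "y \<in> {y \<in> W0. shift Ix (\<lambda>i. - z i) y \<in> g ` W}"
      using gC by (auto simp: S_def h_def shift_cancel)
  next
    fix y assume y: "y \<in> {y \<in> W0. shift Ix (\<lambda>i. - z i) y \<in> g ` W}"
    then obtain w where w: "w \<in> W" "shift Ix (\<lambda>i. - z i) y = g w" by auto
    have "y \<in> Cspace Ix" using y chart_domD(4)[OF W0(1)] by blast
    then have "y = h w" using w(2) shift_cancel(1) by (metis h_def)
    then show "y \<in> h ` S" using w y by (auto simp: S_def)
  qed
  have "biholomorphism_on (Cmfd Ix) (Cmfd Ix) S h"
  proof (rule biholomorphism_CmfdI[OF finite_atLeastAtMost So, where k = "\<lambda>y. inv_into W g (shift Ix (\<lambda>i. - z i) y)"])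
    show "holo_fun Ix S (\<lambda>w. h w i)" if "i \<in> Ix" for i
      by (rule holo_fun_cong[OF _ So _ hol[OF that]]) (auto simp: S_def)
    show "h w \<in> Cspace Ix" for w by (simp add: h_def shift_Cspace)
    show ho: "open_in Ix (h ` S)"
      unfolding hS
      by (rule openin_preimage[OF chart_domD(1)[OF W0(1)] continuous_on_shift]) (use g' shift_Cspace in auto)
    show "holo_fun Ix (h ` S) (\<lambda>y. inv_into W g (shift Ix (\<lambda>i. - z i) y) i)" if i: "i \<in> Ix" for i
    proof -
      have "holo_fun Ix (g ` W) (\<lambda>y. inv_into W g y i)" using g' i by blast
      from holo_fun_comp_diag_affine[OF _ ho this, of "\<lambda>_. 1" "\<lambda>i. - z i"]
      show ?thesis unfolding shift_def[symmetric] using hS by auto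
    qed
    show "inv_into W g (shift Ix (\<lambda>i. - z i) (h w)) = w" if "w \<in> S" for w
      using that gC inj by (auto simp: S_def h_def shift_cancel inv_into_f_f)
  qed
  then have "biholomorphism_on (Cmfd Ix) M S (\<lambda>w. \<pi> (h w))"
    by (rule biholomorphism_into_M[OF W0(1)]) (auto simp: S_def)
  moreover have "origin \<in> S" using W(1) W0(2) unfolding S_def h_def by (simp only: g0 shift_origin[OF zC] mem_Collect_eq simp_thms)
  ultimately show ?thesis unfolding frame_germ_def M_simps h_def by blast
qed

text \<open>
  Each frame at \<open>\<pi> z\<close> is the projection of the translation by z, composed with a germ that fixes 0.
  In this way translations act on frames without changing the germ g.
\<close>

lemma frame_germ_lift:
  assumes r: "frame_germ M r" and W0: "chart_dom W0" "z \<in> W0" "r origin = \<pi> z"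
  obtains g S where "fixing_germ Ix g" "open_in Ix S" "origin \<in> S"
    "\<And>i. i \<in> Ix \<Longrightarrow> holo_fun Ix S (\<lambda>w. g w i)" "\<And>w. w \<in> S \<Longrightarrow> g w \<in> Cspace Ix"
    "\<And>w. w \<in> S \<Longrightarrow> r w = \<pi> (shift Ix z (g w))" "\<And>w. w \<in> S \<Longrightarrow> shift Ix z (g w) \<in> W0"
    "\<And>w. w \<in> S \<Longrightarrow> coord W0 (r w) = shift Ix z (g w)"
proof -
  obtain W where W: "origin \<in> W" "biholomorphism_on (Cmfd Ix) M W r"
    using r unfolding frame_germ_def M_simps by blast
  then have r1: "holomorphic_map (Cmfd Ix) M W r" and inj: "inj_on r W" and rW: "openin (mtop M) (r ` W)"
    and r2: "holomorphic_map M (Cmfd Ix) (r ` W) (inv_into W r)"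
    by (auto simp: biholomorphism_on_def)
  note r1' = r1[unfolded holomorphic_map_from_Cmfd_iff[OF finite_atLeastAtMost]]
  note Wo = conjunct1[OF r1'] and rc = conjunct1[OF conjunct2[OF r1']] and rh = conjunct2[OF conjunct2[OF r1']]
  have CM: "(\<pi> ` W0, coord W0) \<in> mcharts M" using W0(1) by (auto simp: mcharts_M)
  have WC: "W \<subseteq> Cspace Ix" using Wo openin_imp_subset by blast
  define S where "S = {w \<in> W. r w \<in> \<pi> ` W0}"
  have So: "open_in Ix S"
    unfolding S_def by (rule open_in_preimage_map[OF Wo rc proj_open[OF chart_domD(1,2)[OF W0(1)]]])
  have SW: "S \<subseteq> W" by (auto simp: S_def)
  define g where "g = (\<lambda>w. shift Ix (\<lambda>i. - z i) (coord W0 (r w)))"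
  have cW0: "coord W0 (r w) \<in> W0" "\<pi> (coord W0 (r w)) = r w" if "w \<in> S" for w
    using that coord_proj[OF W0(1)] by (auto simp: S_def)
  have sg: "shift Ix z (g w) = coord W0 (r w)" if "w \<in> S" for w
    unfolding g_def using cW0(1)[OF that] chart_domD(4)[OF W0(1)] by (intro shift_cancel(1)) auto
  have gC: "g w \<in> Cspace Ix" for w by (simp add: g_def shift_Cspace)
  have hol: "holo_fun Ix S (\<lambda>w. g w i)" if i: "i \<in> Ix" for i
  proof -
    have "holo_fun Ix S (\<lambda>w. coord W0 (r w) i)"
      unfolding S_def by (rule bspec[OF rh CM, unfolded prod.case M_simps, THEN bspec, OF i])
    from holo_fun_affine[OF this, of 1 "- z i"] show ?thesis using i by (simp add: g_def shift_apply)
  qed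
  have g0: "g origin = origin"
    unfolding g_def W0(3) coord_proj[OF W0(1,2)] by (rule shift_self)
  have oS: "origin \<in> S" using W(1) W0(2,3) by (simp add: S_def)
  define B where "B = W0 \<inter> {x \<in> \<Omega>. \<pi> x \<in> r ` W}"
  have Bo: "open_in Ix B"
    unfolding B_def by (rule openin_Int[OF chart_domD(1)[OF W0(1)] openin_proj_preimage[OF rW]])
  have gS: "g ` S = {y \<in> Cspace Ix. shift Ix z y \<in> B}"
  proof (intro equalityI subsetI)
    fix y assume "y \<in> g ` S"
    then obtain w where w: "w \<in> S" "y = g w" by auto
    have "coord W0 (r w) \<in> B"
      unfolding B_def using cW0[OF w(1)] SW w(1) chart_domD(2)[OF W0(1)] by auto
    then show "y \<in> {y \<in> Cspace Ix. shift Ix z y \<in> B}" using w gC sg by simp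
  next
    fix y assume y: "y \<in> {y \<in> Cspace Ix. shift Ix z y \<in> B}"
    then obtain w where w: "w \<in> W" "\<pi> (shift Ix z y) = r w" and s: "shift Ix z y \<in> W0" by (auto simp: B_def)
    have "r w \<in> \<pi> ` W0" using w(2) s by (metis imageI)
    then have "w \<in> S" using w(1) by (simp add: S_def)
    moreover have "g w = y"
      unfolding g_def w(2)[symmetric] coord_proj[OF W0(1) s] using y by (simp add: shift_cancel)
    ultimately show "y \<in> g ` S" by auto
  qed
  have gSo: "open_in Ix (g ` S)"
    unfolding gS by (rule openin_preimage[OF _ continuous_on_shift Bo]) (auto simp: shift_Cspace)
  have holi: "holo_fun Ix (g ` S) (\<lambda>y. inv_into W r (\<pi> (shift Ix z y)) i)" if i: "i \<in> Ix" for i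
  proof -
    have "\<forall>(V, c)\<in>mcharts M. \<forall>j\<in>Ix. holo_fun Ix (c ` (r ` W \<inter> V \<inter> inv_into W r -` Cspace Ix))
        (\<lambda>z. inv_into W r (inv_into V c z) j)"
      using r2 unfolding holomorphic_map_def Cmfd_simps M_simps by simp
    note h0 = bspec[OF this CM, unfolded prod.case, THEN bspec, OF i]
    have "r ` W \<inter> \<pi> ` W0 \<inter> inv_into W r -` Cspace Ix = \<pi> ` W0 \<inter> r ` W"
      using WC inv_into_into by (auto simp: inj inv_into_f_f)
    moreover have "coord W0 ` (\<pi> ` W0 \<inter> r ` W) = B"
      unfolding chart_image[OF W0(1)] B_def using chart_domD(2)[OF W0(1)] by auto
    ultimately have h1: "holo_fun Ix B (\<lambda>x. inv_into W r (inv_into (\<pi> ` W0) (coord W0) x) i)"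
      using h0 by (simp only:)
    have h2: "holo_fun Ix (g ` S) (\<lambda>y. inv_into W r (inv_into (\<pi> ` W0) (coord W0) (shift Ix z y)) i)"
      using holo_fun_comp_diag_affine[OF _ gSo h1, of "\<lambda>_. 1" z] gS unfolding shift_def[symmetric] by auto
    show ?thesis
    proof (rule holo_fun_cong[OF _ gSo order_refl h2])
      fix y assume "y \<in> g ` S"
      then have "shift Ix z y \<in> W0" unfolding gS B_def by blast
      then show "inv_into W r (\<pi> (shift Ix z y)) i = inv_into W r (inv_into (\<pi> ` W0) (coord W0) (shift Ix z y)) i"
        by (simp add: inv_coord[OF W0(1)])
    qed simp
  qed
  have "biholomorphism_on (Cmfd Ix) (Cmfd Ix) S g"
  proof (rule biholomorphism_CmfdI[OF finite_atLeastAtMost So hol gC gSo holi])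
    show "inv_into W r (\<pi> (shift Ix z (g w))) = w" if "w \<in> S" for w
      unfolding sg[OF that] cW0(2)[OF that] using that SW inj by (auto simp: inv_into_f_f)
  qed
  then have "fixing_germ Ix g"
    unfolding fixing_germ_def frame_germ_def Cmfd_simps using oS g0 by blast
  then show thesis
    by (rule that[OF _ So oS hol gC]) (use sg cW0 in auto)
qed

lemma fixing_germ_ident: "fixing_germ Ix (\<lambda>w. w)"
proof -
  have "open_in Ix (Cspace Ix)" by simp
  then have "biholomorphism_on (Cmfd Ix) (Cmfd Ix) (Cspace Ix) (\<lambda>w. w)"
    by (intro biholomorphism_CmfdI[OF finite_atLeastAtMost, where k = "\<lambda>w. w"]) (simp_all add: holo_fun_coord)
  then show ?thesis unfolding fixing_germ_def frame_germ_def Cmfd_simps using zero_in_Cspace by blast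
qed

text \<open>
  The frame at \<open>\<pi> z\<close> defined by the translation that takes 0 to z. These frames trivialize the frame
  bundle over the domain, and translations permute them.
\<close>

definition base_frame :: "(nat \<Rightarrow> complex) \<Rightarrow> (nat \<Rightarrow> complex) \<Rightarrow> (nat \<Rightarrow> complex) set" where
  "base_frame z w = \<pi> (shift Ix z w)"

lemma frame_germ_base_frame: "z \<in> \<Omega> \<Longrightarrow> frame_germ M (base_frame z)"
  using frame_germ_shift[OF fixing_germ_ident] by (simp add: base_frame_def[abs_def])

lemma base_frame_origin: "z \<in> \<Omega> \<Longrightarrow> base_frame z origin = \<pi> z"
  unfolding base_frame_def by (simp only: shift_origin[OF ot_domain_sub])

lemma base_frame_translate:
  assumes "a \<in> integers_of"
  shows "base_frame (\<Gamma> 1 a z) = base_frame z"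
proof
  fix w
  have "shift Ix (\<Gamma> 1 a z) w = \<Gamma> 1 a (shift Ix z w)"
    by (auto simp: shift_apply ot_map_1)
  then show "base_frame (\<Gamma> 1 a z) w = base_frame z w"
    unfolding base_frame_def using orbit_eq[OF U_closed(1) assms] by simp
qed

text \<open>
  The coordinates of the jet of \<open>c * f + d\<close> if those of the jet of f are J.
\<close>

definition change_jet :: "nat \<Rightarrow> (nat \<Rightarrow> complex) \<Rightarrow> (nat \<Rightarrow> complex) \<Rightarrow> (nat \<times> nat multiset \<Rightarrow> complex) \<Rightarrow>
    nat \<times> nat multiset \<Rightarrow> complex" where
  "change_jet k c d J = (\<lambda>(i, \<mu>). if (i, \<mu>) \<in> jet_index Ix k
     then c i * J (i, \<mu>) + (if \<mu> = {#} then d i else 0) else 0)"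

text \<open>
  The numbers c and d depend on the point and on the two charts, and not on the frame. So the jet in
  one chart determines the jet in all charts.
\<close>

lemma jet_in_other_chart:
  assumes W0: "chart_dom W0" "z \<in> W0" and W: "chart_dom W" "\<pi> z \<in> \<pi> ` W"
  shows "\<exists>c d. \<forall>r. frame_germ M r \<longrightarrow> r origin = \<pi> z \<longrightarrow>
    jet_coords Ix k (coord W \<circ> r) = change_jet k c d (jet_coords Ix k (coord W0 \<circ> r))"
proof -
  have zO: "z \<in> \<Omega>" using W0 chart_domD(2) by blast
  obtain u a T where "u \<in> U" "z \<in> T" and lift: "chart_lift W u a T"
    by (rule ex_chart_lift[OF W(1) zO W(2)])
  note T = chart_liftD[OF lift]
  show ?thesis
  proof (intro exI allI impI)
    fix r assume r: "frame_germ M r" "r origin = \<pi> z"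
    obtain g S where g: "fixing_germ Ix g" "open_in Ix S" "origin \<in> S"
      "\<And>i. i \<in> Ix \<Longrightarrow> holo_fun Ix S (\<lambda>w. g w i)" "\<And>w. w \<in> S \<Longrightarrow> g w \<in> Cspace Ix"
      "\<And>w. w \<in> S \<Longrightarrow> r w = \<pi> (shift Ix z (g w))" "\<And>w. w \<in> S \<Longrightarrow> shift Ix z (g w) \<in> W0"
      "\<And>w. w \<in> S \<Longrightarrow> coord W0 (r w) = shift Ix z (g w)"
      by (rule frame_germ_lift[OF r(1) W0 r(2)]) (rule that)
    define S1 where "S1 = {w \<in> S. shift Ix z (g w) \<in> T}"
    have cont: "continuous_on S (\<lambda>w. shift Ix z (g w))"
      by (rule continuous_on_compose2[OF continuous_on_shift[of UNIV] holo_fun_continuous_map[OF g(4,5)]]) auto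
    have S1: "open_in Ix S1"
      unfolding S1_def by (rule openin_preimage[OF g(2) cont T(1)]) (auto simp: shift_Cspace)
    have "\<pi> (shift Ix z (g origin)) = \<pi> z" using g(6)[OF g(3)] r(2) by simp
    then have "shift Ix z (g origin) = z"
      using chart_domD(3)[OF W0(1)] g(7)[OF g(3)] W0(2) by (meson inj_onD)
    then have o: "origin \<in> S1" using g(3) \<open>z \<in> T\<close> by (simp add: S1_def)
    show "jet_coords Ix k (coord W \<circ> r) =
        change_jet k (\<lambda>i. \<sigma> i u) (\<lambda>i. \<sigma> i u * \<sigma> i a) (jet_coords Ix k (coord W0 \<circ> r))"
      unfolding change_jet_def
    proof (rule jet_coords_affine[OF finite_atLeastAtMost _ o])
      fix i assume i: "i \<in> Ix"
      have hS: "holo_fun Ix S (\<lambda>w. 1 * g w i + z i)" by (rule holo_fun_affine[OF g(4)[OF i]])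
      show "holo_fun Ix S1 (\<lambda>w. (coord W0 \<circ> r) w i)"
      proof (rule holo_fun_cong[OF finite_atLeastAtMost S1 _ hS])
        show "(coord W0 \<circ> r) w i = 1 * g w i + z i" if "w \<in> S1" for w
          using g(8) that i by (simp add: S1_def shift_apply)
      qed (auto simp: S1_def)
      fix w assume w: "w \<in> S1"
      then have "(coord W \<circ> r) w = \<Gamma> u a ((coord W0 \<circ> r) w)" using T(5) g(6,8) by (simp add: S1_def)
      then show "(coord W \<circ> r) w i = \<sigma> i u * (coord W0 \<circ> r) w i + \<sigma> i u * \<sigma> i a"
        using i by (simp add: ot_map_def algebra_simps)
    qed
  qed
qed

lemma jet_eq_if_chart_jet_eq:
  assumes W0: "chart_dom W0" and r: "frame_germ M r" "r origin \<in> \<pi> ` W0"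
    and r': "frame_germ M r'" "r' origin \<in> \<pi> ` W0"
    and eq: "jet_coords Ix k (coord W0 \<circ> r) = jet_coords Ix k (coord W0 \<circ> r')"
  shows "jet M k r = jet M k r'"
proof -
  have "coord W0 (r origin) = coord W0 (r' origin)"
  proof
    fix i
    have C: "coord W0 (r origin) \<in> Cspace Ix" "coord W0 (r' origin) \<in> Cspace Ix"
      using r(2) r'(2) coord_proj[OF W0] chart_domD(4)[OF W0] by auto
    show "coord W0 (r origin) i = coord W0 (r' origin) i"
    proof (cases "i \<in> Ix")
      case True
      then have "(i, {#}) \<in> jet_index Ix k" by (simp add: jet_index_def)
      then show ?thesis using fun_cong[OF eq, of "(i, {#})"] by (simp add: jet_coords_def)
    next
      case False
      then show ?thesis using C by (simp add: Cspace_def)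
    qed
  qed
  then have o: "r origin = r' origin" using inj_on_coord[OF W0] r(2) r'(2) by (meson inj_onD)
  have "jet_coords Ix k (c \<circ> r) = jet_coords Ix k (c \<circ> r')"
    if C: "(V, c) \<in> mcharts M" and V: "r origin \<in> V" for V c
  proof -
    obtain W where W: "chart_dom W" "V = \<pi> ` W" "c = coord W" using C by (auto simp: mcharts_M)
    obtain z where z: "z \<in> W0" "r origin = \<pi> z" using r(2) by auto
    have zW: "\<pi> z \<in> \<pi> ` W" using V W(2) z(2) by simp
    from jet_in_other_chart[OF W0 z(1) W(1) zW, of k] obtain c' d where
      "\<forall>r. frame_germ M r \<longrightarrow> r origin = \<pi> z \<longrightarrow>
        jet_coords Ix k (coord W \<circ> r) = change_jet k c' d (jet_coords Ix k (coord W0 \<circ> r))" by (elim exE)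
    then show ?thesis using r(1) r'(1) z(2) o eq W(3) by simp
  qed
  then show ?thesis unfolding jet_def M_simps using o by auto
qed

lemma frame_chart_value:
  assumes W0: "chart_dom W0" and r: "frame_germ M r" "r origin \<in> \<pi> ` W0"
  shows "jet M k r \<in> fst (frame_chart M k (\<pi> ` W0, coord W0))"
    "snd (frame_chart M k (\<pi> ` W0, coord W0)) (jet M k r) = jet_coords Ix k (coord W0 \<circ> r)"
proof -
  show "jet M k r \<in> fst (frame_chart M k (\<pi> ` W0, coord W0))"
    using r by (auto simp: frame_chart_def)
  have "r \<in> jet M k r" using r(1) by (auto simp: jet_def)
  then have "(SOME r'. r' \<in> jet M k r) \<in> jet M k r"
    by (rule someI[where P = "\<lambda>r'. r' \<in> jet M k r"])
  moreover have "(\<pi> ` W0, coord W0) \<in> mcharts M" using W0 by (auto simp: mcharts_M)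
  ultimately have "jet_coords (mindex M) k (coord W0 \<circ> (SOME r'. r' \<in> jet M k r)) =
      jet_coords (mindex M) k (coord W0 \<circ> r)"
    using r(2) unfolding jet_def by auto
  then show "snd (frame_chart M k (\<pi> ` W0, coord W0)) (jet M k r) = jet_coords Ix k (coord W0 \<circ> r)"
    by (simp add: frame_chart_def M_simps)
qed

lemma inj_on_frame_chart:
  assumes W0: "chart_dom W0"
  shows "inj_on (snd (frame_chart M k (\<pi> ` W0, coord W0))) (fst (frame_chart M k (\<pi> ` W0, coord W0)))"
proof (rule inj_onI)
  fix \<xi> \<xi>' assume "\<xi> \<in> fst (frame_chart M k (\<pi> ` W0, coord W0))" "\<xi>' \<in> fst (frame_chart M k (\<pi> ` W0, coord W0))"
    and eq: "snd (frame_chart M k (\<pi> ` W0, coord W0)) \<xi> = snd (frame_chart M k (\<pi> ` W0, coord W0)) \<xi>'"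
  then obtain r r' where r: "frame_germ M r" "r origin \<in> \<pi> ` W0" "\<xi> = jet M k r"
    and r': "frame_germ M r'" "r' origin \<in> \<pi> ` W0" "\<xi>' = jet M k r'"
    by (auto simp: frame_chart_def)
  show "\<xi> = \<xi>'"
    unfolding r(3) r'(3)
    by (rule jet_eq_if_chart_jet_eq[OF W0 r(1,2) r'(1,2)])
       (use eq frame_chart_value(2)[OF W0 r(1,2)] frame_chart_value(2)[OF W0 r'(1,2)] r(3) r'(3) in simp)
qed

lemma base_frame_chart_jet:
  assumes W0: "chart_dom W0" "z \<in> W0"
  shows "jet_coords Ix k (coord W0 \<circ> base_frame z) = change_jet k (\<lambda>_. 1) z (jet_coords Ix k (\<lambda>w. w))"
  unfolding change_jet_def
proof (rule jet_coords_affine)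
  define S where "S = {w \<in> Cspace Ix. shift Ix z w \<in> W0}"
  have S: "open_in Ix S"
    unfolding S_def by (rule openin_preimage[OF _ continuous_on_shift chart_domD(1)[OF W0(1)]]) (auto simp: shift_Cspace)
  show "holo_fun Ix S (\<lambda>w. w i)" for i by (rule holo_fun_coord[OF S])
  have "z \<in> Cspace Ix" using W0 chart_domD(4) by blast
  then show "origin \<in> S" using W0(2) by (simp add: S_def zero_in_Cspace shift_origin)
  show "(coord W0 \<circ> base_frame z) w i = 1 * w i + z i" if "w \<in> S" "i \<in> Ix" for w i
  proof -
    have "(coord W0 \<circ> base_frame z) w = shift Ix z w"
      unfolding o_apply base_frame_def by (rule coord_proj[OF W0(1)]) (use that(1) in \<open>simp add: S_def\<close>)
    then show ?thesis using that(2) by (simp add: shift_apply)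
  qed
qed simp

section \<open>Constant vector fields\<close>

definition line :: "(nat \<Rightarrow> complex) \<Rightarrow> (nat \<Rightarrow> complex) \<Rightarrow> complex \<Rightarrow> nat \<Rightarrow> complex" where
  "line z b \<tau> = (\<lambda>j. z j + \<tau> * b j)"

lemma line_0: "line z b 0 = z" by (simp add: line_def)

lemma line_Cspace: "z \<in> Cspace I \<Longrightarrow> b \<in> Cspace I \<Longrightarrow> line z b \<tau> \<in> Cspace I"
  by (simp add: line_def Cspace_def)

lemma continuous_on_line: "continuous_on A (line z b)"
  by (rule continuous_on_coordinatewise_then_product) (auto simp: line_def intro!: continuous_intros)

lemma open_line_preimage:
  assumes "open_in I T" "z \<in> Cspace I" "b \<in> Cspace I"
  shows "open {\<tau>. line z b \<tau> \<in> T}"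
proof -
  have "openin (top_of_set UNIV) {\<tau> \<in> UNIV. line z b \<tau> \<in> T}"
    by (rule openin_preimage[OF _ continuous_on_line assms(1)]) (use line_Cspace[OF assms(2,3)] in auto)
  then show ?thesis by simp
qed

lemma line_derivative:
  assumes T: "chart_lift W u a T" and z: "z \<in> Cspace Ix" "b \<in> Cspace Ix" "line z b \<tau> \<in> T"
  shows "((\<lambda>\<tau>. coord W (\<pi> (line z b \<tau>)) i) has_field_derivative (if i \<in> Ix then \<sigma> i u * b i else 0)) (at \<tau>)"
proof -
  have "\<forall>\<^sub>F \<tau> in nhds \<tau>. \<tau> \<in> {\<tau>. line z b \<tau> \<in> T}"
    by (rule eventually_nhds_in_open[OF open_line_preimage[OF chart_liftD(1)[OF T] z(1,2)]]) (use z(3) in simp)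
  then have "\<forall>\<^sub>F \<tau> in nhds \<tau>. coord W (\<pi> (line z b \<tau>)) i = \<Gamma> u a (line z b \<tau>) i"
    by eventually_elim (simp add: chart_liftD(5)[OF T])
  moreover have "((\<lambda>\<tau>. \<Gamma> u a (line z b \<tau>) i) has_field_derivative (if i \<in> Ix then \<sigma> i u * b i else 0)) (at \<tau>)"
    unfolding ot_map_def line_def by (cases "i \<in> Ix") (auto intro!: derivative_eq_intros)
  ultimately show ?thesis by (simp add: DERIV_cong_ev[OF refl _ refl])
qed

text \<open>
  The vector field whose flow moves the representatives in \<open>W0\<close> along the vector b. Its value in a
  chart is the velocity of the flow line in this chart, so that no choice of a deck transformation
  enters the definition.
\<close>

definition const_field ::
  "(nat \<Rightarrow> complex) set \<Rightarrow> (nat \<Rightarrow> complex) \<Rightarrow> (nat \<Rightarrow> complex) set \<Rightarrow> ((nat \<Rightarrow> complex) set, nat) tvec" where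
  "const_field W0 b p C = (if C \<in> mcharts M \<and> p \<in> fst C
     then (\<lambda>i. deriv (\<lambda>\<tau>. snd C (\<pi> (line (coord W0 p) b \<tau>)) i) 0) else origin)"

lemma chart_in_atlas: "chart_dom W \<Longrightarrow> (\<pi> ` W, coord W) \<in> mcharts M"
  by (auto simp: mcharts_M)

lemma const_field_value:
  assumes W0: "chart_dom W0" "z \<in> W0" and b: "b \<in> Cspace Ix" and W: "chart_dom W" and T: "chart_lift W u a T" "z \<in> T"
  shows "const_field W0 b (\<pi> z) (\<pi> ` W, coord W) = (\<lambda>i. if i \<in> Ix then \<sigma> i u * b i else 0)"
proof
  fix i
  have z: "z \<in> Cspace Ix" using W0 chart_domD(4) by blast
  have "((\<lambda>\<tau>. coord W (\<pi> (line z b \<tau>)) i) has_field_derivative (if i \<in> Ix then \<sigma> i u * b i else 0)) (at 0)"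
    by (rule line_derivative[OF T(1) z b]) (use T(2) in \<open>simp add: line_0\<close>)
  then show "const_field W0 b (\<pi> z) (\<pi> ` W, coord W) i = (if i \<in> Ix then \<sigma> i u * b i else 0)"
    using chart_in_atlas[OF W] chart_liftD(6)[OF T] by (simp add: const_field_def coord_proj[OF W0] DERIV_imp_deriv)
qed

lemma chart_lift_id: "chart_dom W \<Longrightarrow> chart_lift W 1 0 W"
  unfolding chart_lift_def using chart_domD coord_proj by (simp add: ot_map_0 subset_iff)

lemma const_field_self:
  assumes W0: "chart_dom W0" "z \<in> W0" and b: "b \<in> Cspace Ix"
  shows "const_field W0 b (\<pi> z) (\<pi> ` W0, coord W0) = b"
proof -
  have "const_field W0 b (\<pi> z) (\<pi> ` W0, coord W0) = (\<lambda>i. if i \<in> Ix then \<sigma> i 1 * b i else 0)"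
    by (rule const_field_value[OF W0 b W0(1) chart_lift_id[OF W0(1)] W0(2)])
  also have "\<dots> = b"
    by (rule ext) (use b embedding' in \<open>auto simp: Cspace_def field_embedding_simps(2)\<close>)
  finally show ?thesis .
qed

text \<open>
  In each chart the field is locally the constant vector with components \<open>\<sigma> i u * b i\<close>, where u belongs to
  the deck transformation between \<open>W0\<close> and the chart.
\<close>

lemma const_field_local:
  assumes W0: "chart_dom W0" and b: "b \<in> Cspace Ix" and W: "chart_dom W" and w: "w \<in> W" "\<pi> w \<in> \<pi> ` W0"
  obtains v N where "open_in Ix N" "w \<in> N" "N \<subseteq> W" "\<pi> ` N \<subseteq> \<pi> ` W0"
    "\<And>y. y \<in> N \<Longrightarrow> const_field W0 b (\<pi> y) (\<pi> ` W, coord W) = v"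
proof -
  obtain z where z: "z \<in> W0" "\<pi> w = \<pi> z" using w(2) by auto
  have zO: "z \<in> \<Omega>" and wO: "w \<in> \<Omega>" using z w chart_domD(2) W W0 by blast+
  have "\<pi> z \<in> \<pi> ` W" using w(1) z(2) by (metis imageI)
  then obtain u a T where "u \<in> U" "z \<in> T" and lift: "chart_lift W u a T"
    by (rule ex_chart_lift[OF W zO])
  note T = chart_liftD[OF lift]
  define N where "N = W \<inter> {y \<in> \<Omega>. \<pi> y \<in> \<pi> ` (T \<inter> W0)}"
  have TW: "open_in Ix (T \<inter> W0)" using T(1) chart_domD(1)[OF W0] by (rule openin_Int)
  show thesis
  proof (rule that[of N "\<lambda>i. if i \<in> Ix then \<sigma> i u * b i else 0"])
    show "open_in Ix N"
      unfolding N_def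
      by (rule openin_Int[OF chart_domD(1)[OF W] openin_proj_preimage[OF proj_open[OF TW]]]) (use T(2) in auto)
    show "w \<in> N" using w(1) wO z \<open>z \<in> T\<close> by (auto simp: N_def)
    show "N \<subseteq> W" "\<pi> ` N \<subseteq> \<pi> ` W0" by (auto simp: N_def)
    fix y assume "y \<in> N"
    then obtain x where x: "x \<in> T" "x \<in> W0" "\<pi> y = \<pi> x" by (auto simp: N_def)
    show "const_field W0 b (\<pi> y) (\<pi> ` W, coord W) = (\<lambda>i. if i \<in> Ix then \<sigma> i u * b i else 0)"
      unfolding x(3) by (rule const_field_value[OF W0 x(2) b W lift x(1)])
  qed
qed

lemma pd_ot_map:
  assumes "i \<in> Ix"
  shows "pd j (\<lambda>y. \<Gamma> u a y i) w = (if j = i then \<sigma> i u else 0)"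
proof -
  have "((\<lambda>v. \<Gamma> u a (w(j := v)) i) has_field_derivative (if j = i then \<sigma> i u else 0)) (at (w j))"
    unfolding ot_map_def using assms by (cases "j = i") (auto intro!: derivative_eq_intros)
  then show ?thesis unfolding pd_def by (rule DERIV_imp_deriv)
qed

lemma const_field_change_of_chart:
  assumes W0: "chart_dom W0" "z \<in> W0" and b: "b \<in> Cspace Ix"
    and W: "chart_dom W" "\<pi> z \<in> \<pi> ` W" and W': "chart_dom W'" "\<pi> z \<in> \<pi> ` W'" and i: "i \<in> Ix"
  shows "const_field W0 b (\<pi> z) (\<pi> ` W', coord W') i =
    (\<Sum>j\<in>Ix. pd j (\<lambda>y. coord W' (inv_into (\<pi> ` W) (coord W) y) i) (coord W (\<pi> z)) *
      const_field W0 b (\<pi> z) (\<pi> ` W, coord W) j)"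
proof -
  have zO: "z \<in> \<Omega>" using W0 chart_domD(2) by blast
  obtain u a T where u: "u \<in> U" and "z \<in> T" and lift: "chart_lift W u a T"
    by (rule ex_chart_lift[OF W(1) zO W(2)])
  note T = chart_liftD[OF lift]
  define w where "w = \<Gamma> u a z"
  have w: "w \<in> W" "\<pi> w = \<pi> z" "coord W (\<pi> z) = w" using T(3-5)[OF \<open>z \<in> T\<close>] by (auto simp: w_def)
  have wO: "w \<in> \<Omega>" using w chart_domD(2)[OF W(1)] by blast
  have "\<pi> w \<in> \<pi> ` W'" using W'(2) w(2) by simp
  then obtain u' a' T' where "u' \<in> U" "w \<in> T'" and lift': "chart_lift W' u' a' T'"
    by (rule ex_chart_lift[OF W'(1) wO])
  note T' = chart_liftD[OF lift']
  define N where "N = {y \<in> T. \<Gamma> u a y \<in> T'}"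
  have comp: "\<Gamma> u' a' (\<Gamma> u a y) = \<Gamma> (u' * u) (a + inverse u * a') y" for y
    by (rule ot_map_comp[OF U_props(1)[OF u]])
  have "chart_lift W' (u' * u) (a + inverse u * a') N"
    unfolding chart_lift_def
  proof (intro conjI ballI)
    show "open_in Ix N"
      unfolding N_def by (rule openin_preimage[OF T(1) continuous_on_ot_map T'(1)]) (use ot_map_Cspace in blast)
    show "N \<subseteq> \<Omega>" using T(2) by (auto simp: N_def)
    fix y assume "y \<in> N"
    then have y: "y \<in> T" "\<Gamma> u a y \<in> T'" by (auto simp: N_def)
    show "\<Gamma> (u' * u) (a + inverse u * a') y \<in> W'" "\<pi> (\<Gamma> (u' * u) (a + inverse u * a') y) = \<pi> y"
      "coord W' (\<pi> y) = \<Gamma> (u' * u) (a + inverse u * a') y"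
      using T'(3-5)[OF y(2)] T(4)[OF y(1)] by (simp_all add: comp)
  qed
  moreover have "z \<in> N" using \<open>z \<in> T\<close> \<open>w \<in> T'\<close> by (simp add: N_def w_def)
  ultimately have X': "const_field W0 b (\<pi> z) (\<pi> ` W', coord W') = (\<lambda>i. if i \<in> Ix then \<sigma> i (u' * u) * b i else 0)"
    by (rule const_field_value[OF W0 b W'(1)])
  have X: "const_field W0 b (\<pi> z) (\<pi> ` W, coord W) = (\<lambda>i. if i \<in> Ix then \<sigma> i u * b i else 0)"
    by (rule const_field_value[OF W0 b W(1) lift \<open>z \<in> T\<close>])
  have pdj: "pd j (\<lambda>y. coord W' (inv_into (\<pi> ` W) (coord W) y) i) w = (if j = i then \<sigma> i u' else 0)"
    if j: "j \<in> Ix" for j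
  proof -
    have "pd j (\<lambda>y. coord W' (inv_into (\<pi> ` W) (coord W) y) i) w = pd j (\<lambda>y. \<Gamma> u' a' y i) w"
    proof (rule pd_cong[OF finite_atLeastAtMost openin_Int[OF chart_domD(1)[OF W(1)] T'(1)] _ j])
      show "w \<in> W \<inter> T'" using w(1) \<open>w \<in> T'\<close> by simp
      show "coord W' (inv_into (\<pi> ` W) (coord W) y) i = \<Gamma> u' a' y i" if "y \<in> W \<inter> T'" for y
        using that inv_coord[OF W(1)] T'(5) by simp
    qed
    then show ?thesis by (simp only: pd_ot_map[OF i])
  qed
  have "(\<Sum>j\<in>Ix. pd j (\<lambda>y. coord W' (inv_into (\<pi> ` W) (coord W) y) i) w * const_field W0 b (\<pi> z) (\<pi> ` W, coord W) j) =
      (\<Sum>j\<in>Ix. (if j = i then \<sigma> i u' else 0) * const_field W0 b (\<pi> z) (\<pi> ` W, coord W) j)"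
    by (rule sum.cong) (simp_all only: pdj)
  also have "\<dots> = \<sigma> i u' * (\<sigma> i u * b i)"
    unfolding X using i by (simp add: if_distrib[of "\<lambda>x. x * _"] cong: if_cong)
  also have "\<dots> = const_field W0 b (\<pi> z) (\<pi> ` W', coord W') i"
    unfolding X' using i field_embedding_simps(4)[OF embedding'[OF i]] by (simp add: mult.assoc)
  finally show ?thesis by (simp only: w(3))
qed

lemma const_field_tangent:
  assumes W0: "chart_dom W0" "z \<in> W0" and b: "b \<in> Cspace Ix"
  shows "const_field W0 b (\<pi> z) \<in> tangent_space M (\<pi> z)"
  unfolding tangent_space_def M_simps
proof (intro CollectI conjI allI ballI impI)
  show "const_field W0 b (\<pi> z) C = origin" if "C \<notin> mcharts M \<or> \<pi> z \<notin> fst C" for C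
    using that by (auto simp: const_field_def)
  show "const_field W0 b (\<pi> z) C \<in> Cspace Ix" if "C \<in> mcharts M" "\<pi> z \<in> fst C" for C
  proof -
    obtain W where W: "chart_dom W" "C = (\<pi> ` W, coord W)" using \<open>C \<in> mcharts M\<close> by (auto simp: mcharts_M)
    have p: "\<pi> z \<in> \<pi> ` W" "z \<in> \<Omega>" using that(2) W(2) W0 chart_domD(2) by auto
    obtain u a T where "u \<in> U" "z \<in> T" "chart_lift W u a T"
      by (rule ex_chart_lift[OF W(1) p(2,1)])
    then show ?thesis unfolding W(2) by (simp add: const_field_value[OF W0 b W(1)] Cspace_def)
  qed
  fix C C' i assume "C \<in> mcharts M" "C' \<in> mcharts M" and p: "\<pi> z \<in> fst C \<and> \<pi> z \<in> fst C'" and i: "i \<in> Ix"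
  then obtain W W' where W: "chart_dom W" "C = (\<pi> ` W, coord W)" and W': "chart_dom W'" "C' = (\<pi> ` W', coord W')"
    by (auto simp: mcharts_M)
  show "const_field W0 b (\<pi> z) C' i = (\<Sum>j\<in>Ix.
      pd j (\<lambda>y. snd C' (inv_into (fst C) (snd C) y) i) (snd C (\<pi> z)) * const_field W0 b (\<pi> z) C j)"
    using const_field_change_of_chart[OF W0 b W(1) _ W'(1) _ i] p unfolding W(2) W'(2) by simp
qed

lemma const_field_holomorphic:
  assumes W0: "chart_dom W0" and b: "b \<in> Cspace Ix"
  shows "holomorphic_vector_field M (\<pi> ` W0) (const_field W0 b)"
  unfolding holomorphic_vector_field_def
proof (intro conjI ballI)
  show "openin (mtop M) (\<pi> ` W0)" by (rule proj_open[OF chart_domD(1,2)[OF W0]])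
  show "const_field W0 b p \<in> tangent_space M p" if "p \<in> \<pi> ` W0" for p
    using that const_field_tangent[OF W0 _ b] by auto
  fix C i assume "C \<in> mcharts M" "i \<in> mindex M"
  then obtain W where W: "chart_dom W" "C = (\<pi> ` W, coord W)" by (auto simp: mcharts_M)
  have eq: "snd C ` (\<pi> ` W0 \<inter> fst C) = {w \<in> W. \<pi> w \<in> \<pi> ` W0}"
    using chart_image[OF W(1), of "\<pi> ` W0"] W(2) by (simp add: Int_commute)
  show "holo_fun (mindex M) (snd C ` (\<pi> ` W0 \<inter> fst C)) (\<lambda>z. const_field W0 b (inv_into (fst C) (snd C) z) C i)"
    unfolding eq M_simps
  proof (rule holo_fun_local)
    show "{w \<in> W. \<pi> w \<in> \<pi> ` W0} \<subseteq> Cspace Ix" using chart_domD(4)[OF W(1)] by auto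
    fix w assume w: "w \<in> {w \<in> W. \<pi> w \<in> \<pi> ` W0}"
    obtain v N where N: "open_in Ix N" "w \<in> N" "N \<subseteq> W" "\<pi> ` N \<subseteq> \<pi> ` W0"
      "\<And>y. y \<in> N \<Longrightarrow> const_field W0 b (\<pi> y) (\<pi> ` W, coord W) = v"
      by (rule const_field_local[OF W0 b W(1), of w]) (use w in blast)+
    have "holo_fun Ix N (\<lambda>z. const_field W0 b (inv_into (fst C) (snd C) z) C i)"
    proof (rule holo_fun_cong[OF _ N(1) order_refl holo_fun_const[OF N(1)]])
      fix y assume "y \<in> N"
      then show "const_field W0 b (inv_into (fst C) (snd C) y) C i = v i"
        using N(3,5) inv_coord[OF W(1)] by (simp add: W(2) subset_iff)
    qed simp
    moreover have "N \<subseteq> {w \<in> W. \<pi> w \<in> \<pi> ` W0}" using N(3,4) by auto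
    ultimately show "\<exists>T. w \<in> T \<and> T \<subseteq> {w \<in> W. \<pi> w \<in> \<pi> ` W0} \<and>
        holo_fun Ix T (\<lambda>z. const_field W0 b (inv_into (fst C) (snd C) z) C i)"
      using N(2) by (intro exI conjI)
  qed simp
qed

lemma const_field_affine:
  assumes W0: "chart_dom W0" and b: "b \<in> Cspace Ix"
  shows "affine_vector_field M (\<pi> ` W0) (const_field W0 b)"
  unfolding affine_vector_field_def
proof (intro conjI ballI const_field_holomorphic[OF W0 b])
  fix C p assume "C \<in> mcharts M" and p: "p \<in> \<pi> ` W0 \<inter> fst C"
  then obtain W where W: "chart_dom W" "C = (\<pi> ` W, coord W)" by (auto simp: mcharts_M)
  obtain w where w: "w \<in> W" "p = \<pi> w" using p W by auto
  obtain v N where N: "open_in Ix N" "w \<in> N" "N \<subseteq> W" "\<pi> ` N \<subseteq> \<pi> ` W0"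
    "\<And>y. y \<in> N \<Longrightarrow> const_field W0 b (\<pi> y) (\<pi> ` W, coord W) = v"
    by (rule const_field_local[OF W0 b W(1) w(1)]) (use w p in blast)+
  show "\<exists>N A v. openin (mtop M) N \<and> p \<in> N \<and> N \<subseteq> \<pi> ` W0 \<inter> fst C \<and>
    (\<forall>q\<in>N. \<forall>i\<in>mindex M. const_field W0 b q C i = (\<Sum>j\<in>mindex M. A i j * snd C q j) + v i)"
  proof (intro exI conjI ballI)
    show "openin (mtop M) (\<pi> ` N)" by (rule proj_open[OF N(1)]) (use N(3) chart_domD(2)[OF W(1)] in auto)
    show "p \<in> \<pi> ` N" using N(2) w by auto
    show "\<pi> ` N \<subseteq> \<pi> ` W0 \<inter> fst C" using N(3,4) W(2) by auto
    fix q i assume "q \<in> \<pi> ` N"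
    then show "const_field W0 b q C i = (\<Sum>j\<in>mindex M. (\<lambda>_ _. 0) i j * snd C q j) + v i"
      using N(5) by (auto simp: W(2))
  qed
qed

lemma const_field_integral_curve:
  assumes W0: "chart_dom W0" and z: "z \<in> Cspace Ix" and b: "b \<in> Cspace Ix"
    and l: "\<And>\<tau>. \<tau> \<in> ball 0 \<epsilon> \<Longrightarrow> line z b \<tau> \<in> W0"
  shows "integral_curve M (\<pi> ` W0) (const_field W0 b) \<epsilon> (\<lambda>\<tau>. \<pi> (line z b \<tau>))"
  unfolding integral_curve_def
proof (intro conjI ballI impI)
  have lO: "line z b \<tau> \<in> \<Omega>" if "\<tau> \<in> ball 0 \<epsilon>" for \<tau> using l[OF that] chart_domD(2)[OF W0] by blast
  have "continuous_map (top_of_set (ball 0 \<epsilon>)) (mtop M) (\<lambda>\<tau>. \<pi> (line z b \<tau>))"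
    unfolding continuous_map_def
  proof (intro conjI allI impI)
    show "(\<lambda>\<tau>. \<pi> (line z b \<tau>)) \<in> topspace (top_of_set (ball 0 \<epsilon>)) \<rightarrow> topspace (mtop M)"
      using lO by (auto simp: topspace_M)
    fix V assume V: "openin (mtop M) V"
    have "{\<tau> \<in> ball 0 \<epsilon>. \<pi> (line z b \<tau>) \<in> V} = {\<tau> \<in> ball 0 \<epsilon>. line z b \<tau> \<in> {y \<in> \<Omega>. \<pi> y \<in> V}}"
      using lO by auto
    moreover have "openin (top_of_set (ball 0 \<epsilon>)) \<dots>"
      by (rule openin_preimage[OF _ continuous_on_line openin_proj_preimage[OF V]])
         (use line_Cspace[OF z b] in auto)
    ultimately show "openin (top_of_set (ball 0 \<epsilon>)) {\<tau> \<in> topspace (top_of_set (ball 0 \<epsilon>)). \<pi> (line z b \<tau>) \<in> V}"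
      by simp
  qed
  then show "continuous_map (top_of_set (ball 0 \<epsilon>)) (subtopology (mtop M) (\<pi> ` W0)) (\<lambda>\<tau>. \<pi> (line z b \<tau>))"
    using l by (auto simp: continuous_map_in_subtopology)
  fix \<tau> C i assume \<tau>: "\<tau> \<in> ball 0 \<epsilon>" and "C \<in> mcharts M" and p: "\<pi> (line z b \<tau>) \<in> fst C"
  then obtain W where W: "chart_dom W" "C = (\<pi> ` W, coord W)" by (auto simp: mcharts_M)
  have "\<pi> (line z b \<tau>) \<in> \<pi> ` W" using p W(2) by simp
  then obtain u a T where "u \<in> U" "line z b \<tau> \<in> T" and lift: "chart_lift W u a T"
    by (rule ex_chart_lift[OF W(1) lO[OF \<tau>]])
  have "const_field W0 b (\<pi> (line z b \<tau>)) C = (\<lambda>i. if i \<in> Ix then \<sigma> i u * b i else 0)"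
    unfolding W(2) by (rule const_field_value[OF W0 l[OF \<tau>] b W(1) lift \<open>line z b \<tau> \<in> T\<close>])
  then show "((\<lambda>w. snd C (\<pi> (line z b w)) i) has_field_derivative const_field W0 b (\<pi> (line z b \<tau>)) C i) (at \<tau>)"
    using line_derivative[OF lift z b \<open>line z b \<tau> \<in> T\<close>, of i] by (simp add: W(2))
qed

end

lemma tangent_space_eqI:
  assumes "v \<in> tangent_space M p" "v' \<in> tangent_space M p" "C0 \<in> mcharts M" "p \<in> fst C0" "v C0 = v' C0"
  shows "v = v'"
proof (rule ext)
  fix C
  show "v C = v' C"
  proof (cases "C \<in> mcharts M \<and> p \<in> fst C")
    case True
    show ?thesis
    proof
      fix i
      show "v C i = v' C i"
      proof (cases "i \<in> mindex M")
        case True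
        then show ?thesis using assms \<open>C \<in> mcharts M \<and> p \<in> fst C\<close> unfolding tangent_space_def by simp
      next
        case False
        then show ?thesis using assms(1,2) \<open>C \<in> mcharts M \<and> p \<in> fst C\<close>
          unfolding tangent_space_def Cspace_def by simp
      qed
    qed
  next
    case False
    then have "v C = origin" "v' C = origin" using assms(1,2) unfolding tangent_space_def by blast+
    then show ?thesis by simp
  qed
qed

lemma transitive_onI:
  assumes "\<And>x v. x \<in> S \<Longrightarrow> v \<in> tangent_space M x \<Longrightarrow> \<exists>V X. (V, X) \<in> A \<and> x \<in> V \<and> v = X x"
  shows "transitive_on M S A"
  unfolding transitive_on_def
proof (intro ballI)
  fix x v assume "x \<in> S" "v \<in> tangent_space M x"
  from assms[OF this] obtain V X where X: "(V, X) \<in> A" "x \<in> V" "v = X x" by (elim exE conjE)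
  define n :: nat where "n = 1"
  define Y where "Y = (\<lambda>_::nat. X)"
  define c :: "nat \<Rightarrow> complex" where "c = (\<lambda>_. 1)"
  have "\<forall>a<n. \<exists>V. (V, Y a) \<in> A \<and> x \<in> V" using X(1,2) unfolding Y_def by blast
  moreover have "\<forall>C i. v C i = (\<Sum>a<n. c a * Y a x C i)" by (simp add: n_def c_def Y_def X(3))
  ultimately have "(\<forall>a<n. \<exists>V. (V, Y a) \<in> A \<and> x \<in> V) \<and> (\<forall>C i. v C i = (\<Sum>a<n. c a * Y a x C i))" ..
  then show "\<exists>(n::nat) X c. (\<forall>a<n. \<exists>V. (V, X a) \<in> A \<and> x \<in> V) \<and> (\<forall>C i. v C i = (\<Sum>a<n. c a * X a x C i))"
    by (intro exI)
qed

context ot_setting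
begin

section \<open>Translation invariance of the geometric structure\<close>

lemma frame_germ_origin:
  assumes "frame_germ M r"
  shows "\<exists>z\<in>\<Omega>. r origin = \<pi> z"
proof -
  obtain W where W: "origin \<in> W" "biholomorphism_on (Cmfd Ix) M W r"
    using assms unfolding frame_germ_def M_simps by blast
  then have Wo: "open_in Ix W"
    and rc: "continuous_map (subtopology (top_of_set (Cspace Ix)) W) (mtop M) r"
    by (auto simp: biholomorphism_on_def holomorphic_map_def Cmfd_simps)
  have "origin \<in> topspace (subtopology (top_of_set (Cspace Ix)) W)" using W(1) zero_in_Cspace by auto
  then have "r origin \<in> topspace (mtop M)"
    using continuous_map_image_subset_topspace[OF rc] by blast
  then show ?thesis unfolding topspace_M by auto
qed

lemma jet_in_frame_bundle:
  assumes r: "frame_germ M r"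
  shows "jet M k r \<in> topspace (mtop (frame_bundle M k))"
proof -
  obtain z where z: "z \<in> \<Omega>" "r origin = \<pi> z" using frame_germ_origin[OF r] by blast
  obtain W0 where W0: "chart_dom W0" "z \<in> W0" using ex_chart[OF z(1)] by blast
  define D where "D = fst (frame_chart M k (\<pi> ` W0, coord W0))"
  define e where "e = snd (frame_chart M k (\<pi> ` W0, coord W0))"
  define S where "S = Cspace (jet_index Ix k)"
  have r0: "r origin \<in> \<pi> ` W0" using z W0 by auto
  have "jet M k r \<in> D" unfolding D_def by (rule frame_chart_value(1)[OF W0(1) r r0])
  moreover have "e (jet M k r) \<in> S"
    unfolding e_def frame_chart_value(2)[OF W0(1) r r0] S_def Cspace_def jet_coords_def by auto
  moreover have "(D, e) \<in> frame_chart M k ` mcharts M"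
    unfolding D_def e_def prod.collapse using chart_in_atlas[OF W0(1)] by (rule imageI)
  moreover have "open_in (jet_index (mindex M) k) S" by (simp add: S_def M_simps)
  ultimately show ?thesis
    unfolding frame_bundle_def by (simp add: topology_generated_by_topspace) blast
qed

lemma frame_bundle_simps: "mindex (frame_bundle M k) = jet_index Ix k"
  "mcharts (frame_bundle M k) = frame_chart M k ` mcharts M"
  by (simp_all add: frame_bundle_def M_simps)

text \<open>
  As \<open>base_frame_chart_jet\<close> shows, the function in this lemma gives the coordinates of the base
  frame at z. It moves along coordinate lines of the jet space when z does in the base.
\<close>

lemma change_jet_upd:
  assumes "i \<in> Ix"
  shows "change_jet k (\<lambda>_. 1) (z(i := w)) (jet_coords Ix k (\<lambda>w. w)) =
    (change_jet k (\<lambda>_. 1) z (jet_coords Ix k (\<lambda>w. w)))((i, {#}) := w)"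
proof
  fix x :: "nat \<times> nat multiset"
  obtain j \<mu> where x: "x = (j, \<mu>)" by (cases x)
  have 1: "(i, {#}) \<in> jet_index Ix k" using assms by (simp add: jet_index_def)
  then have 0: "jet_coords Ix k (\<lambda>w. w) (i, {#}) = 0" by (simp add: jet_coords_def)
  show "change_jet k (\<lambda>_. 1) (z(i := w)) (jet_coords Ix k (\<lambda>w. w)) x =
    ((change_jet k (\<lambda>_. 1) z (jet_coords Ix k (\<lambda>w. w)))((i, {#}) := w)) x"
    using 1 0 by (cases "x = (i, {#})") (auto simp: change_jet_def x)
qed

lemma change_jet_const_term:
  assumes "i \<in> Ix"
  shows "change_jet k (\<lambda>_. 1) z (jet_coords Ix k (\<lambda>w. w)) (i, {#}) = z i"
  using change_jet_upd[OF assms, of k z "z i"] by (metis fun_upd_same fun_upd_triv)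

lemma continuous_on_change_jet:
  "continuous_on A (\<lambda>z. change_jet k c z J)"
proof (rule continuous_on_coordinatewise_then_product)
  fix x :: "nat \<times> nat multiset"
  have "continuous_on A (\<lambda>z::nat \<Rightarrow> complex. z j)" for j
    by (rule continuous_on_subset[OF continuous_on_product_coordinates]) auto
  then have c: "continuous_on A (\<lambda>z. d * z (fst x) + e)" for d e by (intro continuous_intros)
  have "change_jet k c z J x = (if x \<in> jet_index Ix k \<and> snd x = {#} then 1 else 0) * z (fst x) +
      (if x \<in> jet_index Ix k then c (fst x) * J x else 0)" for z
    by (cases x) (simp add: change_jet_def)
  then show "continuous_on A (\<lambda>z. change_jet k c z J x)" using c by (simp only:)
qed

lemma const_fields_transitive:
  assumes mem: "\<And>W0 b. chart_dom W0 \<Longrightarrow> b \<in> Cspace Ix \<Longrightarrow> (\<pi> ` W0, const_field W0 b) \<in> A"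
  shows "transitive_on M (topspace (mtop M)) A"
proof (rule transitive_onI)
  fix x v assume "x \<in> topspace (mtop M)" and v: "v \<in> tangent_space M x"
  then obtain z where z: "z \<in> \<Omega>" "x = \<pi> z" by (auto simp: topspace_M)
  obtain W0 where W0: "chart_dom W0" "z \<in> W0" using ex_chart[OF z(1)] by blast
  define b where "b = v (\<pi> ` W0, coord W0)"
  have C: "(\<pi> ` W0, coord W0) \<in> mcharts M" "x \<in> fst (\<pi> ` W0, coord W0)"
    using chart_in_atlas[OF W0(1)] W0(2) z(2) by auto
  then have b: "b \<in> Cspace Ix" using v unfolding tangent_space_def b_def M_simps by blast
  have "v = const_field W0 b x"
  proof (rule tangent_space_eqI[OF v _ C])
    show "const_field W0 b x \<in> tangent_space M x" unfolding z(2) by (rule const_field_tangent[OF W0 b])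
    show "v (\<pi> ` W0, coord W0) = const_field W0 b x (\<pi> ` W0, coord W0)"
      unfolding z(2) const_field_self[OF W0 b] by (simp add: b_def)
  qed
  moreover have "(\<pi> ` W0, const_field W0 b) \<in> A" by (rule mem[OF W0(1) b])
  moreover have "x \<in> \<pi> ` W0" using W0(2) z(2) by simp
  ultimately show "\<exists>V X. (V, X) \<in> A \<and> x \<in> V \<and> v = X x"
    by (intro exI[where x = "\<pi> ` W0"] exI[where x = "const_field W0 b"] conjI)
qed

context
  fixes k :: nat and L :: "nat set" and Z :: "(nat \<Rightarrow> complex) set"
    and act :: "((nat \<Rightarrow> complex) \<Rightarrow> nat \<Rightarrow> complex) set \<Rightarrow> (nat \<Rightarrow> complex) \<Rightarrow> nat \<Rightarrow> complex"
    and \<phi> :: "((nat \<Rightarrow> complex) \<Rightarrow> (nat \<Rightarrow> complex) set) set \<Rightarrow> nat \<Rightarrow> complex"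
  assumes is_structure: "affine_geometric_structure M k L Z act \<phi>"
begin

lemma structure_value:
  assumes "frame_germ M r"
  shows "\<phi> (jet M k r) \<in> Z" "\<phi> (jet M k r) \<in> Cspace L"
proof -
  show "\<phi> (jet M k r) \<in> Z"
    using is_structure jet_in_frame_bundle[OF assms] unfolding affine_geometric_structure_def by blast
  then show "\<phi> (jet M k r) \<in> Cspace L"
    using is_structure unfolding affine_geometric_structure_def smooth_affine_variety_def algebraic_set_def by auto
qed

text \<open>
  The coordinates of the base frame at z depend on z affinely, through the coordinates of order 0. So
  the structure, restricted to base frames, is holomorphic in z.
\<close>

lemma structure_on_base_frames_holo_chart:
  assumes W0: "chart_dom W0" and l: "l \<in> L"
  shows "holo_fun Ix W0 (\<lambda>z. \<phi> (jet M k (base_frame z)) l)"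
proof -
  define D where "D = fst (frame_chart M k (\<pi> ` W0, coord W0))"
  define e where "e = snd (frame_chart M k (\<pi> ` W0, coord W0))"
  define S where "S = e ` (topspace (mtop (frame_bundle M k)) \<inter> D \<inter> \<phi> -` Cspace L)"
  define \<Phi> where "\<Phi> = (\<lambda>\<zeta>. \<phi> (inv_into D e \<zeta>) l)"
  define \<iota> where "\<iota> = (\<lambda>z. change_jet k (\<lambda>_. 1) z (jet_coords Ix k (\<lambda>w. w)))"
  have hol: "holo_fun (jet_index Ix k) S \<Phi>"
  proof -
    have "(D, e) \<in> mcharts (frame_bundle M k)"
      unfolding D_def e_def prod.collapse frame_bundle_simps using chart_in_atlas[OF W0] by (rule imageI)
    moreover have "\<forall>(V, c)\<in>mcharts (frame_bundle M k). \<forall>j\<in>L.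
        holo_fun (jet_index Ix k) (c ` (topspace (mtop (frame_bundle M k)) \<inter> V \<inter> \<phi> -` Cspace L))
          (\<lambda>z. \<phi> (inv_into V c z) j)"
      using is_structure
      unfolding affine_geometric_structure_def holomorphic_map_def Cmfd_simps frame_bundle_simps by simp
    ultimately show ?thesis unfolding S_def \<Phi>_def using l by (auto dest!: bspec)
  qed
  have jets: "\<iota> z \<in> S" "inv_into D e (\<iota> z) = jet M k (base_frame z)" if z: "z \<in> W0" for z
  proof -
    have zO: "z \<in> \<Omega>" using z chart_domD(2)[OF W0] by blast
    note fg = frame_germ_base_frame[OF zO]
    have o: "base_frame z origin \<in> \<pi> ` W0" using base_frame_origin[OF zO] z by simp
    have v: "e (jet M k (base_frame z)) = \<iota> z"
      unfolding e_def frame_chart_value(2)[OF W0 fg o] \<iota>_def by (rule base_frame_chart_jet[OF W0 z])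
    have D: "jet M k (base_frame z) \<in> D" unfolding D_def by (rule frame_chart_value(1)[OF W0 fg o])
    show "\<iota> z \<in> S"
      unfolding S_def v[symmetric] using D jet_in_frame_bundle[OF fg] structure_value(2)[OF fg] by blast
    have "inj_on e D" unfolding e_def D_def by (rule inj_on_frame_chart[OF W0])
    from inv_into_f_f[OF this D] show "inv_into D e (\<iota> z) = jet M k (base_frame z)" by (simp add: v)
  qed
  have h: "holo_fun Ix W0 (\<lambda>z. \<Phi> (\<iota> z))"
    unfolding holo_fun_def
  proof (intro conjI ballI)
    show "open_in Ix W0" by (rule chart_domD(1)[OF W0])
    show "continuous_on W0 (\<lambda>z. \<Phi> (\<iota> z))"
    proof (rule continuous_on_compose2[of S \<Phi>])
      show "continuous_on S \<Phi>" using hol by (simp add: holo_fun_def)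
      show "continuous_on W0 \<iota>" unfolding \<iota>_def by (rule continuous_on_change_jet)
    qed (use jets in blast)
    fix z i assume z: "z \<in> W0" and i: "i \<in> Ix"
    have "(i, {#}) \<in> jet_index Ix k" using i by (simp add: jet_index_def)
    from holo_fun_diff[OF hol jets(1)[OF z] this]
    have "(\<lambda>w. \<Phi> ((\<iota> z)((i, {#}) := w))) field_differentiable at (z i)"
      unfolding \<iota>_def change_jet_const_term[OF i] .
    then show "(\<lambda>w. \<Phi> (\<iota> (z(i := w)))) field_differentiable at (z i)"
      unfolding \<iota>_def change_jet_upd[OF i] .
  qed
  show ?thesis
    by (rule holo_fun_cong[OF _ chart_domD(1)[OF W0] order_refl h]) (simp_all add: \<Phi>_def jets(2))
qed

text \<open>
  Translation of z by an integer does not change the base frame. Since the structure has values in an affine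
  space, its components on base frames are periodic holomorphic functions, hence constant.
\<close>

lemma structure_constant_on_base_frames:
  assumes z: "z \<in> \<Omega>" "z' \<in> \<Omega>"
  shows "\<phi> (jet M k (base_frame z)) = \<phi> (jet M k (base_frame z'))"
proof
  fix l
  show "\<phi> (jet M k (base_frame z)) l = \<phi> (jet M k (base_frame z')) l"
  proof (cases "l \<in> L")
    case True
    have "holo_fun Ix \<Omega> (\<lambda>z. \<phi> (jet M k (base_frame z)) l)"
    proof (rule holo_fun_local)
      show "\<Omega> \<subseteq> Cspace Ix" using ot_domain_sub by blast
      fix z assume "z \<in> \<Omega>"
      then obtain W0 where "chart_dom W0" "z \<in> W0" using ex_chart by blast
      then show "\<exists>T. z \<in> T \<and> T \<subseteq> \<Omega> \<and> holo_fun Ix T (\<lambda>z. \<phi> (jet M k (base_frame z)) l)"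
        using structure_on_base_frames_holo_chart[OF _ True] chart_domD(2) by (intro exI conjI)
    qed simp
    then show ?thesis
      by (rule periodic_holomorphic_constant[OF _ _ z]) (simp only: base_frame_translate)
  next
    case False
    then show ?thesis
      using structure_value(2)[OF frame_germ_base_frame] z by (simp add: Cspace_def)
  qed
qed

text \<open>
  By equivariance the jet of g acts on the two values by sending them to the values on the base frames,
  which agree. The jet of the inverse germ cancels this action.
\<close>

lemma structure_translation_invariant:
  assumes g: "fixing_germ Ix g" and z: "z \<in> \<Omega>" "z' \<in> \<Omega>"
  shows "\<phi> (jet M k (\<lambda>w. \<pi> (shift Ix z (g w)))) = \<phi> (jet M k (\<lambda>w. \<pi> (shift Ix z' (g w))))"
proof -
  obtain h where h: "fixing_germ Ix h" "jet (Cmfd Ix) k (h \<circ> g) = jet (Cmfd Ix) k (\<lambda>w. w)"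
    by (rule fixing_germ_inverse[OF finite_atLeastAtMost g]) (rule that)
  have A: "algebraic_jet_action Ix k L Z act"
    using is_structure unfolding affine_geometric_structure_def M_simps by blast
  have undo: "act (jet (Cmfd Ix) k h) (\<phi> (jet M k (base_frame z))) = \<phi> (jet M k (\<lambda>w. \<pi> (shift Ix z (g w))))"
    if z: "z \<in> \<Omega>" for z
  proof -
    define y where "y = \<phi> (jet M k (\<lambda>w. \<pi> (shift Ix z (g w))))"
    have "y \<in> Z" unfolding y_def by (rule structure_value(1)[OF frame_germ_shift[OF g z]])
    have "base_frame z \<circ> g = (\<lambda>w. \<pi> (shift Ix z (g w)))" by (simp add: base_frame_def fun_eq_iff)
    then have "act (jet (Cmfd Ix) k g) y = \<phi> (jet M k (base_frame z))"
      using is_structure frame_germ_base_frame[OF z] g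
      unfolding affine_geometric_structure_def M_simps y_def by metis
    then have "act (jet (Cmfd Ix) k h) (\<phi> (jet M k (base_frame z))) =
        act (jet (Cmfd Ix) k h) (act (jet (Cmfd Ix) k g) y)" by simp
    also have "\<dots> = act (jet (Cmfd Ix) k (h \<circ> g)) y"
      using A g h(1) \<open>y \<in> Z\<close> unfolding algebraic_jet_action_def by simp
    also have "\<dots> = y" using A \<open>y \<in> Z\<close> unfolding h(2) algebraic_jet_action_def by blast
    finally show ?thesis by (simp add: y_def)
  qed
  show ?thesis using undo[OF z(1)] undo[OF z(2)] structure_constant_on_base_frames[OF z] by simp
qed

text \<open>
  A frame and its translate have the same germ g and different base points.
\<close>

lemma translation_local_isometry:
  assumes W0: "chart_dom W0" and S: "open_in Ix S" "S \<subseteq> W0"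
    and b: "b \<in> Cspace Ix" and l: "\<And>z. z \<in> S \<Longrightarrow> line z b \<tau> \<in> W0"
  shows "local_isometry M k \<phi> (\<pi> ` S) (\<lambda>p. \<pi> (line (coord W0 p) b \<tau>))"
  unfolding local_isometry_def
proof (intro conjI allI impI)
  have SC: "S \<subseteq> Cspace Ix" using S(1) openin_imp_subset by blast
  define b' where "b' = (\<lambda>i. \<tau> * b i)"
  have b': "b' \<in> Cspace Ix" using b by (simp add: Cspace_def b'_def)
  have line: "line z b \<tau> = shift Ix b' z" if "z \<in> Cspace Ix" for z
    using that b by (auto simp: line_def shift_apply b'_def Cspace_def)
  show "biholomorphism_on M M (\<pi> ` S) (\<lambda>p. \<pi> (line (coord W0 p) b \<tau>))"
  proof (rule biholomorphism_M_M[OF W0 S(2) biholomorphism_shift[OF finite_atLeastAtMost S(1), of b']])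
    show "shift Ix b' ` S \<subseteq> W0" using l SC line by force
    show "\<pi> (line (coord W0 (\<pi> z)) b \<tau>) = \<pi> (shift Ix b' z)" if "z \<in> S" for z
      using coord_proj[OF W0] S(2) SC line that by (auto simp: subset_iff)
  qed
  fix r assume r: "frame_germ M r \<and> r origin \<in> \<pi> ` S"
  then obtain z where z: "z \<in> S" "r origin = \<pi> z" by auto
  have zW: "z \<in> W0" using z(1) S(2) by blast
  obtain g T where g: "fixing_germ Ix g" and T: "open_in Ix T" "origin \<in> T"
    and "\<And>i. i \<in> Ix \<Longrightarrow> holo_fun Ix T (\<lambda>w. g w i)" and gC: "\<And>w. w \<in> T \<Longrightarrow> g w \<in> Cspace Ix"
    and rT: "\<And>w. w \<in> T \<Longrightarrow> r w = \<pi> (shift Ix z (g w))" "\<And>w. w \<in> T \<Longrightarrow> shift Ix z (g w) \<in> W0"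
    "\<And>w. w \<in> T \<Longrightarrow> coord W0 (r w) = shift Ix z (g w)"
    by (rule frame_germ_lift[OF conjunct1[OF r] W0 zW z(2)]) (rule that)
  have fin: "finite (mindex M)" by (simp add: M_simps)
  have "jet M k ((\<lambda>p. \<pi> (line (coord W0 p) b \<tau>)) \<circ> r) = jet M k (\<lambda>w. \<pi> (shift Ix (line z b \<tau>) (g w)))"
  proof (rule jet_cong[OF fin, unfolded M_simps, OF T])
    fix w assume w: "w \<in> T"
    have "line (shift Ix z (g w)) b \<tau> = shift Ix (line z b \<tau>) (g w)"
      by (rule ext) (use b in \<open>auto simp: line_def shift_apply Cspace_def\<close>)
    then show "((\<lambda>p. \<pi> (line (coord W0 p) b \<tau>)) \<circ> r) w = \<pi> (shift Ix (line z b \<tau>) (g w))"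
      using rT(3)[OF w] by simp
  qed
  moreover have "jet M k r = jet M k (\<lambda>w. \<pi> (shift Ix z (g w)))"
    by (rule jet_cong[OF fin, unfolded M_simps, OF T]) (rule rT(1))
  moreover have "\<phi> (jet M k (\<lambda>w. \<pi> (shift Ix (line z b \<tau>) (g w)))) = \<phi> (jet M k (\<lambda>w. \<pi> (shift Ix z (g w))))"
    by (rule structure_translation_invariant[OF g]) (use l[OF z(1)] zW chart_domD(2)[OF W0] in auto)
  ultimately show "\<phi> (jet M k ((\<lambda>p. \<pi> (line (coord W0 p) b \<tau>)) \<circ> r)) = \<phi> (jet M k r)" by simp
qed

lemma const_field_killing:
  assumes W0: "chart_dom W0" and b: "b \<in> Cspace Ix"
  shows "killing_field M k \<phi> (\<pi> ` W0) (const_field W0 b)"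
  unfolding killing_field_def
proof (intro conjI ballI const_field_holomorphic[OF W0 b])
  fix x assume "x \<in> \<pi> ` W0"
  then obtain z where z: "z \<in> W0" "x = \<pi> z" by auto
  have zC: "z \<in> Cspace Ix" using z chart_domD(4)[OF W0] by blast
  from open_in_contains_polydisc[OF finite_atLeastAtMost chart_domD(1)[OF W0] z(1)]
  obtain r where r: "r > 0" "polydisc Ix z r \<subseteq> W0" by (elim exE conjE)
  (* Points of S move by less than r/2 in each coordinate when the time is less than \<epsilon>. *)
  define S where "S = polydisc Ix z (r / 2)"
  define B where "B = 1 + (\<Sum>i\<in>Ix. norm (b i))"
  define \<epsilon> where "\<epsilon> = r / 2 / B"
  have B: "B > 0" unfolding B_def by (intro add_pos_nonneg sum_nonneg) auto
  have So: "open_in Ix S" unfolding S_def by (rule open_in_polydisc) simp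
  have SW: "S \<subseteq> W0"
  proof -
    have "S \<subseteq> polydisc Ix z r" using r(1) by (auto simp: S_def polydisc_def)
    then show ?thesis using r(2) by blast
  qed
  have l: "line y b \<tau> \<in> W0" if y: "y \<in> S" and \<tau>: "\<tau> \<in> ball 0 \<epsilon>" for y \<tau>
  proof -
    have yC: "y \<in> Cspace Ix" using y by (simp add: S_def polydisc_def)
    have "dist (line y b \<tau> i) (z i) < r" if i: "i \<in> Ix" for i
    proof -
      have "norm (b i) \<le> (\<Sum>i\<in>Ix. norm (b i))" by (rule member_le_sum[OF i]) auto
      then have "norm (b i) \<le> B" by (simp add: B_def)
      then have "norm (\<tau> * b i) \<le> norm \<tau> * B" unfolding norm_mult by (intro mult_left_mono) auto
      also have "\<dots> < \<epsilon> * B" using \<tau> B by (intro mult_strict_right_mono) auto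
      also have "\<dots> = r / 2" using B by (simp add: \<epsilon>_def)
      finally have 1: "norm (\<tau> * b i) < r / 2" .
      have 2: "dist (y i) (z i) < r / 2" using y i unfolding S_def polydisc_def by blast
      have "dist (line y b \<tau> i) (z i) \<le> dist (y i) (z i) + norm (\<tau> * b i)"
        using norm_triangle_ineq[of "y i - z i" "\<tau> * b i"] by (simp add: dist_norm line_def algebra_simps)
      then show ?thesis using 1 2 by linarith
    qed
    then have "line y b \<tau> \<in> polydisc Ix z r" using line_Cspace[OF yC b] unfolding polydisc_def by blast
    then show ?thesis using r(2) by blast
  qed
  have cS: "coord W0 (\<pi> y) = y" if "y \<in> S" for y using coord_proj[OF W0] SW that by blast
  show "\<exists>W \<epsilon> \<Psi>. openin (mtop M) W \<and> x \<in> W \<and> W \<subseteq> \<pi> ` W0 \<and> \<epsilon> > 0 \<and>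
    (\<forall>p\<in>W. \<Psi> 0 p = p \<and> integral_curve M (\<pi> ` W0) (const_field W0 b) \<epsilon> (\<lambda>\<tau>. \<Psi> \<tau> p)) \<and>
    (\<forall>\<tau>\<in>ball 0 \<epsilon>. local_isometry M k \<phi> W (\<Psi> \<tau>))"
  proof (intro exI conjI ballI)
    show "openin (mtop M) (\<pi> ` S)" by (rule proj_open[OF So]) (use SW chart_domD(2)[OF W0] in blast)
    have "z \<in> S" unfolding S_def by (rule polydisc_center[OF zC]) (use r(1) in simp)
    then show "x \<in> \<pi> ` S" using z(2) by simp
    show "\<pi> ` S \<subseteq> \<pi> ` W0" using SW by blast
    show "\<epsilon> > 0" using r(1) B by (simp add: \<epsilon>_def)
    show "local_isometry M k \<phi> (\<pi> ` S) ((\<lambda>\<tau> p. \<pi> (line (coord W0 p) b \<tau>)) \<tau>)" if "\<tau> \<in> ball 0 \<epsilon>" for \<tau>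
      by (rule translation_local_isometry[OF W0 So SW b]) (rule l[OF _ that])
    fix p assume "p \<in> \<pi> ` S"
    then obtain y where y: "y \<in> S" "p = \<pi> y" by auto
    show "(\<lambda>\<tau> p. \<pi> (line (coord W0 p) b \<tau>)) 0 p = p" using y cS by (simp add: line_0)
    have yC: "y \<in> Cspace Ix" using y by (simp add: S_def polydisc_def)
    show "integral_curve M (\<pi> ` W0) (const_field W0 b) \<epsilon> (\<lambda>\<tau>. (\<lambda>\<tau> p. \<pi> (line (coord W0 p) b \<tau>)) \<tau> p)"
      using const_field_integral_curve[OF W0 yC b l[OF y(1)]] y cS by simp
  qed
qed

end

end

theorem theorem1p1:
  fixes \<sigma> :: "nat \<Rightarrow> 'f::field_char_0 \<Rightarrow> complex"
    and U :: "'f set"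
    and s t k N :: nat
    and Z :: "(nat \<Rightarrow> complex) set"
    and act :: "((nat \<Rightarrow> complex) \<Rightarrow> nat \<Rightarrow> complex) set \<Rightarrow> (nat \<Rightarrow> complex) \<Rightarrow> nat \<Rightarrow> complex"
    and \<phi> :: "((nat \<Rightarrow> complex) \<Rightarrow> (nat \<Rightarrow> complex) set) set \<Rightarrow> nat \<Rightarrow> complex"
    and M :: "((nat \<Rightarrow> complex) set, nat) cmfd"
  assumes "s > 0" and "t > 0"
    and "ordered_embeddings s t \<sigma>"
    and "admissible s t \<sigma> U"
    and "M = ot_manifold s t \<sigma> U"
    and "affine_geometric_structure M k {1..N} Z act \<phi>"
  shows "locally_homogeneous_on M k \<phi> (topspace (mtop M)) \<and>
    transitive_on M (topspace (mtop M))
      {(V, X). affine_vector_field M V X \<and> killing_field M k \<phi> V X}"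
proof -
  interpret ot_setting s t \<sigma> U
    using assms(1-4) by unfold_locales
  have "affine_vector_field M (\<pi> ` W) (const_field W b) \<and> killing_field M k \<phi> (\<pi> ` W) (const_field W b)"
    if "chart_dom W" "b \<in> Cspace Ix" for W b
    using const_field_affine[OF that] const_field_killing[OF assms(6)[unfolded assms(5)] that]
    by (simp only: assms(5) simp_thms)
  then show ?thesis
    unfolding locally_homogeneous_on_def assms(5) by (intro conjI const_fields_transitive) simp_all
qed

end
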